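(* Every cubic graph has a straight-line drawing in the plane in which the slope of every edge belongs to the set $\{0,\pi/4,\pi/2,3\pi/4\}$ of the four basic slopes.
   Context: Graphs are finite and simple, and not assumed connected. A graph is cubic if it is $3$-regular. A straight-line drawing of a graph $G$ represents the vertices of $G$ by distinct points of the plane and every edge by the straight-line segment connecting the points of its two endpoints, such that this segment does not pass through any other vertex of $G$. Edges may cross. The slope of an edge is the slope of the corresponding segment, expressed as the angle (modulo $\pi$) that the line through the segment makes with the $x$-axis; the four basic slopes $0,\pi/4,\pi/2,3\pi/4$ are thus the horizontal, the vertical and the two diagonal directions. *)

theory Defs
  imports "HOL-Analysis.Analysis"
begin

definition simple_graph :: "'a set \<Rightarrow> 'a set set \<Rightarrow> bool" where
  "simple_graph V E \<longleftrightarrow> finite V \<and> (\<forall>e\<in>E. e \<subseteq> V \<and> card e = 2)"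

definition vertex_degree :: "'a set set \<Rightarrow> 'a \<Rightarrow> nat" where
  "vertex_degree E v = card {e \<in> E. v \<in> e}"

definition cubic_graph :: "'a set \<Rightarrow> 'a set set \<Rightarrow> bool" where
  "cubic_graph V E \<longleftrightarrow> simple_graph V E \<and> (\<forall>v\<in>V. vertex_degree E v = 3)"

text \<open>An edge is drawn as the segment between the images of its two ends, so a
  straight-line drawing is determined by the placement of the vertices.\<close>

definition straight_line_drawing ::
    "'a set \<Rightarrow> 'a set set \<Rightarrow> ('a \<Rightarrow> real \<times> real) \<Rightarrow> bool" where
  "straight_line_drawing V E f \<longleftrightarrow>
     inj_on f V \<and>
     (\<forall>u v. {u, v} \<in> E \<longrightarrow> (\<forall>w \<in> V - {u, v}. f w \<notin> closed_segment (f u) (f v)))"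

text \<open>Angles modulo \<open>\<pi>\<close> are represented by their representatives in \<open>[0, \<pi>)\<close>.
  The scalar \<open>r\<close> may be negative: the line through \<open>p\<close> and \<open>q\<close> is undirected.
  The value is meaningful only for \<open>p \<noteq> q\<close>.\<close>

definition slope :: "real \<times> real \<Rightarrow> real \<times> real \<Rightarrow> real" where
  "slope p q = (THE \<theta>. 0 \<le> \<theta> \<and> \<theta> < pi \<and> (\<exists>r. q - p = r *\<^sub>R (cos \<theta>, sin \<theta>)))"

definition basic_slopes :: "real set" where
  "basic_slopes = {0, pi / 4, pi / 2, 3 * pi / 4}"

lemma slope_unique:
  assumes "p \<noteq> q"
  shows "\<exists>!\<theta>. 0 \<le> \<theta> \<and> \<theta> < pi \<and> (\<exists>r. q - p = r *\<^sub>R (cos \<theta>, sin \<theta>))"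
proof -
  obtain a b where ab: "q - p = (a, b)" by (cases "q - p")
  have nz: "(a, b) \<noteq> (0, 0)"
    using assms ab by (metis eq_iff_diff_eq_0 zero_prod_def)
  define z where "z = Complex a b"
  have z: "a = cmod z * cos (Arg z)" "b = cmod z * sin (Arg z)"
    using rcis_cmod_Arg[of z] unfolding z_def
    by (metis complex.sel(1) Re_rcis, metis complex.sel(2) Im_rcis)
  have ex: "\<exists>\<theta>. 0 \<le> \<theta> \<and> \<theta> < pi \<and> (\<exists>r. (a, b) = r *\<^sub>R (cos \<theta>, sin \<theta>))"
  proof -
    have bd: "- pi < Arg z" "Arg z \<le> pi" using Arg_bounded by auto
    consider "Arg z < 0" | "Arg z = pi" | "0 \<le> Arg z" "Arg z < pi" using bd by linarith
    then show ?thesis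
    proof cases
      case 1
      show ?thesis
        by (rule exI[of _ "Arg z + pi"]) (use 1 bd z in \<open>auto intro!: exI[of _ "- cmod z"]\<close>)
    next
      case 2
      show ?thesis
        by (rule exI[of _ 0]) (use 2 z in \<open>auto intro!: exI[of _ "- cmod z"]\<close>)
    next
      case 3
      show ?thesis
        by (rule exI[of _ "Arg z"]) (use 3 z in \<open>auto intro!: exI[of _ "cmod z"]\<close>)
    qed
  qed
  have uniq: "s = t"
    if s: "0 \<le> s" "s < pi" "(a, b) = r *\<^sub>R (cos s, sin s)"
      and t: "0 \<le> t" "t < pi" "(a, b) = r' *\<^sub>R (cos t, sin t)" for s t r r'
  proof -
    have r: "r \<noteq> 0" "r' \<noteq> 0" using nz s(3) t(3) by auto
    have "r * r' * sin (s - t) = (r * sin s) * (r' * cos t) - (r * cos s) * (r' * sin t)"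
      by (simp add: sin_diff algebra_simps)
    also have "\<dots> = 0" using s(3) t(3) by simp
    finally have 0: "sin (s - t) = 0" using r by simp
    have "\<not> s < t" using sin_gt_zero[of "t - s"] 0 s t sin_minus[of "s - t"] by auto
    moreover have "\<not> t < s" using sin_gt_zero[of "s - t"] 0 s t by auto
    ultimately show ?thesis by simp
  qed
  show ?thesis unfolding ab using ex uniq by blast
qed

end

theory Submission imports Defs begin

text \<open>Assign one of the four directions to every edge, properly. The placements of the vertices in which
  every edge has its direction form a vector space, and a generic one is a drawing unless the line of
  some edge \<open>uv\<close> is forced to pass through some other vertex \<open>w\<close>; by linear duality such a coincidence
  is witnessed by a stress that is in equilibrium everywhere except at \<open>w\<close>. At a vertex of degree
  three a stress is zero on all edges or on none, so a cut with at least three edges spreads a single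
  zero over the whole graph.

  In a 3-edge-connected cubic graph there is a perfect matching. Its edges are made vertical except for
  one or two edges joining different cycles of the complement, and each of these cycles is coloured
  alternately by the diagonals except for one horizontal edge. Balancing vertical forces over a cycle,
  or comparing the magnitudes of the stress along the cycles, produces a zero. If the graph is
  3-edge-colourable, two colour classes are drawn diagonally, and a zero is produced by
  subtracting an explicit self-stress.

  A graph with smaller cuts contains a minimal vertex set with two edges leaving it. It is drawn so that
  these edges can leave along a line or along two perpendicular rays, enlarged while their outer ends
  coincide or are adjacent, and finally inserted at a tiny scale into an edge of a drawing of a smaller
  cubic graph.\<close>

subsection \<open>Linear functionals on configurations\<close>

text \<open>The cut argument runs as follows. Let S be the vertices other than \<open>w\<close>
  where the stress does not vanish. Every edge leaving S ends at \<open>w\<close>, except possibly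
  \<open>uv\<close>. As \<open>w\<close> has only three edges, either S or S together with
  \<open>w\<close> would be left by at most two edges. Hence a single zero away from
  \<open>w\<close> is fatal.

  The obstacle is graphs without a 3-edge-colouring, where the explicit self-stress is missing and
  the cycles left by a matching are odd. If the whole matching is vertical, the balance over a cycle
  says nothing, because the normal of a vertical edge has second coordinate 0. Tilting exactly one
  matching edge that leaves the cycle makes its stress the only surviving term. This fails when
  \<open>w\<close> and \<open>uv\<close> lie on different sides of the cut. Then magnitudes decide:
  at a vertex the colours fix the ratios of the three forces to 1 or 2, and by parity a value
  carried along a cycle cannot change at exactly one vertex.

  For a piece, the two leaving edges can be given any two different directions, but in general not
  equal ones; this is the reason for corners.\<close>

definition linear_functional :: "(('a \<Rightarrow> real \<times> real) \<Rightarrow> real) \<Rightarrow> bool" where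
  "linear_functional \<Phi> \<longleftrightarrow> (\<forall>f g t. \<Phi> (\<lambda>x. f x + t *\<^sub>R g x) = \<Phi> f + t * \<Phi> g)"

lemma linear_functionalD:
  "linear_functional \<Phi> \<Longrightarrow> \<Phi> (\<lambda>x. f x + t *\<^sub>R g x) = \<Phi> f + t * \<Phi> g"
  by (simp add: linear_functional_def)

text \<open>The configuration space may be infinite-dimensional, so the induction runs over the
  functionals. If \<open>F i\<close> vanishes on the common kernel of the others, it gets
  coefficient 0. Otherwise a point \<open>h\<close> of that kernel with \<open>F i h\<close> nonzero
  determines the coefficient of \<open>F i\<close>, and what remains of \<open>L\<close> vanishes on
  that kernel.\<close>

lemma functional_in_span_if_vanishes_on_kernel:
  assumes "finite I" "\<And>i. i \<in> I \<Longrightarrow> linear_functional (F i)" "linear_functional L"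
    and "\<And>f. (\<forall>i\<in>I. F i f = 0) \<Longrightarrow> L f = 0"
  shows "\<exists>c. \<forall>f. L f = (\<Sum>i\<in>I. c i * F i f)"
  using assms
proof (induction I arbitrary: L rule: finite_induct)
  case empty
  then show ?case by simp
next
  case (insert i I)
  show ?case
  proof (cases "\<forall>f. (\<forall>j\<in>I. F j f = 0) \<longrightarrow> F i f = 0")
    case True
    then have "\<exists>c. \<forall>f. L f = (\<Sum>j\<in>I. c j * F j f)"
      by (intro insert.IH) (use insert.prems in auto)
    then obtain c where c: "\<forall>f. L f = (\<Sum>j\<in>I. c j * F j f)" by blast
    have "(\<Sum>j\<in>I. (c(i := 0)) j * F j f) = (\<Sum>j\<in>I. c j * F j f)" for f
      by (rule sum.cong) (use insert.hyps in auto)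
    then show ?thesis using c insert.hyps by (intro exI[of _ "c(i := 0)"]) simp
  next
    case False
    then obtain h where h: "\<forall>j\<in>I. F j h = 0" "F i h \<noteq> 0" by blast
    define q where "q = L h / F i h"
    define L' where "L' = (\<lambda>f. L f - q * F i f)"
    have lin: "linear_functional (F i)" "linear_functional L" using insert.prems by auto
    have "linear_functional L'"
      unfolding linear_functional_def L'_def
      by (simp add: linear_functionalD[OF lin(1)] linear_functionalD[OF lin(2)] algebra_simps)
    moreover have "L' f = 0" if f: "\<forall>j\<in>I. F j f = 0" for f
    proof -
      define t where "t = - (F i f / F i h)"
      have "F j (\<lambda>x. f x + t *\<^sub>R h x) = 0" if "j \<in> insert i I" for j
        using that f h insert.prems(1)[OF that]
        by (auto simp: linear_functionalD[OF insert.prems(1)[OF that]] t_def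
            simp del: scaleR_minus_left)
      then have "L (\<lambda>x. f x + t *\<^sub>R h x) = 0" using insert.prems(3) by blast
      then have "L f + t * L h = 0" by (simp only: linear_functionalD[OF lin(2)])
      then show ?thesis using h by (simp add: L'_def t_def q_def)
    qed
    ultimately have "\<exists>c. \<forall>f. L' f = (\<Sum>j\<in>I. c j * F j f)"
      by (intro insert.IH) (use insert.prems in auto)
    then obtain c where c: "\<forall>f. L' f = (\<Sum>j\<in>I. c j * F j f)" by blast
    have "(\<Sum>j\<in>I. (c(i := q)) j * F j f) = (\<Sum>j\<in>I. c j * F j f)" for f
      by (rule sum.cong) (use insert.hyps in auto)
    moreover have "L f = q * F i f + L' f" for f by (simp add: L'_def)
    ultimately show ?thesis using c insert.hyps by (intro exI[of _ "c(i := q)"]) simp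
  qed
qed

text \<open>On the line through \<open>f\<close> with direction \<open>g\<close>, a functional that
  is not identically zero there vanishes for at most one parameter. A point that is good for
  \<open>Q\<close> can thus be moved along a line to become good for one more functional.\<close>

lemma generic_point_avoids_functionals:
  assumes "finite Q" "S \<noteq> {}"
    and S: "\<And>f g t. f \<in> S \<Longrightarrow> g \<in> S \<Longrightarrow> (\<lambda>x. f x + t *\<^sub>R g x) \<in> S"
    and "\<And>q. q \<in> Q \<Longrightarrow> linear_functional (F q)"
    and "\<And>q. q \<in> Q \<Longrightarrow> \<exists>f\<in>S. F q f \<noteq> 0"
  shows "\<exists>f\<in>S. \<forall>q\<in>Q. F q f \<noteq> 0"
  using assms(1,4,5)
proof (induction Q rule: finite_induct)
  case empty
  then show ?case using \<open>S \<noteq> {}\<close> by auto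
next
  case (insert q Q)
  then obtain f where f: "f \<in> S" "\<forall>r\<in>Q. F r f \<noteq> 0" by auto
  obtain g where g: "g \<in> S" "F q g \<noteq> 0" using insert.prems by blast
  define bad where "bad = insert (- F q f / F q g) ((\<lambda>r. - F r f / F r g) ` Q)"
  have "finite bad" using insert.hyps by (simp add: bad_def)
  then obtain t where t: "t \<notin> bad" using ex_new_if_finite infinite_UNIV_char_0 by blast
  have "F r (\<lambda>x. f x + t *\<^sub>R g x) \<noteq> 0" if r: "r \<in> insert q Q" for r
  proof
    assume "F r (\<lambda>x. f x + t *\<^sub>R g x) = 0"
    then have 0: "F r f + t * F r g = 0" using insert.prems(1)[OF r] by (simp add: linear_functionalD)
    show False
    proof (cases "F r g = 0")
      case True
      then show False using 0 r f g by auto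
    next
      case False
      then have "t = - F r f / F r g" using 0 by (simp add: field_simps)
      then show False using t r by (auto simp: bad_def)
    qed
  qed
  then show ?case using S[OF f(1) g(1)] by blast
qed

subsection \<open>The four directions\<close>

text \<open>A line with direction \<open>s\<close> is a level set of the inner product with the normal vector
  \<open>nrm s\<close>; \<open>Dp\<close> and \<open>Dn\<close> are the diagonals of slope \<open>1\<close> and \<open>-1\<close>.\<close>

datatype dir = Dh | Dp | Dv | Dn

fun nrm :: "dir \<Rightarrow> real \<times> real" where
  "nrm Dh = (0, 1)"
| "nrm Dp = (-1, 1)"
| "nrm Dv = (1, 0)"
| "nrm Dn = (1, 1)"

lemma UNIV_dir: "(UNIV :: dir set) = {Dh, Dp, Dv, Dn}"
  using dir.exhaust by auto

lemma nrm_independent: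
  "s \<noteq> t \<Longrightarrow> a *\<^sub>R nrm s + b *\<^sub>R nrm t = 0 \<Longrightarrow> a = 0 \<and> b = 0"
  by (cases s; cases t) (auto simp: zero_prod_def)

lemma nrm_nonzero [simp]: "nrm s \<noteq> 0"
  by (cases s) (auto simp: zero_prod_def)

text \<open>The zero vector qualifies as well; in drawings it is excluded by injectivity.\<close>

definition basic_dir :: "real \<times> real \<Rightarrow> bool" where
  "basic_dir q \<longleftrightarrow> fst q = 0 \<or> snd q = 0 \<or> snd q = fst q \<or> snd q = - fst q"

lemma basic_dir_nrm: "nrm s \<bullet> q = 0 \<Longrightarrow> basic_dir q"
  by (cases s; cases q) (auto simp: basic_dir_def)

lemma basic_dir_minus_commute: "basic_dir (p - q) \<longleftrightarrow> basic_dir (q - p)"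
  by (auto simp: basic_dir_def)

lemma slope_basic:
  assumes "p \<noteq> q" "basic_dir (q - p)"
  shows "slope p q \<in> basic_slopes"
proof -
  obtain a b where ab: "q - p = (a, b)" by (cases "q - p")
  have s: "slope p q = \<theta>" if "0 \<le> \<theta>" "\<theta> < pi" "(a, b) = r *\<^sub>R (cos \<theta>, sin \<theta>)" for \<theta> r
    unfolding slope_def
    by (rule the1_equality[OF slope_unique[OF assms(1)]]) (use that ab in auto)
  have pp: "0 < pi" by (rule pi_gt_zero)
  have c135: "cos (3 * pi / 4) = - (sqrt 2 / 2)" "sin (3 * pi / 4) = sqrt 2 / 2"
    using cos_diff[of pi "pi / 4"] sin_diff[of pi "pi / 4"] by (simp_all add: cos_45 sin_45)
  have q: "a = 0 \<or> b = 0 \<or> b = a \<or> b = - a"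
    using assms(2) ab by (auto simp: basic_dir_def)
  have "a = 0 \<Longrightarrow> slope p q = pi / 2"
    by (rule s[of _ b]) (use pp in \<open>auto simp: cos_pi_half\<close>)
  moreover have "b = 0 \<Longrightarrow> slope p q = 0"
    by (rule s[of _ a]) (use pp in auto)
  moreover have "b = a \<Longrightarrow> slope p q = pi / 4"
    by (rule s[of _ "a * sqrt 2"]) (use pp in \<open>auto simp: cos_45 sin_45\<close>)
  moreover have "b = - a \<Longrightarrow> slope p q = 3 * pi / 4"
    by (rule s[of _ "- a * sqrt 2"]) (use pp in \<open>auto simp: c135\<close>)
  ultimately show ?thesis using q by (auto simp: basic_slopes_def)
qed

definition basic_drawing :: "'a set \<Rightarrow> 'a set set \<Rightarrow> ('a \<Rightarrow> real \<times> real) \<Rightarrow> bool" where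
  "basic_drawing V E f \<longleftrightarrow> inj_on f V \<and>
     (\<forall>u v. {u, v} \<in> E \<longrightarrow> basic_dir (f u - f v) \<and>
        (\<forall>w \<in> V - {u, v}. f w \<notin> closed_segment (f u) (f v)))"

lemma basic_drawing_slopes:
  assumes "simple_graph V E" "basic_drawing V E f"
  shows "straight_line_drawing V E f \<and> (\<forall>u v. {u, v} \<in> E \<longrightarrow> slope (f u) (f v) \<in> basic_slopes)"
proof -
  have "slope (f u) (f v) \<in> basic_slopes" if e: "{u, v} \<in> E" for u v
  proof -
    have "u \<in> V" "v \<in> V" "u \<noteq> v" using e assms(1) by (auto simp: simple_graph_def card_2_iff)
    then have "f u \<noteq> f v" using assms(2) by (auto simp: basic_drawing_def inj_on_def)
    then show ?thesis using assms(2) e basic_dir_minus_commute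
      by (intro slope_basic) (auto simp: basic_drawing_def)
  qed
  then show ?thesis using assms(2) by (auto simp: basic_drawing_def straight_line_drawing_def)
qed

lemma inner_on_segment:
  fixes n :: "real \<times> real"
  assumes "p \<in> closed_segment a b" "n \<bullet> a = n \<bullet> b"
  shows "n \<bullet> p = n \<bullet> a"
proof -
  obtain u where "p = (1 - u) *\<^sub>R a + u *\<^sub>R b" using assms(1) by (auto simp: closed_segment_def)
  then have "n \<bullet> p = (1 - u) * (n \<bullet> a) + u * (n \<bullet> b)"
    by (simp only: inner_add_right inner_scaleR_right)
  then show ?thesis using assms(2) by (simp add: algebra_simps)
qed

lemma inner_on_segment_less:
  fixes n :: "real \<times> real"
  assumes "p \<in> closed_segment a b" "n \<bullet> a < r" "n \<bullet> b < r"
  shows "n \<bullet> p < r"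
proof -
  have "convex {x. n \<bullet> x < r}" by (rule convex_halfspace_lt)
  then have "closed_segment a b \<subseteq> {x. n \<bullet> x < r}" using assms by (intro closed_segment_subset) auto
  then show ?thesis using assms(1) by auto
qed

subsection \<open>Edge colourings by directions and their stresses\<close>

definition nb :: "'a set set \<Rightarrow> 'a \<Rightarrow> 'a set" where
  "nb E x = {y. {x, y} \<in> E}"

definition proper :: "'a set set \<Rightarrow> ('a set \<Rightarrow> 'c) \<Rightarrow> bool" where
  "proper E \<kappa> \<longleftrightarrow> (\<forall>x. inj_on (\<lambda>y. \<kappa> {x, y}) (nb E x))"

definition conforms :: "'a set set \<Rightarrow> ('a set \<Rightarrow> dir) \<Rightarrow> ('a \<Rightarrow> real \<times> real) \<Rightarrow> bool" where
  "conforms E \<kappa> f \<longleftrightarrow> (\<forall>x y. {x, y} \<in> E \<longrightarrow> nrm (\<kappa> {x, y}) \<bullet> f x = nrm (\<kappa> {x, y}) \<bullet> f y)"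

text \<open>A stress witnesses, by duality, that the line of the edge \<open>uv\<close> passes through \<open>w\<close> in every
  configuration that conforms to the colouring. The unit force along \<open>uv\<close> is recorded as the
  failure of antisymmetry on that edge, and equilibrium is not required at \<open>w\<close>.\<close>

definition stress ::
  "'a set \<Rightarrow> 'a set set \<Rightarrow> ('a set \<Rightarrow> dir) \<Rightarrow> 'a \<Rightarrow> 'a \<Rightarrow> 'a \<Rightarrow> ('a \<Rightarrow> 'a \<Rightarrow> real) \<Rightarrow> bool" where
  "stress V E \<kappa> u v w \<omega> \<longleftrightarrow>
     (\<forall>x y. {x, y} \<in> E \<and> {x, y} \<noteq> {u, v} \<longrightarrow> \<omega> x y = - \<omega> y x) \<and>
     \<omega> u v + \<omega> v u = 1 \<and>
     (\<forall>z\<in>V - {w}. (\<Sum>y\<in>nb E z. \<omega> z y *\<^sub>R nrm (\<kappa> {z, y})) = 0)"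

lemma simple_graph_edgeD:
  assumes "simple_graph V E" "{x, y} \<in> E"
  shows "x \<in> V" "y \<in> V" "x \<noteq> y"
  using assms by (auto simp: simple_graph_def card_2_iff)

lemma simple_graph_edgeE:
  assumes "simple_graph V E" "e \<in> E" "x \<in> e"
  obtains y where "e = {x, y}" "y \<noteq> x" "x \<in> V" "y \<in> V"
proof -
  obtain a b where ab: "e = {a, b}" "a \<noteq> b" "e \<subseteq> V"
    using assms by (auto simp: simple_graph_def card_2_iff)
  consider "x = a" | "x = b" using ab assms(3) by blast
  then show thesis
  proof cases
    case 1
    then show thesis using that[of b] ab by auto
  next
    case 2
    then show thesis using that[of a] ab by auto
  qed
qed

lemma nb_sym: "y \<in> nb E x \<longleftrightarrow> x \<in> nb E y"
  by (simp add: nb_def insert_commute)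

lemma nb_subset: "simple_graph V E \<Longrightarrow> nb E x \<subseteq> V - {x}"
  by (auto simp: nb_def simple_graph_edgeD dest: simple_graph_edgeD(3))

lemma finite_nb: "simple_graph V E \<Longrightarrow> finite (nb E x)"
  by (rule finite_subset[OF nb_subset]) (auto simp: simple_graph_def)

lemma finite_edges: "simple_graph V E \<Longrightarrow> finite E"
  by (rule finite_subset[of _ "Pow V"]) (auto simp: simple_graph_def)

lemma vertex_degree_nb:
  assumes "simple_graph V E"
  shows "vertex_degree E x = card (nb E x)"
proof -
  have "{e \<in> E. x \<in> e} = (\<lambda>y. {x, y}) ` nb E x"
  proof (intro equalityI subsetI)
    fix e assume e: "e \<in> {e \<in> E. x \<in> e}"
    then obtain y where "e = {x, y}" using simple_graph_edgeE[OF assms] by blast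
    then show "e \<in> (\<lambda>y. {x, y}) ` nb E x" using e by (auto simp: nb_def)
  qed (auto simp: nb_def)
  moreover have "inj_on (\<lambda>y. {x, y}) (nb E x)"
    by (auto simp: inj_on_def doubleton_eq_iff)
  ultimately show ?thesis by (simp add: vertex_degree_def card_image)
qed

text \<open>Linear duality: the forced incidence is a functional that vanishes on all conforming
  configurations, hence a combination of the edge conditions. The coefficients, read vertex by
  vertex, are the forces.\<close>

lemma stress_if_forced:
  assumes G: "simple_graph V E" and e: "{u, v} \<in> E" and w: "w \<in> V" "w \<noteq> u" "w \<noteq> v"
    and forced: "\<And>f. conforms E \<kappa> f \<Longrightarrow> nrm (\<kappa> {u, v}) \<bullet> f w = nrm (\<kappa> {u, v}) \<bullet> f u"
  shows "\<exists>\<omega>. stress V E \<kappa> u v w \<omega>"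
proof -
  let ?n = "\<lambda>x y. nrm (\<kappa> {x, y})"
  define I where "I = Sigma V (nb E)"
  define F where "F = (\<lambda>(x, y) f. ?n x y \<bullet> f x - ?n x y \<bullet> f y)"
  define L where "L = (\<lambda>f. ?n u v \<bullet> f w - ?n u v \<bullet> f u)"
  have finV: "finite V" using G by (simp add: simple_graph_def)
  have finI: "finite I" unfolding I_def using finV finite_nb[OF G] by auto
  have "\<exists>c. \<forall>f. L f = (\<Sum>i\<in>I. c i * F i f)"
  proof (rule functional_in_span_if_vanishes_on_kernel[OF finI])
    show "linear_functional (F i)" for i
      by (cases i) (simp add: F_def linear_functional_def inner_add_right algebra_simps)
    show "linear_functional L"
      by (simp add: L_def linear_functional_def inner_add_right algebra_simps)
    fix f assume "\<forall>i\<in>I. F i f = 0"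
    then have "conforms E \<kappa> f"
      using simple_graph_edgeD[OF G] by (fastforce simp: conforms_def I_def F_def nb_def)
    then show "L f = 0" using forced by (simp add: L_def)
  qed
  then obtain c where c: "\<And>f. L f = (\<Sum>i\<in>I. c i * F i f)" by blast
  \<comment> \<open>Every edge occurs in \<open>I\<close> in both orientations, so the force on it
    is the difference of the two coefficients.\<close>
  define \<omega>0 where "\<omega>0 = (\<lambda>x y. c (x, y) - c (y, x))"
  have eq0: "(\<Sum>y\<in>nb E z. \<omega>0 z y *\<^sub>R ?n z y) = (if z = u then - ?n u v else 0)"
    if z: "z \<in> V" "z \<noteq> w" for z
  proof -
    have "(\<Sum>y\<in>nb E z. \<omega>0 z y *\<^sub>R ?n z y) \<bullet> q = (if z = u then - ?n u v else 0) \<bullet> q" for q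
    proof -
      \<comment> \<open>Testing the identity on a configuration that moves only \<open>z\<close>
        isolates the forces at \<open>z\<close>.\<close>
      define f where "f = (\<lambda>x. if x = z then q else 0)"
      have a: "(\<Sum>x\<in>V. \<Sum>y\<in>nb E x. c (x, y) * (?n x y \<bullet> f x))
          = (\<Sum>y\<in>nb E z. c (z, y) * (?n z y \<bullet> q))"
      proof -
        have "(\<Sum>x\<in>V. \<Sum>y\<in>nb E x. c (x, y) * (?n x y \<bullet> f x))
            = (\<Sum>x\<in>V. if x = z then \<Sum>y\<in>nb E z. c (z, y) * (?n z y \<bullet> q) else 0)"
          by (rule sum.cong) (auto simp: f_def)
        then show ?thesis using z finV by simp
      qed
      have b: "(\<Sum>x\<in>V. \<Sum>y\<in>nb E x. c (x, y) * (?n x y \<bullet> f y))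
          = (\<Sum>y\<in>nb E z. c (y, z) * (?n z y \<bullet> q))"
      proof -
        have "(\<Sum>x\<in>V. \<Sum>y\<in>nb E x. c (x, y) * (?n x y \<bullet> f y))
            = (\<Sum>x\<in>V. if x \<in> nb E z then c (x, z) * (?n z x \<bullet> q) else 0)"
        proof (rule sum.cong)
          fix x assume "x \<in> V"
          have "(\<Sum>y\<in>nb E x. c (x, y) * (?n x y \<bullet> f y))
              = (\<Sum>y\<in>nb E x. if y = z then c (x, z) * (?n x z \<bullet> q) else 0)"
            by (rule sum.cong) (auto simp: f_def)
          also have "\<dots> = (if z \<in> nb E x then c (x, z) * (?n x z \<bullet> q) else 0)"
            using finite_nb[OF G] by simp
          finally show "(\<Sum>y\<in>nb E x. c (x, y) * (?n x y \<bullet> f y))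
              = (if x \<in> nb E z then c (x, z) * (?n z x \<bullet> q) else 0)"
            using nb_sym[of z E x] by (simp add: insert_commute)
        qed simp
        also have "\<dots> = (\<Sum>x\<in>V \<inter> nb E z. c (x, z) * (?n z x \<bullet> q))"
          by (rule sum.inter_restrict[OF finV, symmetric])
        also have "V \<inter> nb E z = nb E z" using nb_subset[OF G] by blast
        finally show ?thesis .
      qed
      have "L f = (\<Sum>x\<in>V. \<Sum>y\<in>nb E x. c (x, y) * F (x, y) f)"
        unfolding c I_def using finV finite_nb[OF G]
        by (subst sum.Sigma) (auto simp: split_def)
      also have "\<dots> = (\<Sum>x\<in>V. \<Sum>y\<in>nb E x. c (x, y) * (?n x y \<bullet> f x))
          - (\<Sum>x\<in>V. \<Sum>y\<in>nb E x. c (x, y) * (?n x y \<bullet> f y))"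
        by (simp add: F_def right_diff_distrib sum_subtractf)
      also have "\<dots> = (\<Sum>y\<in>nb E z. \<omega>0 z y * (?n z y \<bullet> q))"
        unfolding a b by (simp add: \<omega>0_def left_diff_distrib sum_subtractf)
      also have "\<dots> = (\<Sum>y\<in>nb E z. \<omega>0 z y *\<^sub>R ?n z y) \<bullet> q"
        by (simp add: inner_sum_left)
      finally have "L f = (\<Sum>y\<in>nb E z. \<omega>0 z y *\<^sub>R ?n z y) \<bullet> q" .
      moreover have "L f = (if z = u then - ?n u v else 0) \<bullet> q"
        using z by (auto simp: L_def f_def)
      ultimately show ?thesis by simp
    qed
    then show ?thesis using vector_eq_rdot by blast
  qed
  \<comment> \<open>The force missing at \<open>u\<close> is a unit force along \<open>uv\<close>.
    Adding it there restores equilibrium at \<open>u\<close> and leaves \<open>w\<close> as the only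
    exceptional vertex.\<close>
  define \<omega> where "\<omega> = (\<lambda>x y. if x = u \<and> y = v then \<omega>0 u v + 1 else \<omega>0 x y)"
  have uv: "u \<noteq> v" "v \<in> nb E u" using e simple_graph_edgeD[OF G e] by (auto simp: nb_def)
  have "(\<Sum>y\<in>nb E z. \<omega> z y *\<^sub>R ?n z y) = 0" if z: "z \<in> V - {w}" for z
  proof (cases "z = u")
    case False
    then show ?thesis using eq0[of z] z by (simp add: \<omega>_def)
  next
    case True
    have "(\<Sum>y\<in>nb E u. \<omega> u y *\<^sub>R ?n u y)
        = (\<Sum>y\<in>nb E u. \<omega>0 u y *\<^sub>R ?n u y + (if y = v then ?n u v else 0))"
      by (rule sum.cong) (auto simp: \<omega>_def algebra_simps)
    also have "\<dots> = 0" using eq0[of u] z True uv finite_nb[OF G] by (simp add: sum.distrib)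
    finally show ?thesis using True by simp
  qed
  moreover have "\<omega> x y = - \<omega> y x" if "{x, y} \<noteq> {u, v}" for x y
  proof -
    have "\<not> (x = u \<and> y = v)" "\<not> (y = u \<and> x = v)" using that by (auto simp: insert_commute)
    then show ?thesis by (simp only: \<omega>_def \<omega>0_def if_False minus_diff_eq)
  qed
  moreover have "\<omega> u v + \<omega> v u = 1" using uv by (simp add: \<omega>_def \<omega>0_def)
  ultimately have "stress V E \<kappa> u v w \<omega>" by (simp add: stress_def)
  then show ?thesis by blast
qed

text \<open>Without a stress each incidence in \<open>Q\<close> is avoided by some conforming
  configuration, and a generic one avoids all of them. \<open>Q\<close> is a parameter because a
  piece has two incidences that cannot be excluded.\<close>

lemma stress_free_configuration:
  assumes G: "simple_graph V E" and Q: "finite Q"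
    and nostress: "\<And>u v w. (u, v, w) \<in> Q \<Longrightarrow>
       {u, v} \<in> E \<and> w \<in> V - {u, v} \<and> \<not> (\<exists>\<omega>. stress V E \<kappa> u v w \<omega>)"
  shows "\<exists>f. conforms E \<kappa> f \<and>
    (\<forall>(u, v, w)\<in>Q. nrm (\<kappa> {u, v}) \<bullet> f w \<noteq> nrm (\<kappa> {u, v}) \<bullet> f u)"
proof -
  define F where "F = (\<lambda>(u, v, w) f. nrm (\<kappa> {u, v}) \<bullet> f w - nrm (\<kappa> {u, v}) \<bullet> f u)"
  have "\<exists>f\<in>Collect (conforms E \<kappa>). \<forall>q\<in>Q. F q f \<noteq> 0"
  proof (rule generic_point_avoids_functionals[OF Q])
    have "conforms E \<kappa> (\<lambda>x. 0)" by (simp add: conforms_def)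
    then show "Collect (conforms E \<kappa>) \<noteq> {}" by blast
    show "(\<lambda>x. f x + t *\<^sub>R g x) \<in> Collect (conforms E \<kappa>)"
      if "f \<in> Collect (conforms E \<kappa>)" "g \<in> Collect (conforms E \<kappa>)" for f g t
      unfolding conforms_def mem_Collect_eq inner_add_right inner_scaleR_right
      using that by (metis (no_types, lifting) conforms_def mem_Collect_eq)
    show "linear_functional (F q)" for q
      by (cases q) (simp add: F_def linear_functional_def inner_add_right algebra_simps)
    show "\<exists>f\<in>Collect (conforms E \<kappa>). F q f \<noteq> 0" if q: "q \<in> Q" for q
    proof (rule ccontr)
      assume no: "\<not> ?thesis"
      obtain u v w where uvw: "q = (u, v, w)" by (cases q)
      have "\<exists>\<omega>. stress V E \<kappa> u v w \<omega>"
        using nostress[of u v w] q uvw no by (intro stress_if_forced[OF G]) (auto simp: F_def)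
      then show False using nostress q uvw by blast
    qed
  qed
  then obtain f where "conforms E \<kappa> f" "\<And>q. q \<in> Q \<Longrightarrow> F q f \<noteq> 0" by blast
  then show ?thesis by (intro exI[of _ f]) (fastforce simp: F_def)
qed

text \<open>With one force zero, at most two remain, along distinct and therefore independent
  normals. The bound 3 instead of equality also covers the pendant ends of a piece.\<close>

lemma dead_vertex:
  assumes eq: "(\<Sum>y\<in>nb E z. \<omega> z y *\<^sub>R nrm (\<kappa> {z, y})) = 0"
    and fin: "finite (nb E z)" "card (nb E z) \<le> 3"
    and pr: "proper E \<kappa>" and y: "y \<in> nb E z" "\<omega> z y = 0" and x: "x \<in> nb E z"
  shows "\<omega> z x = 0"
proof (cases "x = y")
  case False
  have sub: "nb E z = insert y (insert x (nb E z - {x, y}))" using x y by auto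
  have card: "card (nb E z - {x, y}) \<le> 1"
    using x y False fin by (subst card_Diff_subset) auto
  have inj: "\<kappa> {z, a} \<noteq> \<kappa> {z, b}" if "a \<in> nb E z" "b \<in> nb E z" "a \<noteq> b" for a b
    using pr that by (auto simp: proper_def inj_on_def)
  have sum: "\<omega> z x *\<^sub>R nrm (\<kappa> {z, x}) + (\<Sum>y\<in>nb E z - {x, y}. \<omega> z y *\<^sub>R nrm (\<kappa> {z, y})) = 0"
    using eq fin False y by (subst (asm) sub) (simp add: sum.insert_if)
  consider "nb E z - {x, y} = {}" | a where "nb E z - {x, y} = {a}"
    using card fin by (auto simp: le_Suc_eq card_1_singleton_iff)
  then show ?thesis
  proof cases
    case 1
    then have "\<omega> z x *\<^sub>R nrm (\<kappa> {z, x}) = 0" using sum by (simp only: sum.empty add_0_right)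
    then show ?thesis by simp
  next
    case 2
    then have "\<kappa> {z, x} \<noteq> \<kappa> {z, a}" using inj x by blast
    then show ?thesis using nrm_independent[of "\<kappa> {z, x}" "\<kappa> {z, a}"] sum 2 by auto
  qed
qed (use y in simp)

text \<open>Summing the second coordinates of all equilibria in \<open>B\<close>, edges inside
  \<open>B\<close> cancel by antisymmetry. The edge \<open>uv\<close> is not antisymmetric, so it
  must either not lie inside \<open>B\<close> or be vertical, when its normal has second coordinate
  0.\<close>

lemma stress_vertical_balance:
  assumes G: "simple_graph V E" and \<omega>: "stress V E \<kappa> u v w \<omega>"
    and B: "B \<subseteq> V" "w \<notin> B" "\<not> (u \<in> B \<and> v \<in> B) \<or> \<kappa> {u, v} = Dv"
  shows "(\<Sum>z\<in>B. \<Sum>y\<in>nb E z - B. \<omega> z y * snd (nrm (\<kappa> {z, y}))) = 0"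
proof -
  let ?t = "\<lambda>z y. \<omega> z y * snd (nrm (\<kappa> {z, y}))"
  have finB: "finite B" using B G finite_subset by (auto simp: simple_graph_def)
  have fin: "finite (nb E z)" for z by (rule finite_nb[OF G])
  have "(\<Sum>z\<in>B. \<Sum>y\<in>nb E z. ?t z y) = 0"
  proof (rule sum.neutral, rule ballI)
    fix z assume "z \<in> B"
    then have "(\<Sum>y\<in>nb E z. \<omega> z y *\<^sub>R nrm (\<kappa> {z, y})) = 0"
      using \<omega> B by (auto simp: stress_def)
    then have "snd (\<Sum>y\<in>nb E z. \<omega> z y *\<^sub>R nrm (\<kappa> {z, y})) = 0" by simp
    then show "(\<Sum>y\<in>nb E z. ?t z y) = 0" by (simp add: snd_sum)
  qed
  moreover have "(\<Sum>y\<in>nb E z. ?t z y) = (\<Sum>y\<in>nb E z \<inter> B. ?t z y) + (\<Sum>y\<in>nb E z - B. ?t z y)" for z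
    by (rule sum.Int_Diff[OF fin])
  ultimately have "(\<Sum>z\<in>B. \<Sum>y\<in>nb E z \<inter> B. ?t z y) + (\<Sum>z\<in>B. \<Sum>y\<in>nb E z - B. ?t z y) = 0"
    by (simp add: sum.distrib)
  moreover have "(\<Sum>z\<in>B. \<Sum>y\<in>nb E z \<inter> B. ?t z y) = 0"
  proof -
    let ?S = "\<Sum>z\<in>B. \<Sum>y\<in>nb E z \<inter> B. ?t z y"
    have r: "(\<Sum>y\<in>nb E z \<inter> B. ?t z y) = (\<Sum>y\<in>B. if {z, y} \<in> E then ?t z y else 0)" for z
    proof -
      have "(\<Sum>y\<in>nb E z \<inter> B. ?t z y) = (\<Sum>y\<in>B \<inter> nb E z. ?t z y)" by (simp add: Int_commute)
      also have "\<dots> = (\<Sum>y\<in>B. if y \<in> nb E z then ?t z y else 0)"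
        by (rule sum.inter_restrict[OF finB])
      finally show ?thesis by (simp add: nb_def)
    qed
    have "?S = (\<Sum>z\<in>B. \<Sum>y\<in>B. if {z, y} \<in> E then ?t z y else 0)" by (simp add: r)
    also have "\<dots> = (\<Sum>y\<in>B. \<Sum>z\<in>B. if {z, y} \<in> E then ?t z y else 0)" by (rule sum.swap)
    also have "\<dots> = (\<Sum>y\<in>B. \<Sum>z\<in>B. - (if {y, z} \<in> E then ?t y z else 0))"
    proof (intro sum.cong refl)
      fix y z assume yz: "y \<in> B" "z \<in> B"
      show "(if {z, y} \<in> E then ?t z y else 0) = - (if {y, z} \<in> E then ?t y z else 0)"
      proof (cases "{z, y} \<in> E")
        case True
        have "?t z y = - ?t y z"
        proof (cases "{z, y} = {u, v}")
          case True
          then have "u \<in> B \<and> v \<in> B" using yz by (auto simp: doubleton_eq_iff)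
          then have "\<kappa> {z, y} = Dv" "\<kappa> {y, z} = Dv" using B True by (auto simp: insert_commute)
          then show ?thesis by simp
        next
          case False
          then have "\<omega> z y = - \<omega> y z" using \<omega> \<open>{z, y} \<in> E\<close> by (auto simp: stress_def)
          then show ?thesis by (simp add: insert_commute)
        qed
        then show ?thesis using True by (simp add: insert_commute)
      qed (simp add: insert_commute)
    qed
    also have "\<dots> = - ?S" by (simp add: r sum_negf)
    finally show ?thesis by simp
  qed
  ultimately show ?thesis by simp
qed

subsection \<open>Perfect matchings\<close>

definition fpf_involution :: "'a set \<Rightarrow> ('a \<Rightarrow> 'a) \<Rightarrow> bool" where
  "fpf_involution V m \<longleftrightarrow> (\<forall>x\<in>V. m x \<in> V \<and> m x \<noteq> x \<and> m (m x) = x)"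

definition perfect_matching :: "'a set \<Rightarrow> 'a set set \<Rightarrow> ('a \<Rightarrow> 'a) \<Rightarrow> bool" where
  "perfect_matching V E m \<longleftrightarrow> fpf_involution V m \<and> (\<forall>x\<in>V. {x, m x} \<in> E)"

lemma fpf_involutionD:
  assumes "fpf_involution V m" "x \<in> V"
  shows "m x \<in> V" "m x \<noteq> x" "m (m x) = x"
  using assms by (auto simp: fpf_involution_def)

text \<open>The union of two perfect matchings consists of even cycles and double edges. The
  induction removes one pair of \<open>m\<close> and splices its two neighbours in \<open>n\<close>
  together, which preserves the parity of the cycle.\<close>

lemma two_involutions_bipartite:
  assumes "finite V" "fpf_involution V m" "fpf_involution V n"
  shows "\<exists>\<tau>. \<forall>x\<in>V. \<tau> (m x) = (\<not> \<tau> x) \<and> \<tau> (n x) = (\<not> \<tau> x)"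
  using assms
proof (induction "card V" arbitrary: V n rule: less_induct)
  case less
  note m = fpf_involutionD[OF less.prems(2)] and n = fpf_involutionD[OF less.prems(3)]
  show ?case
  proof (cases "V = {}")
    case False
    then obtain x where x: "x \<in> V" by blast
    define y where "y = m x"
    have y: "y \<in> V" "y \<noteq> x" "m y = x" using m[OF x] by (auto simp: y_def)
    let ?W = "V - {x, y}"
    have less': "card ?W < card V" using x less.prems(1) by (intro psubset_card_mono) auto
    have mW: "fpf_involution ?W m"
      unfolding fpf_involution_def
    proof
      fix z assume "z \<in> ?W"
      then show "m z \<in> ?W \<and> m z \<noteq> z \<and> m (m z) = z" using m[of z] y by (auto simp: y_def)
    qed
    show ?thesis
    proof (cases "n x = y")
      case True
      then have nx: "n y = x" using n[OF x] by simp
      have "fpf_involution ?W n"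
        unfolding fpf_involution_def
      proof
        fix z assume "z \<in> ?W"
        then show "n z \<in> ?W \<and> n z \<noteq> z \<and> n (n z) = z" using n[of z] True nx by auto
      qed
      then obtain \<tau> where \<tau>: "\<forall>z\<in>?W. \<tau> (m z) = (\<not> \<tau> z) \<and> \<tau> (n z) = (\<not> \<tau> z)"
        using less.hyps[OF less' _ mW] less.prems(1) by auto
      have "m z \<notin> {x, y}" "n z \<notin> {x, y}" if "z \<in> ?W" for z
        using that m[of z] n[of z] y True nx by (auto simp: y_def)
      then show ?thesis using \<tau> y True nx
        by (intro exI[of _ "\<tau>(x := True, y := False)"]) (auto simp: y_def)
    next
      case False
      define x' y' where "x' = n x" and "y' = n y"
      have x': "x' \<in> ?W" "n x' = x" using n[OF x] False by (auto simp: x'_def)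
      have "y' \<noteq> x" using n[OF y(1)] False by (auto simp: y'_def)
      then have y': "y' \<in> ?W" "n y' = y" using n[OF y(1)] by (auto simp: y'_def)
      have xy': "x' \<noteq> y'" using x' y' y by auto
      define n' where "n' = n(x' := y', y' := x')"
      have "fpf_involution ?W n'"
        unfolding fpf_involution_def
      proof
        fix z assume z: "z \<in> ?W"
        show "n' z \<in> ?W \<and> n' z \<noteq> z \<and> n' (n' z) = z"
        proof (cases "z \<in> {x', y'}")
          case True
          then show ?thesis using x' y' xy' by (auto simp: n'_def)
        next
          case F: False
          have "n z \<noteq> x" "n z \<noteq> y" using n[of z] z F by (auto simp: x'_def y'_def)
          moreover have "n z \<noteq> x'" "n z \<noteq> y'" using n[of z] z x' y' by auto
          ultimately show ?thesis using n[of z] z F by (auto simp: n'_def)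
        qed
      qed
      then obtain \<tau> where \<tau>: "\<forall>z\<in>?W. \<tau> (m z) = (\<not> \<tau> z) \<and> \<tau> (n' z) = (\<not> \<tau> z)"
        using less.hyps[OF less' _ mW] less.prems(1) by auto
      have \<tau>xy: "\<tau> y' = (\<not> \<tau> x')" using \<tau>[rule_format, OF x'(1)] xy' by (simp add: n'_def)
      define \<sigma> where "\<sigma> = \<tau>(x := \<not> \<tau> x', y := \<tau> x')"
      have "\<sigma> (m z) = (\<not> \<sigma> z) \<and> \<sigma> (n z) = (\<not> \<sigma> z)" if z: "z \<in> V" for z
      proof (cases "z \<in> {x, y}")
        case True
        then show ?thesis using x' y' y \<tau>xy
          by (auto simp: \<sigma>_def x'_def[symmetric] y'_def[symmetric] y_def[symmetric])
      next
        case F: False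
        then have zW: "z \<in> ?W" using z by auto
        have mz: "m z \<in> ?W" using mW zW by (auto simp: fpf_involution_def)
        have "\<sigma> (n z) = (\<not> \<sigma> z)"
        proof (cases "z \<in> {x', y'}")
          case True
          then show ?thesis using x' y' y \<tau>xy by (auto simp: \<sigma>_def)
        next
          case F': False
          have "n z \<noteq> x" "n z \<noteq> y" using n[OF z] F' by (auto simp: x'_def y'_def)
          then show ?thesis using \<tau>[rule_format, OF zW] F F' by (simp add: \<sigma>_def n'_def)
        qed
        then show ?thesis using \<tau>[rule_format, OF zW] mz F by (simp add: \<sigma>_def)
      qed
      then show ?thesis by blast
    qed
  qed auto
qed

text \<open>The exchange step in Lovasz's proof of Tutte's theorem. One matching uses the extra edge
  \<open>ac\<close>, the other the extra edge \<open>bd\<close>. Following them alternately from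
  \<open>d\<close> gives a region on which they can be swapped so that neither extra edge is
  used.\<close>

lemma lovasz_exchange:
  assumes V: "finite V" "a \<in> V" "b \<in> V" "c \<in> V" "d \<in> V"
    and m1: "perfect_matching V (insert {a, c} F) m1"
    and m2: "perfect_matching V (insert {b, d} F) m2"
    and F: "{a, b} \<in> F" "{c, b} \<in> F" "{b, d} \<notin> F"
  shows "\<exists>m. perfect_matching V F m"
proof (rule ccontr)
  assume no: "\<nexists>m. perfect_matching V F m"
  have i1: "fpf_involution V m1" and i2: "fpf_involution V m2"
    using m1 m2 by (auto simp: perfect_matching_def)
  note f1 = fpf_involutionD[OF i1] and f2 = fpf_involutionD[OF i2]
  have m1F: "{x, m1 x} \<in> F" if "x \<in> V" "x \<noteq> a" "x \<noteq> c" for x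
    using m1 that by (auto simp: perfect_matching_def doubleton_eq_iff)
  have m2F: "{x, m2 x} \<in> F" if "x \<in> V" "x \<noteq> b" "x \<noteq> d" for x
    using m2 that by (auto simp: perfect_matching_def doubleton_eq_iff)
  have m1a: "m1 a = c"
  proof (rule ccontr)
    assume n: "m1 a \<noteq> c"
    then have "m1 c \<noteq> a" using f1 V by metis
    then have "{x, m1 x} \<in> F" if "x \<in> V" for x
      using m1 that n by (auto simp: perfect_matching_def doubleton_eq_iff)
    then show False using no i1 by (auto simp: perfect_matching_def)
  qed
  have m1c: "m1 c = a" using m1a f1 V by metis
  have m2b: "m2 b = d"
  proof (rule ccontr)
    assume n: "m2 b \<noteq> d"
    then have "m2 d \<noteq> b" using f2 V by metis
    then have "{x, m2 x} \<in> F" if "x \<in> V" for x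
      using m2 that n by (auto simp: perfect_matching_def doubleton_eq_iff)
    then show False using no i2 by (auto simp: perfect_matching_def)
  qed
  have m2d: "m2 d = b" using m2b f2 V by metis
  have dac: "d \<noteq> a" "d \<noteq> c" using F by (auto simp: insert_commute)
  \<comment> \<open>The bipartition keeps every \<open>z i\<close> on the side of \<open>d\<close>,
    hence away from \<open>b\<close>, which is matched to \<open>d\<close> by
    \<open>m2\<close>.\<close>
  obtain \<tau> where \<tau>: "\<And>x. x \<in> V \<Longrightarrow> \<tau> (m1 x) = (\<not> \<tau> x)" "\<And>x. x \<in> V \<Longrightarrow> \<tau> (m2 x) = (\<not> \<tau> x)"
    using two_involutions_bipartite[OF V(1) i1 i2] by blast
  \<comment> \<open>Every second vertex of the alternating walk. Watching only these suffices, since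
    \<open>m1\<close> exchanges \<open>a\<close> and \<open>c\<close>.\<close>
  define z where "z i = ((m2 \<circ> m1) ^^ i) d" for i :: nat
  have z0: "z 0 = d" and zS: "\<And>i. z (Suc i) = m2 (m1 (z i))" by (auto simp: z_def)
  have zV: "z i \<in> V" for i by (induction i) (use z0 zS f1 f2 V in auto)
  have m2z: "m2 (z (Suc i)) = m1 (z i)" for i using zS f2 f1 zV by simp
  have z\<tau>: "\<tau> (z i) = \<tau> d" for i by (induction i) (use z0 zS \<tau> f1 zV in auto)
  have zb: "z i \<noteq> b" for i using z\<tau>[of i] \<tau>(2)[of d] m2d V by auto
  have zinj: "z i = z j" if "z (Suc i) = z (Suc j)" for i j
    using that m2z f1 zV by metis
  have zback: "z (k + j) = z k" if "z j = d" for j k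
    using that by (induction k) (auto simp: z0 zS)
  show False
  proof (cases "\<exists>i. z i \<in> {a, c}")
    case False
    \<comment> \<open>The walk never meets \<open>a\<close> or \<open>c\<close>, so it closes up
      through \<open>b\<close>. This cycle contains \<open>bd\<close> but not \<open>ac\<close>:
      \<open>m1\<close> is used on it and \<open>m2\<close> elsewhere.\<close>
    define P where "P = range z \<union> range (\<lambda>i. m1 (z i))"
    have ac: "a \<notin> P" "c \<notin> P"
      using False f1(3)[OF zV] m1a m1c by (fastforce simp: P_def)+
    have "\<not> inj z"
      using V(1) zV by (meson finite_subset image_subset_iff infinite_UNIV_nat finite_imageD rangeE subsetI)
    then obtain i j where ij: "i < j" "z i = z j" unfolding inj_def by (metis linorder_neqE_nat)
    have "z (i - k) = z (j - k)" if "k \<le> i" for k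
      using that
    proof (induction k)
      case (Suc k)
      then have "z (Suc (i - Suc k)) = z (Suc (j - Suc k))"
        using ij(1) by (simp add: Suc_diff_Suc)
      then show ?case by (rule zinj)
    qed (use ij in simp)
    from this[of i] have "d = z (j - i)" using z0 by simp
    moreover obtain r where "j - i = Suc r" using ij(1) by (metis Suc_diff_Suc)
    ultimately have "b = m1 (z r)" using m2z m2d by metis
    then have bP: "b \<in> P" by (auto simp: P_def)
    have dP: "d \<in> P" using z0 by (auto simp: P_def)
    have P1: "m1 x \<in> P" if "x \<in> P" for x using that f1 zV by (auto simp: P_def)
    have P2: "m2 x \<in> P" if "x \<in> P" for x
    proof -
      consider i where "x = z i" | i where "x = m1 (z i)" using \<open>x \<in> P\<close> by (auto simp: P_def)
      then show ?thesis
      proof cases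
        case (1 i)
        then show ?thesis using m2z m2d bP z0 by (cases i) (auto simp: P_def)
      next
        case (2 i)
        then have "m2 x = z (Suc i)" using zS by simp
        then show ?thesis by (simp add: P_def)
      qed
    qed
    have P2': "m2 x \<notin> P" if "x \<in> V" "x \<notin> P" for x
      using P2 f2 that by metis
    have e1: "{x, m1 x} \<in> F" if "x \<in> V" "x \<in> P" for x
      by (rule m1F) (use that ac in blast)+
    have e2: "{x, m2 x} \<in> F" if "x \<in> V" "x \<notin> P" for x
      by (rule m2F) (use that bP dP in blast)+
    have "perfect_matching V F (\<lambda>x. if x \<in> P then m1 x else m2 x)"
      unfolding perfect_matching_def fpf_involution_def
      using P1 P2' f1 f2 e1 e2 by auto
    then show False using no by blast
  next
    case True
    define i where "i = (LEAST i. z i \<in> {a, c})"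
    have zi: "z i \<in> {a, c}" unfolding i_def using True by (rule LeastI_ex)
    have zmin: "z j \<notin> {a, c}" if "j < i" for j using that not_less_Least unfolding i_def by blast
    define a' where "a' = z i"
    have a'V: "a' \<in> V" "a' \<noteq> b" "{a', b} \<in> F" using zV zb zi F by (auto simp: a'_def)
    have ipos: "i > 0" using zi z0 dac by (cases i) auto
    \<comment> \<open>The walk is stopped just before it first reaches \<open>a\<close> or
      \<open>c\<close>, at \<open>a'\<close>. Then \<open>m1\<close> covers \<open>P\<close>, the
      edge from \<open>a'\<close> to \<open>b\<close> lies in \<open>F\<close>, and
      \<open>m2\<close> covers the rest.\<close>
    define P where "P = z ` {..<i} \<union> (\<lambda>j. m1 (z j)) ` {..<i}"
    have PV: "P \<subseteq> V" using zV f1 by (auto simp: P_def)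
    have m1z: "m1 (z j) \<notin> {a, c}" if "j < i" for j
      using zmin[OF that] f1(3)[OF zV[of j]] m1a m1c by auto
    then have ac: "a \<notin> P" "c \<notin> P" using zmin by (auto simp: P_def)
    then have a'P: "a' \<notin> P" using zi by (auto simp: a'_def)
    have dP: "d \<in> P" using z0 ipos by (auto simp: P_def)
    have bP: "b \<notin> P"
    proof
      assume "b \<in> P"
      then obtain j where j: "j < i" "b = m1 (z j)" using zb by (auto simp: P_def)
      then have "z (Suc j) = d" using zS m2b by simp
      then have "z (i - Suc j) = z i" using zback[of "Suc j" "i - Suc j"] j(1) by simp
      then show False using zmin[of "i - Suc j"] zi j(1) by auto
    qed
    have P1: "m1 x \<in> P" if "x \<in> P" for x using that f1 zV by (auto simp: P_def)
    have P2: "m2 x \<in> P \<union> {a', b}" if xP: "x \<in> P \<union> {a'}" for x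
    proof -
      consider j where "j \<le> i" "x = z j" | j where "j < i" "x = m1 (z j)"
        using xP unfolding P_def a'_def by (blast intro: less_imp_le)
      then show ?thesis
      proof cases
        case (1 j)
        then show ?thesis using m2z m2d z0 by (cases j) (auto simp: P_def)
      next
        case (2 j)
        then have "m2 x = z (Suc j)" using zS by simp
        then show ?thesis using 2 by (cases "Suc j = i") (auto simp: P_def a'_def)
      qed
    qed
    have P2': "m2 x \<notin> P \<union> {a', b}" if x: "x \<in> V" "x \<notin> P \<union> {a', b}" for x
    proof
      assume "m2 x \<in> P \<union> {a', b}"
      moreover have "m2 x \<noteq> b" using f2[OF x(1)] m2b dP x by auto
      ultimately have "m2 (m2 x) \<in> P \<union> {a', b}" using P2 by blast
      then show False using f2 x by simp
    qed
    let ?m = "\<lambda>x. if x \<in> P then m1 x else if x = a' then b else if x = b then a' else m2 x"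
    have "?m x \<in> V \<and> ?m x \<noteq> x \<and> ?m (?m x) = x \<and> {x, ?m x} \<in> F" if x: "x \<in> V" for x
    proof -
      consider "x \<in> P" | "x = a'" | "x = b" | "x \<notin> P \<union> {a', b}" by blast
      then show ?thesis
      proof cases
        case 1
        then show ?thesis using P1[of x] f1[OF x] m1F[OF x] ac by auto
      next
        case 2
        then show ?thesis using a'P bP a'V V by auto
      next
        case 3
        then show ?thesis using a'P bP a'V V by (auto simp: insert_commute)
      next
        case 4
        then have "x \<noteq> b" "x \<noteq> d" using dP by auto
        then show ?thesis using 4 P2'[OF x 4] f2[OF x] m2F[OF x] by auto
      qed
    qed
    then have "perfect_matching V F ?m"
      unfolding perfect_matching_def fpf_involution_def by blast
    then show False using no by blast
  qed
qed

lemma handshake: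
  assumes "finite V" "finite F" "\<And>e. e \<in> F \<Longrightarrow> e \<subseteq> V \<and> card e = 2"
  shows "(\<Sum>v\<in>V. card {e \<in> F. v \<in> e}) = 2 * card F"
proof -
  have "(\<Sum>v\<in>V. card {e \<in> F. v \<in> e}) = (\<Sum>v\<in>V. \<Sum>e\<in>F. if v \<in> e then 1 else 0)"
  proof (rule sum.cong)
    fix v
    have "{e \<in> F. v \<in> e} = F \<inter> {e. v \<in> e}" by blast
    then show "card {e \<in> F. v \<in> e} = (\<Sum>e\<in>F. if v \<in> e then 1 else 0)"
      using sum.inter_restrict[OF assms(2), of "\<lambda>_. 1::nat" "{e. v \<in> e}"] by simp
  qed simp
  also have "\<dots> = (\<Sum>e\<in>F. \<Sum>v\<in>V. if v \<in> e then 1 else 0)" by (rule sum.swap)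
  also have "\<dots> = (\<Sum>e\<in>F. 2)"
  proof (rule sum.cong)
    fix e assume "e \<in> F"
    then have "V \<inter> e = e" "card e = 2" using assms(3) by auto
    then show "(\<Sum>v\<in>V. if v \<in> e then 1 else 0) = (2::nat)"
      using sum.inter_restrict[OF assms(1), of "\<lambda>_. 1::nat" e] by simp
  qed simp
  finally show ?thesis by simp
qed

subsection \<open>Three-edge-connected cubic graphs\<close>

definition cut :: "'a set set \<Rightarrow> 'a set \<Rightarrow> 'a set set" where
  "cut E S = {e \<in> E. e \<inter> S \<noteq> {} \<and> \<not> e \<subseteq> S}"

text \<open>A disconnected graph has a proper vertex set with empty cut, so the cut condition
  includes connectedness.\<close>

locale three_edge_connected =
  fixes V :: "'a set" and E :: "'a set set"
  assumes cubic: "cubic_graph V E" and nonempty: "V \<noteq> {}"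
    and cut_ge_3: "\<And>S. S \<subseteq> V \<Longrightarrow> S \<noteq> {} \<Longrightarrow> S \<noteq> V \<Longrightarrow> 3 \<le> card (cut E S)"
begin

lemma G: "simple_graph V E" using cubic by (simp add: cubic_graph_def)

lemma finV: "finite V" using G by (simp add: simple_graph_def)

lemma finE: "finite E" by (rule finite_edges[OF G])

lemma card_nb: "x \<in> V \<Longrightarrow> card (nb E x) = 3"
  using cubic vertex_degree_nb[OF G] by (auto simp: cubic_graph_def)

lemma even_V: "even (card V)"
proof -
  have "(\<Sum>v\<in>V. card {e \<in> E. v \<in> e}) = 2 * card E"
    by (rule handshake[OF finV finE]) (use G in \<open>auto simp: simple_graph_def\<close>)
  moreover have "(\<Sum>v\<in>V. card {e \<in> E. v \<in> e}) = (\<Sum>v\<in>V. 3)"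
    by (rule sum.cong) (use cubic in \<open>auto simp: cubic_graph_def vertex_degree_def\<close>)
  ultimately have "3 * card V = 2 * card E" by simp
  then show ?thesis by presburger
qed

text \<open>In an edge-maximal counterexample \<open>F\<close> the vertices outside the set
  \<open>U\<close> of universal ones form disjoint cliques. The cuts bound the number of cliques by
  the size of \<open>U\<close>, whereas a maximum matching that misses a vertex would need more
  cliques than that.\<close>

lemma perfect_matching_exists: "\<exists>m. perfect_matching V E m"
proof (rule ccontr)
  assume none: "\<nexists>m. perfect_matching V E m"
  define \<F> where "\<F> = {F. E \<subseteq> F \<and> F \<subseteq> {e. e \<subseteq> V \<and> card e = 2} \<and> (\<nexists>m. perfect_matching V F m)}"
  have "finite \<F>"
    by (rule finite_subset[of _ "Pow (Pow V)"]) (auto simp: \<F>_def finV)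
  moreover have "E \<in> \<F>" using none G by (auto simp: \<F>_def simple_graph_def)
  ultimately obtain F where F: "F \<in> \<F>" and Fmax: "\<And>F'. F' \<in> \<F> \<Longrightarrow> F \<subseteq> F' \<Longrightarrow> F = F'"
    using finite_has_maximal[of \<F>] by (metis emptyE)
  have EF: "E \<subseteq> F" and F2: "\<And>e. e \<in> F \<Longrightarrow> e \<subseteq> V \<and> card e = 2"
    and noF: "\<nexists>m. perfect_matching V F m"
    using F by (auto simp: \<F>_def)
  have extend: "\<exists>m. perfect_matching V (insert {a, c} F) m"
    if "a \<in> V" "c \<in> V" "a \<noteq> c" "{a, c} \<notin> F" for a c
  proof (rule ccontr)
    assume "\<not> ?thesis"
    then have "insert {a, c} F \<in> \<F>" using F that by (auto simp: \<F>_def)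
    then show False using Fmax[of "insert {a, c} F"] that by auto
  qed
  define U where "U = {x \<in> V. \<forall>y\<in>V - {x}. {x, y} \<in> F}"
  define W where "W = V - U"
  define R where "R = (\<lambda>x y. x = y \<or> {x, y} \<in> F)"
  have Rsym: "R x y \<Longrightarrow> R y x" for x y by (auto simp: R_def insert_commute)
  \<comment> \<open>A failure of transitivity is exactly the configuration of
    \<open>lovasz_exchange\<close>; the vertex \<open>d\<close> exists because \<open>y\<close> is
    not universal.\<close>
  have Rtrans: "R x z" if xyz: "x \<in> W" "y \<in> W" "z \<in> W" "R x y" "R y z" for x y z
  proof (rule ccontr)
    assume n: "\<not> R x z"
    then have e: "{x, y} \<in> F" "{z, y} \<in> F" "x \<noteq> z" "{x, z} \<notin> F"
      using that by (auto simp: R_def insert_commute)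
    obtain d where d: "d \<in> V" "d \<noteq> y" "{y, d} \<notin> F" using xyz by (auto simp: W_def U_def)
    have V: "x \<in> V" "y \<in> V" "z \<in> V" using xyz by (auto simp: W_def)
    obtain m1 where m1: "perfect_matching V (insert {x, z} F) m1" using extend e V by blast
    obtain m2 where m2: "perfect_matching V (insert {y, d} F) m2" using extend d V by blast
    show False using lovasz_exchange[OF finV V(1,2,3) d(1) m1 m2 e(1,2) d(3)] noF by blast
  qed
  define cl where "cl = (\<lambda>x. {y \<in> W. R x y})"
  have clself: "x \<in> cl x" if "x \<in> W" for x using that by (simp add: cl_def R_def)
  have cleq: "cl x = cl y" if "x \<in> W" "y \<in> W" "R x y" for x y
    using that Rtrans Rsym unfolding cl_def by blast
  have clW: "cl x \<subseteq> W" for x by (auto simp: cl_def)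
  have UW: "U \<inter> W = {}" "U \<union> W = V" "U \<subseteq> V" by (auto simp: W_def U_def)
  have finU: "finite U" and finW: "finite W" using finV UW by (auto intro: finite_subset)
  have cutU: "\<exists>x u. e = {x, u} \<and> x \<in> cl z \<and> u \<in> U" if e: "e \<in> cut E (cl z)" and z: "z \<in> W" for e z
  proof -
    obtain x where x: "x \<in> e" "x \<in> cl z" using e by (auto simp: cut_def)
    have eE: "e \<in> E" using e by (auto simp: cut_def)
    obtain y where y: "e = {x, y}" "y \<in> V" using simple_graph_edgeE[OF G eE x(1)] by metis
    have "y \<notin> cl z" using e x y by (auto simp: cut_def)
    moreover have "R x y" using y eE EF by (auto simp: R_def)
    ultimately have "y \<notin> W" using Rtrans[of z x y] x z clW by (auto simp: cl_def)
    then show ?thesis using x y UW by blast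
  qed
  \<comment> \<open>Every clique sends at least three edges of \<open>E\<close> out, all into
    \<open>U\<close>, and \<open>U\<close> receives at most three per vertex.\<close>
  have few: "card (cl ` W) \<le> card U"
  proof -
    have K: "3 \<le> card (cut E K)" if K: "K \<in> cl ` W" for K
    proof (rule cut_ge_3)
      show "K \<subseteq> V" "K \<noteq> {}" using K clW clself UW by blast+
      show "K \<noteq> V"
      proof
        assume KV: "K = V"
        obtain z where z: "z \<in> W" "K = cl z" using K by blast
        have "{x, y} \<in> F" if "x \<in> V" "y \<in> V - {x}" for x y
        proof -
          have "x \<in> cl z" "y \<in> cl z" using that KV z by auto
          then have "R x y" using Rtrans[of x z y] Rsym z by (auto simp: cl_def)
          then show ?thesis using that by (auto simp: R_def)
        qed
        then have "z \<in> U" using z by (auto simp: U_def W_def)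
        then show False using z UW by blast
      qed
    qed
    have disj: "cut E K \<inter> cut E K' = {}" if KK: "K \<in> cl ` W" "K' \<in> cl ` W" "K \<noteq> K'" for K K'
    proof (rule ccontr)
      assume "cut E K \<inter> cut E K' \<noteq> {}"
      then obtain e where e: "e \<in> cut E K" "e \<in> cut E K'" by blast
      obtain z z' where z: "z \<in> W" "K = cl z" "z' \<in> W" "K' = cl z'" using KK by blast
      obtain x u where x: "e = {x, u}" "x \<in> cl z" "u \<in> U" using cutU e z by metis
      obtain x' u' where x': "e = {x', u'}" "x' \<in> cl z'" "u' \<in> U" using cutU e z by metis
      have "x \<in> W" "x' \<in> W" using x x' clW by blast+
      then have "x = x'" using x x' UW by (auto simp: doubleton_eq_iff)
      then have "cl z = cl x" "cl z' = cl x" using cleq[of z x] cleq[of z' x] x x' z clW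
        by (auto simp: cl_def)
      then show False using z KK by simp
    qed
    have "3 * card (cl ` W) = (\<Sum>K\<in>cl ` W. 3)" by simp
    also have "\<dots> \<le> (\<Sum>K\<in>cl ` W. card (cut E K))" by (rule sum_mono) (rule K)
    also have "\<dots> = card (\<Union>K\<in>cl ` W. cut E K)"
      by (rule card_UN_disjoint[symmetric]) (use finW finE disj in \<open>auto simp: cut_def\<close>)
    also have "\<dots> \<le> card (\<Union>u\<in>U. {e \<in> E. u \<in> e})"
    proof (rule card_mono)
      show "finite (\<Union>u\<in>U. {e \<in> E. u \<in> e})" using finU finE by auto
      show "(\<Union>K\<in>cl ` W. cut E K) \<subseteq> (\<Union>u\<in>U. {e \<in> E. u \<in> e})"
      proof
        fix e assume "e \<in> (\<Union>K\<in>cl ` W. cut E K)"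
        then obtain z where z: "z \<in> W" "e \<in> cut E (cl z)" by blast
        then obtain x u where "e = {x, u}" "u \<in> U" using cutU by metis
        then show "e \<in> (\<Union>u\<in>U. {e \<in> E. u \<in> e})" using z by (auto simp: cut_def)
      qed
    qed
    also have "\<dots> \<le> (\<Sum>u\<in>U. card {e \<in> E. u \<in> e})" by (rule card_UN_le[OF finU])
    also have "\<dots> = (\<Sum>u\<in>U. 3)"
      by (rule sum.cong) (use cubic UW in \<open>auto simp: cubic_graph_def vertex_degree_def\<close>)
    finally show ?thesis by simp
  qed
  define mat where "mat = (\<lambda>M. M \<subseteq> F \<and> (\<forall>e\<in>M. \<forall>e'\<in>M. e \<noteq> e' \<longrightarrow> e \<inter> e' = {}))"
  have finF: "finite F" using F2 finV by (intro finite_subset[of F "Pow V"]) auto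
  define M where "M = (ARG_MAX card M. mat M)"
  have "mat {}" by (simp add: mat_def)
  moreover have "\<forall>M. mat M \<longrightarrow> card M < Suc (card F)"
    using card_mono[OF finF] by (auto simp: mat_def less_Suc_eq_le)
  ultimately have M: "mat M" and Mmax: "\<And>M'. mat M' \<Longrightarrow> card M' \<le> card M"
    using arg_max_nat_lemma[of mat "{}" card] unfolding M_def by auto
  have MF: "M \<subseteq> F" and Mdisj: "\<And>e e'. e \<in> M \<Longrightarrow> e' \<in> M \<Longrightarrow> e \<noteq> e' \<Longrightarrow> e \<inter> e' = {}"
    using M by (auto simp: mat_def)
  have finM: "finite M" using MF finF finite_subset by blast
  define R0 where "R0 = V - \<Union>M"
  \<comment> \<open>\<open>R0\<close> consists of the unmatched vertices. Trading \<open>D\<close>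
    for \<open>N\<close> cannot enlarge a maximum matching; every augmentation below is an
    instance.\<close>
  have improve: "card N \<le> card D"
    if D: "D \<subseteq> M" and N: "N \<subseteq> F" "\<And>e e'. e \<in> N \<Longrightarrow> e' \<in> N \<Longrightarrow> e \<noteq> e' \<Longrightarrow> e \<inter> e' = {}"
      and sub: "\<Union>N \<subseteq> R0 \<union> \<Union>D" for D N
  proof -
    have cross: "e \<inter> e' = {}" if "e \<in> M - D" "e' \<in> N" for e e'
    proof -
      have "e \<inter> \<Union>D = {}" using that D Mdisj by fastforce
      moreover have "e \<inter> R0 = {}" using that by (auto simp: R0_def)
      ultimately show ?thesis using that sub by blast
    qed
    have "e \<inter> e' = {}" if "e \<in> (M - D) \<union> N" "e' \<in> (M - D) \<union> N" "e \<noteq> e'" for e e'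
      using that Mdisj[of e e'] N(2)[of e e'] cross[of e e'] cross[of e' e] by (metis DiffD1 Int_commute UnE)
    then have "mat ((M - D) \<union> N)"
      unfolding mat_def using MF N(1) by blast
    then have le: "card ((M - D) \<union> N) \<le> card M" by (rule Mmax)
    have "(M - D) \<inter> N = {}"
    proof (rule ccontr)
      assume "(M - D) \<inter> N \<noteq> {}"
      then obtain e where "e \<in> M - D" "e \<in> N" by blast
      then have "e \<inter> e = {}" using cross by blast
      then show False using F2[of e] \<open>e \<in> N\<close> N by auto
    qed
    then have "card ((M - D) \<union> N) = card (M - D) + card N"
      using finM finF N(1) by (intro card_Un_disjoint) (auto intro: finite_subset)
    moreover have "card (M - D) + card D = card M"
      using D finM by (metis card_Diff_subset card_mono finite_subset le_add_diff_inverse2)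
    ultimately show ?thesis using le by simp
  qed
  have R0V: "R0 \<subseteq> V" by (auto simp: R0_def)
  have R0empty: "R0 = {}"
  proof (rule ccontr)
    assume "R0 \<noteq> {}"
    then obtain r1 where r1: "r1 \<in> R0" by blast
    have fe: "finite e" if "e \<in> M" for e using that MF F2 finV finite_subset by blast
    have "card (\<Union>M) = (\<Sum>e\<in>M. card e)"
      by (rule card_Union_disjoint) (use Mdisj fe in \<open>auto simp: pairwise_def disjnt_def\<close>)
    also have "\<dots> = 2 * card M" using MF F2 by (simp add: subset_iff)
    finally have "even (card (\<Union>M))" by simp
    moreover have "card V = card R0 + card (\<Union>M)"
    proof -
      have "\<Union>M \<subseteq> V" using MF F2 by blast
      then show ?thesis unfolding R0_def using finV
        by (metis Diff_disjoint Diff_partition card_Un_disjoint finite_Diff finite_subset inf_commute add.commute)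
    qed
    ultimately have evR: "even (card R0)" using even_V by simp
    have "R0 \<noteq> {r1}" using evR by auto
    then obtain r2 where r2: "r2 \<in> R0" "r2 \<noteq> r1" using r1 by blast
    have other: "\<exists>r'\<in>R0. r' \<noteq> r" for r using r1 r2 by metis
    have RW: "r \<in> W" if r: "r \<in> R0" for r
    proof (rule ccontr)
      assume "r \<notin> W"
      then have rU: "r \<in> U" using r R0V UW by blast
      obtain r' where r': "r' \<in> R0" "r' \<noteq> r" using other by blast
      then have "{r, r'} \<in> F" using rU R0V by (auto simp: U_def)
      then have "card {{r, r'}} \<le> card ({} :: 'a set set)" using r r' by (intro improve) auto
      then show False by simp
    qed
    have Rind: "\<not> R r r'" if "r \<in> R0" "r' \<in> R0" "r \<noteq> r'" for r r'
    proof
      assume "R r r'"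
      then have "{r, r'} \<in> F" using that by (simp add: R_def)
      then have "card {{r, r'}} \<le> card ({} :: 'a set set)" using that by (intro improve) auto
      then show False by simp
    qed
    have UF: "{u, x} \<in> F" if "u \<in> U" "x \<in> V" "x \<noteq> u" for u x using that by (auto simp: U_def)
    have partner: "\<exists>x. {u, x} \<in> M \<and> x \<in> W" if u: "u \<in> U" for u
    proof -
      have uV: "u \<in> V" "u \<notin> R0" using u UW RW by auto
      then obtain e where e: "e \<in> M" "u \<in> e" by (auto simp: R0_def)
      then have "e \<subseteq> V" "card e = 2" using MF F2 by auto
      then obtain x where x: "e = {u, x}" "x \<noteq> u" "x \<in> V" using e(2) by (auto simp: card_2_iff)
      have "x \<notin> U"
      proof
        assume xU: "x \<in> U"
        have d: "u \<notin> R0" "x \<notin> R0" using uV RW xU UW by auto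
        have "card {{u, r1}, {x, r2}} \<le> card {e}"
        proof (rule improve)
          show "{{u, r1}, {x, r2}} \<subseteq> F" using UF u xU r1 r2 R0V d by auto
          show "\<Union>{{u, r1}, {x, r2}} \<subseteq> R0 \<union> \<Union>{e}" using r1 r2 x by auto
          show "f \<inter> f' = {}" if "f \<in> {{u, r1}, {x, r2}}" "f' \<in> {{u, r1}, {x, r2}}" "f \<noteq> f'" for f f'
            using that x r2 r1 d by auto
        qed (use e in auto)
        moreover have "{u, r1} \<noteq> {x, r2}" using x r2 r1 d by (auto simp: doubleton_eq_iff)
        ultimately show False by simp
      qed
      then show ?thesis using x e UW by blast
    qed
    then obtain p where p: "\<And>u. u \<in> U \<Longrightarrow> {u, p u} \<in> M" "\<And>u. u \<in> U \<Longrightarrow> p u \<in> W" by metis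
    have pR: "p u \<notin> R0" "u \<notin> R0" if "u \<in> U" for u using p(1)[OF that] by (auto simp: R0_def)
    have UR: "{u, r} \<in> F" if "u \<in> U" "r \<in> R0" for u r
      using UF[of u r] that R0V pR(2)[of u] by auto
    have pinj: "u = u'" if "u \<in> U" "u' \<in> U" "p u = p u'" for u u'
      using Mdisj[OF p(1)[OF that(1)] p(1)[OF that(2)]] that p(2) UW by (metis disjoint_iff doubleton_eq_iff insertI1 insertI2)
    \<comment> \<open>Otherwise two matching edges could be traded for three: the partners are
      joined to each other, and \<open>u\<close> and \<open>u'\<close> to two unmatched
      vertices.\<close>
    have c1: "\<not> R (p u) (p u')" if u: "u \<in> U" "u' \<in> U" "u \<noteq> u'" for u u'
    proof
      assume "R (p u) (p u')"
      moreover have pp: "p u \<noteq> p u'" using pinj u by blast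
      ultimately have f: "{p u, p u'} \<in> F" by (simp add: R_def)
      have ne: "u \<noteq> p u" "u \<noteq> p u'" "u' \<noteq> p u" "u' \<noteq> p u'"
        using p(2)[OF u(1)] p(2)[OF u(2)] u(1,2) UW(1) by auto
      let ?N = "{{p u, p u'}, {u, r1}, {u', r2}}"
      have "card ?N \<le> card {{u, p u}, {u', p u'}}"
      proof (rule improve)
        show "{{u, p u}, {u', p u'}} \<subseteq> M" using p u by auto
        show "?N \<subseteq> F" using f UR u r1 r2 by simp
        show "\<Union>?N \<subseteq> R0 \<union> \<Union>{{u, p u}, {u', p u'}}" using r1 r2 by auto
        show "e \<inter> e' = {}" if "e \<in> ?N" "e' \<in> ?N" "e \<noteq> e'" for e e'
          using that ne u r1 r2 pR by auto
      qed
      moreover have "card ?N = 3"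
        using ne u r1 r2 pR by (auto simp: card_insert_if doubleton_eq_iff)
      ultimately show False by (simp add: card_insert_if split: if_splits)
    qed
    have c2: "\<not> R (p u) r" if u: "u \<in> U" "r \<in> R0" for u r
    proof
      assume "R (p u) r"
      then have f: "{p u, r} \<in> F" using pR u by (auto simp: R_def)
      obtain r' where r': "r' \<in> R0" "r' \<noteq> r" using other by blast
      have ne: "u \<noteq> p u" using p(2)[OF u(1)] u(1) UW(1) by auto
      let ?N = "{{p u, r}, {u, r'}}"
      have "card ?N \<le> card {{u, p u}}"
      proof (rule improve)
        show "{{u, p u}} \<subseteq> M" using p u by auto
        show "?N \<subseteq> F" using f UR u r' by simp
        show "\<Union>?N \<subseteq> R0 \<union> \<Union>{{u, p u}}" using u r' by auto
        show "e \<inter> e' = {}" if "e \<in> ?N" "e' \<in> ?N" "e \<noteq> e'" for e e'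
          using that ne u r' pR by auto
      qed
      moreover have "{p u, r} \<noteq> {u, r'}" using ne u r' pR by (auto simp: doubleton_eq_iff)
      ultimately show False by simp
    qed
    \<comment> \<open>The classes of the partners of \<open>U\<close> and those of the unmatched
      vertices are all different, which gives more classes than \<open>U\<close> has
      vertices.\<close>
    define \<phi> where "\<phi> = (\<lambda>x. if x \<in> U then cl (p x) else cl x)"
    have clR: "R x y" if "cl x = cl y" "x \<in> W" "y \<in> W" for x y
      using that clself[of y] by (auto simp: cl_def)
    have "inj_on \<phi> (U \<union> R0)"
    proof (rule inj_onI)
      fix x y assume xy: "x \<in> U \<union> R0" "y \<in> U \<union> R0" and eq: "\<phi> x = \<phi> y"
      show "x = y"
      proof (cases "x \<in> U"; cases "y \<in> U")
        assume "x \<in> U" "y \<in> U"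
        then show ?thesis using eq c1[of x y] clR[of "p x" "p y"] p by (auto simp: \<phi>_def)
      next
        assume "x \<in> U" "y \<notin> U"
        then show ?thesis using eq c2[of x y] clR[of "p x" y] p RW xy by (auto simp: \<phi>_def)
      next
        assume "x \<notin> U" "y \<in> U"
        then show ?thesis using eq c2[of y x] clR[of "p y" x] p RW xy by (auto simp: \<phi>_def)
      next
        assume "x \<notin> U" "y \<notin> U"
        then show ?thesis using eq Rind[of x y] clR[of x y] RW xy by (auto simp: \<phi>_def)
      qed
    qed
    moreover have "\<phi> ` (U \<union> R0) \<subseteq> cl ` W" using p RW by (auto simp: \<phi>_def)
    ultimately have "card (U \<union> R0) \<le> card (cl ` W)" using finW by (intro card_inj_on_le) auto
    moreover have "card (U \<union> R0) = card U + card R0"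
      using finU finV R0V RW UW by (intro card_Un_disjoint) (auto intro: finite_subset)
    moreover have "card R0 > 0" using r1 finite_subset[OF R0V finV] by (auto simp: card_gt_0_iff)
    ultimately show False using few by linarith
  qed
  have "\<exists>y. {x, y} \<in> M" if "x \<in> V" for x
  proof -
    obtain e where e: "e \<in> M" "x \<in> e" using R0empty \<open>x \<in> V\<close> by (auto simp: R0_def)
    then have "card e = 2" using MF F2 by auto
    then show ?thesis using e by (auto simp: card_2_iff insert_commute)
  qed
  then obtain m where m: "\<And>x. x \<in> V \<Longrightarrow> {x, m x} \<in> M" by metis
  have mV: "m x \<in> V" "m x \<noteq> x" if "x \<in> V" for x
    using F2[of "{x, m x}"] m[OF that] MF by (auto simp: card_2_iff doubleton_eq_iff)
  have mm: "m (m x) = x" if x: "x \<in> V" for x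
  proof -
    have "{x, m x} \<inter> {m x, m (m x)} \<noteq> {}" by auto
    then have "{x, m x} = {m x, m (m x)}"
      using Mdisj[OF m[OF x] m[OF mV(1)[OF x]]] by blast
    then show ?thesis by (auto simp: doubleton_eq_iff)
  qed
  have "perfect_matching V F m"
    unfolding perfect_matching_def fpf_involution_def using m mV mm MF by blast
  then show False using noF by blast
qed

end

subsection \<open>Edge colourings\<close>

text \<open>Greedy colouring: the edge with few neighbours is put aside, the rest is coloured, and a
  free colour remains for it. This is used with two colours for paths and with four directions for
  pieces.\<close>

lemma degenerate_edge_colouring:
  assumes "finite E" "finite C"
    and "\<And>F. F \<subseteq> E \<Longrightarrow> F \<noteq> {} \<Longrightarrow> \<exists>e\<in>F. card {e' \<in> F. e' \<noteq> e \<and> e' \<inter> e \<noteq> {}} < card C"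
  shows "\<exists>\<kappa>. \<kappa> ` E \<subseteq> C \<and> (\<forall>e\<in>E. \<forall>e'\<in>E. e \<noteq> e' \<and> e \<inter> e' \<noteq> {} \<longrightarrow> \<kappa> e \<noteq> \<kappa> e')"
  using assms(1,3)
proof (induction "card E" arbitrary: E rule: less_induct)
  case less
  show ?case
  proof (cases "E = {}")
    case False
    then obtain e where e: "e \<in> E" "card {e' \<in> E. e' \<noteq> e \<and> e' \<inter> e \<noteq> {}} < card C"
      using less.prems(2) by blast
    have "card (E - {e}) < card E" using e less.prems(1) by (intro psubset_card_mono) auto
    moreover have "\<exists>f\<in>F. card {e' \<in> F. e' \<noteq> f \<and> e' \<inter> f \<noteq> {}} < card C"
      if "F \<subseteq> E - {e}" "F \<noteq> {}" for F using that less.prems(2)[of F] by blast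
    ultimately obtain \<kappa> where \<kappa>: "\<kappa> ` (E - {e}) \<subseteq> C"
        "\<forall>f\<in>E - {e}. \<forall>f'\<in>E - {e}. f \<noteq> f' \<and> f \<inter> f' \<noteq> {} \<longrightarrow> \<kappa> f \<noteq> \<kappa> f'"
      using less.hyps[of "E - {e}"] less.prems(1) by auto
    let ?N = "{e' \<in> E. e' \<noteq> e \<and> e' \<inter> e \<noteq> {}}"
    have "card (\<kappa> ` ?N) < card C"
      using e(2) card_image_le[of ?N \<kappa>] less.prems(1) by (simp add: le_less_trans)
    then have "\<not> C \<subseteq> \<kappa> ` ?N"
      using less.prems(1) card_mono[of "\<kappa> ` ?N" C] by auto
    then obtain c where c: "c \<in> C" "c \<notin> \<kappa> ` ?N" by blast
    have "(\<kappa>(e := c)) f \<noteq> (\<kappa>(e := c)) f'"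
      if f: "f \<in> E" "f' \<in> E" "f \<noteq> f'" "f \<inter> f' \<noteq> {}" for f f'
    proof -
      consider "f = e" "f' \<in> ?N" | "f' = e" "f \<in> ?N" | "f \<in> E - {e}" "f' \<in> E - {e}"
        using f by blast
      then show ?thesis
      proof cases
        case 1
        then have "\<kappa> f' \<in> \<kappa> ` ?N" by blast
        then show ?thesis using 1 c f by auto
      next
        case 2
        then have "\<kappa> f \<in> \<kappa> ` ?N" by blast
        then show ?thesis using 2 c f by auto
      next
        case 3
        then show ?thesis using \<kappa>(2) f by auto
      qed
    qed
    moreover have "(\<kappa>(e := c)) ` E \<subseteq> C" using \<kappa>(1) c(1) by (auto simp: image_subset_iff)
    ultimately show ?thesis by blast
  qed auto
qed

lemma properI:
  assumes "\<And>e e'. e \<in> E \<Longrightarrow> e' \<in> E \<Longrightarrow> e \<noteq> e' \<Longrightarrow> e \<inter> e' \<noteq> {} \<Longrightarrow> \<kappa> e \<noteq> \<kappa> e'"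
  shows "proper E \<kappa>"
  unfolding proper_def
proof (intro allI inj_onI)
  fix x y y' assume y: "y \<in> nb E x" "y' \<in> nb E x" and eq: "\<kappa> {x, y} = \<kappa> {x, y'}"
  show "y = y'"
  proof (rule ccontr)
    assume "y \<noteq> y'"
    then have "{x, y} \<noteq> {x, y'}" by (auto simp: doubleton_eq_iff)
    then show False using assms[of "{x, y}" "{x, y'}"] y eq by (auto simp: nb_def)
  qed
qed

lemma properD:
  "proper E \<kappa> \<Longrightarrow> {x, y} \<in> E \<Longrightarrow> {x, y'} \<in> E \<Longrightarrow> y \<noteq> y' \<Longrightarrow> \<kappa> {x, y} \<noteq> \<kappa> {x, y'}"
  by (auto simp: proper_def nb_def inj_on_def)

definition generic_colouring :: "'a set \<Rightarrow> 'a set set \<Rightarrow> ('a set \<Rightarrow> dir) \<Rightarrow> bool" where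
  "generic_colouring V E \<kappa> \<longleftrightarrow>
     (\<forall>u v w \<omega>. {u, v} \<in> E \<longrightarrow> w \<in> V - {u, v} \<longrightarrow> \<not> stress V E \<kappa> u v w \<omega>)"

section \<open>Zeros of a stress in three-edge-connected graphs, and 3-edge-colourable
  graphs\<close>

context three_edge_connected
begin

text \<open>Let \<open>S\<close> be the vertices apart from \<open>w\<close> that carry stress, and
  let k of the edges at \<open>w\<close> lead to \<open>S\<close>. The cut of \<open>S\<close> has
  at most k + 1 edges and the cut of \<open>insert w S\<close> at most (3 - k) + 1. Both being at
  least 3 is impossible.\<close>

lemma no_dead_vertex:
  assumes pr: "proper E \<kappa>" and \<omega>: "stress V E \<kappa> u v w \<omega>"
    and e: "{u, v} \<in> E" and w: "w \<in> V - {u, v}"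
    and z: "z \<in> V" "z \<noteq> w" "y \<in> nb E z"
  shows "\<omega> z y \<noteq> 0"
proof
  assume zero: "\<omega> z y = 0"
  have dead: "\<omega> x b = 0" if "x \<in> V" "x \<noteq> w" "a \<in> nb E x" "\<omega> x a = 0" "b \<in> nb E x" for x a b
    by (rule dead_vertex[where E = E and y = a and \<kappa> = \<kappa>])
      (use \<omega> that finite_nb[OF G] card_nb[OF that(1)] pr in \<open>auto simp: stress_def\<close>)
  define D where "D = {x \<in> V - {w}. \<forall>y\<in>nb E x. \<omega> x y = 0}"
  have zD: "z \<in> D" using z zero dead by (auto simp: D_def)
  define S where "S = V - {w} - D"
  \<comment> \<open>Off the edge \<open>uv\<close> antisymmetry carries a zero across an edge, and
    it then kills the whole vertex on the other side.\<close>
  have out: "{a, b} = {u, v}" if ab: "{a, b} \<in> E" "a \<in> S" "b \<notin> S" "b \<noteq> w" for a b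
  proof (rule ccontr)
    assume ne: "{a, b} \<noteq> {u, v}"
    have "b \<in> D" using ab simple_graph_edgeD[OF G ab(1)] by (auto simp: S_def)
    moreover have "a \<in> nb E b" "b \<in> nb E a" using ab by (auto simp: nb_def insert_commute)
    ultimately have "\<omega> b a = 0" by (simp add: D_def)
    then have "\<omega> a b = 0" using \<omega> ab(1) ne by (auto simp: stress_def)
    then have "a \<in> D" using dead[of a b] ab(2) \<open>b \<in> nb E a\<close> by (auto simp: D_def S_def)
    then show False using ab by (auto simp: S_def)
  qed
  \<comment> \<open>If both \<open>u\<close> and \<open>v\<close> were dead, the two values on
    \<open>uv\<close> could not add up to 1.\<close>
  have "S \<noteq> {}"
  proof
    assume "S = {}"
    moreover have "u \<in> V" "v \<in> V" using simple_graph_edgeD[OF G e] by auto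
    ultimately have "u \<in> D" "v \<in> D" using w by (auto simp: S_def)
    then have "\<omega> u v = 0" "\<omega> v u = 0" using e by (auto simp: D_def nb_def insert_commute)
    then show False using \<omega> by (simp add: stress_def)
  qed
  have fin: "finite (nb E w)" by (rule finite_nb[OF G])
  have inj: "inj_on (\<lambda>x. {w, x}) A" for A by (auto simp: inj_on_def doubleton_eq_iff)
  have "cut E S \<subseteq> insert {u, v} ((\<lambda>x. {w, x}) ` (nb E w \<inter> S))"
  proof
    fix f assume f: "f \<in> cut E S"
    then obtain a where a: "a \<in> f" "a \<in> S" "f \<in> E" by (auto simp: cut_def)
    then obtain b where b: "f = {a, b}" using simple_graph_edgeE[OF G] by metis
    have "b \<notin> S" using f b a by (auto simp: cut_def)
    then show "f \<in> insert {u, v} ((\<lambda>x. {w, x}) ` (nb E w \<inter> S))"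
      using out[of a b] a b by (cases "b = w") (auto simp: nb_def insert_commute)
  qed
  then have "card (cut E S) \<le> card (insert {u, v} ((\<lambda>x. {w, x}) ` (nb E w \<inter> S)))"
    using fin by (intro card_mono) auto
  also have "\<dots> \<le> Suc (card (nb E w \<inter> S))"
    using fin by (simp add: card_insert_if card_image[OF inj])
  finally have "card (cut E S) \<le> Suc (card (nb E w \<inter> S))" .
  moreover have "3 \<le> card (cut E S)"
    by (rule cut_ge_3) (use \<open>S \<noteq> {}\<close> w in \<open>auto simp: S_def\<close>)
  ultimately have two: "2 \<le> card (nb E w \<inter> S)" by simp
  have "cut E (insert w S) \<subseteq> insert {u, v} ((\<lambda>x. {w, x}) ` (nb E w - S))"
  proof
    fix f assume f: "f \<in> cut E (insert w S)"
    then obtain a where a: "a \<in> f" "a \<in> insert w S" "f \<in> E" by (auto simp: cut_def)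
    then obtain b where b: "f = {a, b}" using simple_graph_edgeE[OF G] by metis
    have "b \<notin> S" "b \<noteq> w" using f b a by (auto simp: cut_def)
    then show "f \<in> insert {u, v} ((\<lambda>x. {w, x}) ` (nb E w - S))"
      using out[of a b] a b by (cases "a = w") (auto simp: nb_def)
  qed
  then have "card (cut E (insert w S)) \<le> card (insert {u, v} ((\<lambda>x. {w, x}) ` (nb E w - S)))"
    using fin by (intro card_mono) auto
  also have "\<dots> \<le> Suc (card (nb E w - S))"
    using fin by (simp add: card_insert_if card_image[OF inj])
  also have "card (nb E w - S) = 3 - card (nb E w \<inter> S)"
    using card_nb[of w] w fin by (simp add: card_Diff_subset_Int)
  finally have "card (cut E (insert w S)) \<le> Suc (3 - card (nb E w \<inter> S))" .
  moreover have "3 \<le> card (cut E (insert w S))"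
    by (rule cut_ge_3) (use zD z w in \<open>auto simp: S_def\<close>)
  ultimately show False using two by simp
qed

text \<open>There is a nowhere-zero self-stress \<sigma> in equilibrium at every vertex. Subtracting
  the right multiple of it from a stress for \<open>u v w\<close> gives another such stress that
  vanishes at \<open>u\<close> along \<open>uv\<close>.\<close>

lemma tait_colouring_generic:
  assumes c: "proper E c" "\<And>e. e \<in> E \<Longrightarrow> c e \<in> {0, 1, 2 :: nat}"
  shows "\<exists>\<kappa>. proper E \<kappa> \<and> generic_colouring V E \<kappa>"
proof -
  have ex: "\<exists>y. y \<in> nb E x \<and> c {x, y} = i" if x: "x \<in> V" and i: "i \<in> {0, 1, 2}" for x i
  proof -
    have "card ((\<lambda>y. c {x, y}) ` nb E x) = 3"
      using c(1) card_nb[OF x] by (simp add: card_image proper_def)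
    moreover have "(\<lambda>y. c {x, y}) ` nb E x \<subseteq> {0, 1, 2}"
    proof
      fix k assume "k \<in> (\<lambda>y. c {x, y}) ` nb E x"
      then obtain y where "k = c {x, y}" "{x, y} \<in> E" by (auto simp: nb_def)
      then show "k \<in> {0, 1, 2}" using c(2) by metis
    qed
    ultimately have "(\<lambda>y. c {x, y}) ` nb E x = {0, 1, 2}"
      by (intro card_subset_eq) simp_all
    then have "i \<in> (\<lambda>y. c {x, y}) ` nb E x" using i by simp
    then show ?thesis by auto
  qed
  define m where "m = (\<lambda>i x. SOME y. y \<in> nb E x \<and> c {x, y} = i)"
  have m: "m i x \<in> nb E x" "c {x, m i x} = i" if "x \<in> V" "i \<in> {0, 1, 2}" for x i
    using someI_ex[OF ex[OF that]] by (auto simp: m_def)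
  have mun: "y = m i x" if "x \<in> V" "i \<in> {0, 1, 2}" "{x, y} \<in> E" "c {x, y} = i" for x y i
    using properD[OF c(1) that(3), of "m i x"] m[OF that(1,2)] that(4) by (auto simp: nb_def)
  have mV: "m i x \<in> V" "m i x \<noteq> x" if "x \<in> V" "i \<in> {0, 1, 2}" for x i
    using m(1)[OF that] nb_subset[OF G, of x] by auto
  have mm: "m i (m i x) = x" if "x \<in> V" "i \<in> {0, 1, 2}" for x i
    using mun[OF mV(1)[OF that] that(2), of x] m[OF that] by (simp add: nb_def insert_commute)
  have inv: "fpf_involution V (m i)" if "i \<in> {0, 1, 2}" for i
    unfolding fpf_involution_def using mV[OF _ that] mm[OF _ that] by simp
  have inv012: "fpf_involution V (m 0)" "fpf_involution V (m 1)" "fpf_involution V (m 2)"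
    by (rule inv, simp)+
  \<comment> \<open>\<tau> alternates along the cycles of colours 0 and 2, \<tau>' along those of
    colours 0 and 1. An edge of colour 0 flips both, so whether they agree is the same at its two
    ends.\<close>
  obtain \<tau> where \<tau>: "\<And>x. x \<in> V \<Longrightarrow> \<tau> (m 0 x) = (\<not> \<tau> x) \<and> \<tau> (m 2 x) = (\<not> \<tau> x)"
    using two_involutions_bipartite[OF finV inv012(1,3)] by blast
  obtain \<tau>' where \<tau>': "\<And>x. x \<in> V \<Longrightarrow> \<tau>' (m 0 x) = (\<not> \<tau>' x) \<and> \<tau>' (m 1 x) = (\<not> \<tau>' x)"
    using two_involutions_bipartite[OF finV inv012(1,2)] by blast
  define \<kappa> where "\<kappa> = (\<lambda>e. if c e = 1 then Dp else if c e = 2 then Dn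
     else if \<exists>x\<in>e. \<tau> x = \<tau>' x then Dh else Dv)"
  have \<kappa>0: "\<kappa> {x, m 0 x} = (if \<tau> x = \<tau>' x then Dh else Dv)" if "x \<in> V" for x
    using m(2)[OF that, of 0] \<tau>[OF that] \<tau>'[OF that] by (auto simp: \<kappa>_def)
  have \<kappa>12: "\<kappa> {x, m 1 x} = Dp" "\<kappa> {x, m 2 x} = Dn" if "x \<in> V" for x
    using m(2)[OF that] by (auto simp: \<kappa>_def)
  have nb3: "nb E x = {m 0 x, m 1 x, m 2 x}" "m 0 x \<noteq> m 1 x" "m 0 x \<noteq> m 2 x" "m 1 x \<noteq> m 2 x"
    if x: "x \<in> V" for x
  proof -
    show "m 0 x \<noteq> m 1 x" "m 0 x \<noteq> m 2 x" "m 1 x \<noteq> m 2 x"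
      using m(2)[OF x, of 0] m(2)[OF x, of 1] m(2)[OF x, of 2] by auto
    then have "card {m 0 x, m 1 x, m 2 x} = 3" by simp
    moreover have "{m 0 x, m 1 x, m 2 x} \<subseteq> nb E x" using m(1)[OF x] by simp
    ultimately show "nb E x = {m 0 x, m 1 x, m 2 x}"
      using card_nb[OF x] finite_nb[OF G] by (metis card_subset_eq)
  qed
  have prp: "proper E \<kappa>"
    unfolding proper_def
  proof
    fix x
    show "inj_on (\<lambda>y. \<kappa> {x, y}) (nb E x)"
    proof (cases "x \<in> V")
      case True
      then show ?thesis using \<kappa>0[OF True] \<kappa>12[OF True] unfolding nb3(1)[OF True] by auto
    next
      case False
      then have "nb E x = {}" using simple_graph_edgeD[OF G] by (auto simp: nb_def)
      then show ?thesis by simp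
    qed
  qed
  define s s' where "s = (\<lambda>x. if \<tau> x then 1 else -1 :: real)" and "s' = (\<lambda>x. if \<tau>' x then 1 else -1 :: real)"
  \<comment> \<open>With unit forces of signs \<open>s'\<close> on \<open>Dp\<close> and
    \<open>s\<close> on \<open>Dn\<close>, the sum is \<open>2 * s\<close> times the normal of
    \<open>Dh\<close> if the signs agree and of \<open>Dv\<close> if they differ. This explains the
    direction and the factor -2 for colour 0.\<close>
  define \<sigma> where "\<sigma> = (\<lambda>x y. if c {x, y} = 2 then s x else if c {x, y} = 1 then s' x else - 2 * s x)"
  have anti: "\<sigma> x y = - \<sigma> y x" if e: "{x, y} \<in> E" for x y
  proof -
    have x: "x \<in> V" using simple_graph_edgeD[OF G e] by auto
    have "c {x, y} \<in> {0, 1, 2}" using c(2) e by blast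
    then have "y = m (c {x, y}) x" using mun[OF x _ e] by simp
    moreover have "c {y, x} = c {x, y}" by (simp add: insert_commute)
    ultimately show ?thesis using \<tau>[OF x] \<tau>'[OF x] c(2)[OF e]
      by (auto simp: \<sigma>_def s_def s'_def)
  qed
  have bal: "(\<Sum>y\<in>nb E x. \<sigma> x y *\<^sub>R nrm (\<kappa> {x, y})) = 0" if x: "x \<in> V" for x
  proof -
    have "(\<Sum>y\<in>nb E x. \<sigma> x y *\<^sub>R nrm (\<kappa> {x, y}))
      = \<sigma> x (m 0 x) *\<^sub>R nrm (\<kappa> {x, m 0 x}) + \<sigma> x (m 1 x) *\<^sub>R nrm (\<kappa> {x, m 1 x}) + \<sigma> x (m 2 x) *\<^sub>R nrm (\<kappa> {x, m 2 x})"
      unfolding nb3(1)[OF x] using nb3(2-4)[OF x] by (simp add: add.assoc)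
    also have "\<dots> = 0"
      using m(2)[OF x, of 0] m(2)[OF x, of 1] m(2)[OF x, of 2] \<kappa>0[OF x] \<kappa>12[OF x]
      by (auto simp: \<sigma>_def s_def s'_def zero_prod_def)
    finally show ?thesis .
  qed
  have nz: "\<sigma> x y \<noteq> 0" for x y by (auto simp: \<sigma>_def s_def s'_def)
  have "generic_colouring V E \<kappa>"
    unfolding generic_colouring_def
  proof (intro allI impI notI)
    fix u v w \<omega> assume e: "{u, v} \<in> E" and w: "w \<in> V - {u, v}" and \<omega>: "stress V E \<kappa> u v w \<omega>"
    have u: "u \<in> V" "v \<in> nb E u" using simple_graph_edgeD[OF G e] e by (auto simp: nb_def)
    \<comment> \<open>Chosen to make the modified stress vanish at \<open>u\<close> along
      \<open>uv\<close>; antisymmetry of \<sigma> keeps the two values on \<open>uv\<close> adding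
      up to 1.\<close>
    define r where "r = \<omega> u v / \<sigma> u v"
    define \<omega>' where "\<omega>' = (\<lambda>x y. \<omega> x y - r * \<sigma> x y)"
    have "stress V E \<kappa> u v w \<omega>'"
      unfolding stress_def
    proof (intro conjI allI impI ballI)
      show "\<omega>' x y = - \<omega>' y x" if "{x, y} \<in> E \<and> {x, y} \<noteq> {u, v}" for x y
        using that \<omega> anti[of x y] by (auto simp: \<omega>'_def stress_def)
      show "\<omega>' u v + \<omega>' v u = 1"
        using \<omega> anti[OF e] by (auto simp: \<omega>'_def stress_def)
      fix z assume z: "z \<in> V - {w}"
      have "(\<Sum>y\<in>nb E z. \<omega>' z y *\<^sub>R nrm (\<kappa> {z, y}))
        = (\<Sum>y\<in>nb E z. \<omega> z y *\<^sub>R nrm (\<kappa> {z, y})) - r *\<^sub>R (\<Sum>y\<in>nb E z. \<sigma> z y *\<^sub>R nrm (\<kappa> {z, y}))"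
        by (simp add: \<omega>'_def algebra_simps sum_subtractf scaleR_sum_right)
      then show "(\<Sum>y\<in>nb E z. \<omega>' z y *\<^sub>R nrm (\<kappa> {z, y})) = 0"
        using bal[of z] z \<omega> by (simp add: stress_def)
    qed
    then have "\<omega>' u v \<noteq> 0" using no_dead_vertex[OF prp _ e w u(1) _ u(2)] w by auto
    then show False using nz[of u v] by (simp add: \<omega>'_def r_def)
  qed
  then show ?thesis using prp by blast
qed

end

subsection \<open>The cycles left by a perfect matching\<close>

text \<open>The ratios come from the normals themselves: the two diagonal normals have sum (0,2) and
  difference (2,0), while a horizontal and a diagonal normal with unit coefficients of opposite sign
  leave a unit vertical one.\<close>

lemma equilibrium_diagonals:
  assumes eq: "a *\<^sub>R nrm s + b *\<^sub>R nrm t + c *\<^sub>R nrm r = 0"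
    and ne: "s \<noteq> t" "s \<noteq> r" "t \<noteq> r" "s \<noteq> Dv" "t \<noteq> Dv"
  shows "r = Dv \<Longrightarrow> \<bar>a\<bar> = \<bar>b\<bar> \<and> \<bar>c\<bar> = (if Dh \<in> {s, t} then 1 else 2) * \<bar>a\<bar>"
    and "r = Dh \<Longrightarrow> \<bar>a\<bar> = \<bar>b\<bar> \<and> \<bar>c\<bar> = 2 * \<bar>a\<bar>"
    and "r \<noteq> Dh \<Longrightarrow> r \<noteq> Dv \<Longrightarrow> s = Dh \<Longrightarrow> \<bar>a\<bar> = 2 * \<bar>b\<bar>"
proof -
  have x: "a * fst (nrm s) + b * fst (nrm t) + c * fst (nrm r) = 0"
    and y: "a * snd (nrm s) + b * snd (nrm t) + c * snd (nrm r) = 0"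
    using arg_cong[OF eq, of fst] arg_cong[OF eq, of snd] by simp_all
  show "r = Dv \<Longrightarrow> \<bar>a\<bar> = \<bar>b\<bar> \<and> \<bar>c\<bar> = (if Dh \<in> {s, t} then 1 else 2) * \<bar>a\<bar>"
    using x y ne by (cases s; cases t; simp; arith)
  show "r = Dh \<Longrightarrow> \<bar>a\<bar> = \<bar>b\<bar> \<and> \<bar>c\<bar> = 2 * \<bar>a\<bar>"
    using x y ne by (cases s; cases t; simp; arith)
  show "r \<noteq> Dh \<Longrightarrow> r \<noteq> Dv \<Longrightarrow> s = Dh \<Longrightarrow> \<bar>a\<bar> = 2 * \<bar>b\<bar>"
    using x y ne by (cases r; cases t; simp; arith)
qed

locale matched = three_edge_connected V E for V :: "'a set" and E +
  fixes m :: "'a \<Rightarrow> 'a"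
  assumes pm: "perfect_matching V E m"
begin

definition M where "M = (\<lambda>x. {x, m x}) ` V"

text \<open>The two neighbours along the cycles that remain when the matching is removed.\<close>

definition Hn where "Hn x = nb E x - {m x}"

lemma m: assumes "x \<in> V" shows "m x \<in> V" "m x \<noteq> x" "m (m x) = x" "{x, m x} \<in> E" "m x \<in> nb E x"
  using pm assms by (auto simp: perfect_matching_def fpf_involution_def nb_def)

lemma M_sub: "M \<subseteq> E" using m by (auto simp: M_def)

lemma M_iff: "x \<in> V \<Longrightarrow> {x, y} \<in> M \<longleftrightarrow> y = m x"
  using m by (auto simp: M_def doubleton_eq_iff)

lemma Hn_V: "Hn x \<subseteq> V" using nb_subset[OF G, of x] by (auto simp: Hn_def)

lemma card_Hn: "x \<in> V \<Longrightarrow> card (Hn x) = 2"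
  using card_nb[of x] m[of x] finite_nb[OF G, of x] by (simp add: Hn_def card_Diff_singleton)

lemma Hn_iff: "x \<in> V \<Longrightarrow> y \<in> Hn x \<longleftrightarrow> {x, y} \<in> E - M"
  by (auto simp: Hn_def nb_def M_iff)

lemma Hn_sym: "x \<in> V \<Longrightarrow> y \<in> Hn x \<Longrightarrow> x \<in> Hn y"
  using Hn_iff[of x y] Hn_iff[of y x] Hn_V[of x] by (auto simp: insert_commute)

lemma Hn_two:
  assumes "x \<in> V" "y \<in> Hn x"
  obtains y' where "Hn x = {y, y'}" "y' \<noteq> y"
proof -
  obtain a b where "Hn x = {a, b}" "a \<noteq> b" using card_Hn[OF assms(1)] by (auto simp: card_2_iff)
  then show thesis using assms(2) that[of a] that[of b] by auto
qed

lemma nb_Hn: "x \<in> V \<Longrightarrow> nb E x = insert (m x) (Hn x)" using m by (auto simp: Hn_def)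

definition closed :: "'a set \<Rightarrow> bool" where
  "closed S \<longleftrightarrow> S \<subseteq> V \<and> (\<forall>x\<in>S. Hn x \<subseteq> S)"

text \<open>The cycle through \<open>x\<close>, obtained as a least closed set so that no walks have
  to be handled.\<close>

definition comp :: "'a \<Rightarrow> 'a set" where
  "comp x = \<Inter> {S. closed S \<and> x \<in> S}"

lemma closed_V: "closed V" using Hn_V by (auto simp: closed_def)

lemma closed_comp: "x \<in> V \<Longrightarrow> closed (comp x)"
  unfolding comp_def closed_def using closed_V[unfolded closed_def] by blast

lemma self_comp: "x \<in> comp x" by (simp add: comp_def)

lemma comp_least: "closed S \<Longrightarrow> x \<in> S \<Longrightarrow> comp x \<subseteq> S" by (auto simp: comp_def)

lemma closed_Compl: "closed S \<Longrightarrow> closed (V - S)"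
  unfolding closed_def using Hn_V Hn_sym by (meson DiffD1 DiffD2 DiffI Diff_subset subset_iff)

lemma closed_Int: "closed S \<Longrightarrow> closed T \<Longrightarrow> closed (S \<inter> T)"
  by (auto simp: closed_def)

text \<open>Adjacency is symmetric, so complements of closed sets are closed. If
  \<open>comp y\<close> missed \<open>x\<close>, removing it from \<open>comp x\<close> would leave
  a smaller closed set around \<open>x\<close>.\<close>

lemma comp_eq:
  assumes "x \<in> V" "y \<in> comp x"
  shows "comp y = comp x"
proof (rule ccontr)
  assume ne: "comp y \<noteq> comp x"
  have y: "y \<in> V" using assms closed_comp[OF assms(1)] by (auto simp: closed_def)
  have sub: "comp y \<subseteq> comp x" using comp_least closed_comp assms by blast
  have "x \<notin> comp y" using ne sub comp_least[OF closed_comp[OF y]] by blast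
  then have "closed (comp x \<inter> (V - comp y))" "x \<in> comp x \<inter> (V - comp y)"
    using closed_comp closed_Compl closed_Int assms y self_comp by blast+
  then have "comp x \<subseteq> V - comp y" using comp_least by blast
  then show False using assms(2) self_comp by blast
qed

lemma closed_minimal:
  assumes "x \<in> V" "closed S" "S \<subseteq> comp x" "S \<noteq> {}"
  shows "S = comp x"
proof -
  obtain y where "y \<in> S" using assms(4) by blast
  then have "comp x = comp y" "comp y \<subseteq> S" using comp_eq assms comp_least by blast+
  then show ?thesis using assms(3) by blast
qed

lemma comp_disjoint:
  assumes "x \<in> V" "y \<in> V" "comp x \<noteq> comp y"
  shows "comp x \<inter> comp y = {}"
  using comp_eq[of x] comp_eq[of y] assms by blast

lemma closed_edge:
  assumes "closed S" "{x, y} \<in> E - M" "x \<in> S"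
  shows "y \<in> S"
  using assms Hn_iff[of x y] by (auto simp: closed_def)

lemma closed_card_gt:
  assumes "closed S" "x \<in> S"
  shows "card S \<ge> 3"
proof -
  have x: "x \<in> V" using assms by (auto simp: closed_def)
  have "x \<notin> Hn x" using nb_subset[OF G, of x] by (auto simp: Hn_def)
  then have "card (insert x (Hn x)) = 3"
    using card_Hn[OF x] finite_nb[OF G, of x] by (simp add: Hn_def)
  moreover have "insert x (Hn x) \<subseteq> S" "finite S"
    using assms finV by (auto simp: closed_def intro: finite_subset)
  ultimately show ?thesis by (metis card_mono)
qed

text \<open>The cycle edges of value \<open>r\<close> form a graph of maximum degree two, and the
  vertices counted are its vertices of odd degree. In particular a value cannot change at exactly
  one vertex of a cycle, which is how contradictions are obtained below.\<close>

lemma parity: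
  assumes B: "closed B" and g: "\<And>x y. x \<in> B \<Longrightarrow> y \<in> Hn x \<Longrightarrow> g x y = g y x"
  shows "even (card {x \<in> B. card {y \<in> Hn x. g x y = (r :: real)} = 1})"
proof -
  define F where "F = {{x, y} | x y. x \<in> B \<and> y \<in> Hn x \<and> g x y = r}"
  have BV: "B \<subseteq> V" using B by (auto simp: closed_def)
  have FE: "F \<subseteq> E" using BV Hn_iff by (auto simp: F_def)
  have mem: "{x, y} \<in> F \<longleftrightarrow> y \<in> Hn x \<and> g x y = r" if x: "x \<in> B" for x y
  proof
    assume "{x, y} \<in> F"
    then obtain a b where ab: "{x, y} = {a, b}" "a \<in> B" "b \<in> Hn a" "g a b = r"
      by (auto simp: F_def)
    then have "a \<in> V" using BV by blast
    then show "y \<in> Hn x \<and> g x y = r" using ab g[of a b] Hn_sym[of a b]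
      by (auto simp: doubleton_eq_iff)
  qed (use x in \<open>auto simp: F_def\<close>)
  have "(\<Sum>v\<in>V. card {e \<in> F. v \<in> e}) = 2 * card F"
    by (rule handshake[OF finV]) (use FE finE G in \<open>auto simp: simple_graph_def intro: finite_subset\<close>)
  then have "even (\<Sum>v\<in>V. card {e \<in> F. v \<in> e})" by simp
  then have ev: "even (card {v \<in> V. odd (card {e \<in> F. v \<in> e})})"
    by (simp only: even_sum_iff[OF finV])
  have "{v \<in> V. odd (card {e \<in> F. v \<in> e})} = {x \<in> B. card {y \<in> Hn x. g x y = r} = 1}"
  proof -
    have "odd (card {e \<in> F. v \<in> e}) \<longleftrightarrow> v \<in> B \<and> card {y \<in> Hn v. g v y = r} = 1" if v: "v \<in> V" for v
    proof (cases "v \<in> B")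
      case True
      have "{e \<in> F. v \<in> e} = (\<lambda>y. {v, y}) ` {y \<in> Hn v. g v y = r}"
      proof (intro equalityI subsetI)
        fix e assume e: "e \<in> {e \<in> F. v \<in> e}"
        then have "e \<in> E" using FE by blast
        then obtain y where "e = {v, y}" using simple_graph_edgeE[OF G] e by (metis mem_Collect_eq)
        then show "e \<in> (\<lambda>y. {v, y}) ` {y \<in> Hn v. g v y = r}" using e mem[OF True] by auto
      qed (use mem[OF True] in auto)
      then have c: "card {e \<in> F. v \<in> e} = card {y \<in> Hn v. g v y = r}"
        by (simp add: card_image inj_on_def doubleton_eq_iff)
      have "card {y \<in> Hn v. g v y = r} \<le> 2"
        using card_mono[of "Hn v" "{y \<in> Hn v. g v y = r}"] card_Hn[OF v] finite_nb[OF G, of v]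
        by (auto simp: Hn_def)
      then show ?thesis using c True by (auto simp: le_Suc_eq numeral_2_eq_2)
    next
      case False
      have "{e \<in> F. v \<in> e} = {}"
        using False B by (auto simp: F_def closed_def)
      then show ?thesis using False by (metis card.empty even_zero)
    qed
    then show ?thesis using BV by blast
  qed
  then show ?thesis using ev by simp
qed

text \<open>Removing at least one edge from every cycle leaves paths, whose edges can be coloured
  alternately. In terms of degeneracy: if each edge of \<open>F\<close> met two others of
  \<open>F\<close>, the vertices of \<open>F\<close> would form a closed set, and an edge of
  \<open>Z\<close> would belong to \<open>F\<close>.\<close>

lemma zero_edge_colouring:
  assumes Z: "\<And>S. closed S \<Longrightarrow> S \<noteq> {} \<Longrightarrow> \<exists>z\<in>Z. z \<subseteq> S \<and> z \<in> E - M"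
  shows "\<exists>c :: 'a set \<Rightarrow> bool. \<forall>e\<in>E - M - Z. \<forall>e'\<in>E - M - Z. e \<noteq> e' \<and> e \<inter> e' \<noteq> {} \<longrightarrow> c e \<noteq> c e'"
proof -
  have "\<exists>e\<in>F. card {e' \<in> F. e' \<noteq> e \<and> e' \<inter> e \<noteq> {}} < card (UNIV :: bool set)"
    if F: "F \<subseteq> E - M - Z" "F \<noteq> {}" for F
  proof (rule ccontr)
    assume "\<not> ?thesis"
    then have two: "2 \<le> card {e' \<in> F. e' \<noteq> e \<and> e' \<inter> e \<noteq> {}}" if "e \<in> F" for e
      using that by (auto simp: not_less)
    have all: "{x, b} \<in> F" if xy: "{x, y} \<in> F" and b: "b \<in> Hn x" for x y b
    proof (cases "b = y")
      case False
      have e: "{x, y} \<in> E - M" using xy F by blast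
      have V: "x \<in> V" "y \<in> V" using simple_graph_edgeD[OF G, of x y] e by auto
      have yH: "y \<in> Hn x" "x \<in> Hn y" using Hn_iff V e by (auto simp: insert_commute)
      obtain b' where b': "Hn x = {y, b'}" using Hn_two[OF V(1) yH(1)] by metis
      obtain a where a: "Hn y = {x, a}" using Hn_two[OF V(2) yH(2)] by metis
      have bb: "b = b'" using b b' False by auto
      have "{e' \<in> F. e' \<noteq> {x, y} \<and> e' \<inter> {x, y} \<noteq> {}} \<subseteq> {{x, b}, {y, a}}"
      proof
        fix e' assume e': "e' \<in> {e' \<in> F. e' \<noteq> {x, y} \<and> e' \<inter> {x, y} \<noteq> {}}"
        then have eE: "e' \<in> E - M" using F by blast
        consider "x \<in> e'" | "y \<in> e'" using e' by blast
        then show "e' \<in> {{x, b}, {y, a}}"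
        proof cases
          case 1
          then obtain z where z: "e' = {x, z}" using simple_graph_edgeE[OF G] eE by (metis DiffD1)
          then have "z \<in> Hn x" using Hn_iff V eE by auto
          then show ?thesis using b' bb z e' by auto
        next
          case 2
          then obtain z where z: "e' = {y, z}" using simple_graph_edgeE[OF G] eE by (metis DiffD1)
          then have "z \<in> Hn y" using Hn_iff V eE by auto
          then show ?thesis using a z e' by (auto simp: insert_commute)
        qed
      qed
      moreover have "\<not> {e' \<in> F. e' \<noteq> {x, y} \<and> e' \<inter> {x, y} \<noteq> {}} \<subseteq> {{y, a}}"
        using two[OF xy] card_mono[of "{{y, a}}" "{e' \<in> F. e' \<noteq> {x, y} \<and> e' \<inter> {x, y} \<noteq> {}}"] by auto
      ultimately show ?thesis by blast
    qed (use xy in simp)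
    have edge: "\<exists>y. {x, y} \<in> F" if x: "x \<in> \<Union>F" for x
    proof -
      obtain e where e: "e \<in> F" "x \<in> e" using x by blast
      then have "e \<in> E" using F by blast
      then show ?thesis using simple_graph_edgeE[OF G _ e(2)] e by metis
    qed
    have "closed (\<Union>F)"
      unfolding closed_def
    proof (intro conjI ballI subsetI)
      fix x assume "x \<in> \<Union>F"
      then obtain e where "e \<in> F" "x \<in> e" by blast
      then show "x \<in> V" using F G by (auto simp: simple_graph_def)
    next
      fix x b assume "x \<in> \<Union>F" "b \<in> Hn x"
      then have "{x, b} \<in> F" using edge all by blast
      then show "b \<in> \<Union>F" by blast
    qed
    moreover have "\<Union>F \<noteq> {}"
    proof -
      obtain e where e: "e \<in> F" using F by blast
      then have "card e = 2" using F G by (auto simp: simple_graph_def)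
      then show ?thesis using e by fastforce
    qed
    ultimately obtain z where z: "z \<in> Z" "z \<subseteq> \<Union>F" "z \<in> E - M" using Z by blast
    then obtain a b where ab: "z = {a, b}" using G by (auto simp: simple_graph_def card_2_iff)
    then have "a \<in> V" using z simple_graph_edgeD[OF G, of a b] by auto
    then have "b \<in> Hn a" using Hn_iff ab z by blast
    moreover obtain y where "{a, y} \<in> F" using edge[of a] z ab by blast
    ultimately have "z \<in> F" using all ab by blast
    then show False using z F by blast
  qed
  then obtain c :: "'a set \<Rightarrow> bool" where "\<forall>e\<in>E - M - Z. \<forall>e'\<in>E - M - Z. e \<noteq> e' \<and> e \<inter> e' \<noteq> {} \<longrightarrow> c e \<noteq> c e'"
    using degenerate_edge_colouring[of "E - M - Z" "UNIV :: bool set"] finE by auto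
  then show ?thesis by blast
qed

end

section \<open>Stresses when all matching edges outside the exceptional set \<open>N\<close> are
  vertical\<close>

locale vertical_matching = matched +
  fixes N :: "'a set set" and \<kappa> :: "'a set \<Rightarrow> dir"
  assumes N_sub: "N \<subseteq> M" and prp: "proper E \<kappa>"
    and vert: "\<And>e. e \<in> M - N \<Longrightarrow> \<kappa> e = Dv"
    and nonvert: "\<And>e. e \<in> (E - M) \<union> N \<Longrightarrow> \<kappa> e \<noteq> Dv"
begin

lemma equilibrium:
  assumes "stress V E \<kappa> u v w \<omega>" "x \<in> V" "x \<noteq> w" "Hn x = {y, y'}" "y \<noteq> y'"
  shows "\<omega> x y *\<^sub>R nrm (\<kappa> {x, y}) + \<omega> x y' *\<^sub>R nrm (\<kappa> {x, y'}) + \<omega> x (m x) *\<^sub>R nrm (\<kappa> {x, m x}) = 0"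
    and "distinct [\<kappa> {x, y}, \<kappa> {x, y'}, \<kappa> {x, m x}]"
    and "\<kappa> {x, y} \<noteq> Dv" "\<kappa> {x, y'} \<noteq> Dv"
proof -
  have nb: "nb E x = {m x, y, y'}" using nb_Hn assms by auto
  have "m x \<noteq> y" "m x \<noteq> y'" using assms by (auto simp: Hn_def)
  then show "\<omega> x y *\<^sub>R nrm (\<kappa> {x, y}) + \<omega> x y' *\<^sub>R nrm (\<kappa> {x, y'}) + \<omega> x (m x) *\<^sub>R nrm (\<kappa> {x, m x}) = 0"
  proof -
    have "(\<Sum>y\<in>nb E x. \<omega> x y *\<^sub>R nrm (\<kappa> {x, y})) = 0" using assms(1-3) by (simp add: stress_def)
    then show ?thesis unfolding nb using \<open>m x \<noteq> y\<close> \<open>m x \<noteq> y'\<close> assms(5) by (simp add: ac_simps)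
  qed
  have E: "{x, y} \<in> E - M" "{x, y'} \<in> E - M" "{x, m x} \<in> E"
    using Hn_iff[OF assms(2)] assms(4) m[OF assms(2)] by auto
  then show "distinct [\<kappa> {x, y}, \<kappa> {x, y'}, \<kappa> {x, m x}]"
    using properD[OF prp] \<open>m x \<noteq> y\<close> \<open>m x \<noteq> y'\<close> assms(5) by auto
  show "\<kappa> {x, y} \<noteq> Dv" "\<kappa> {x, y'} \<noteq> Dv" using nonvert E by auto
qed

text \<open>Cycle edges do not leave \<open>B\<close>, and vertical matching edges contribute
  nothing to the vertical balance. If the balance holds over \<open>B\<close>, the only exceptional
  edge leaving \<open>B\<close> therefore carries no stress at \<open>p\<close>, against
  \<open>no_dead_vertex\<close>. The same is applied to the complement of \<open>B\<close>.\<close>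

lemma separated:
  assumes \<omega>: "stress V E \<kappa> u v w \<omega>" and e: "{u, v} \<in> E" and w: "w \<in> V - {u, v}"
    and B: "closed B" and p: "p \<in> B" "m p \<notin> B" and N: "N \<inter> cut E B = {{p, m p}}"
  shows "(w \<notin> B \<and> u \<in> B \<and> v \<in> B \<or> w \<in> B \<and> u \<notin> B \<and> v \<notin> B) \<and> \<kappa> {u, v} \<noteq> Dv"
proof -
  have one: "w \<in> B \<or> u \<in> B \<and> v \<in> B \<and> \<kappa> {u, v} \<noteq> Dv"
    if B: "closed B" and p: "p \<in> B" "m p \<notin> B" and N: "N \<inter> cut E B = {{p, m p}}" for B p
  proof (rule ccontr)
    assume n: "\<not> ?thesis"
    have BV: "B \<subseteq> V" using B by (auto simp: closed_def)
    have finB: "finite B" using BV finV finite_subset by blast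
    have "(\<Sum>z\<in>B. \<Sum>y\<in>nb E z - B. \<omega> z y * snd (nrm (\<kappa> {z, y}))) = 0"
      by (rule stress_vertical_balance[OF G \<omega> BV]) (use n in auto)
    moreover have "(\<Sum>y\<in>nb E z - B. \<omega> z y * snd (nrm (\<kappa> {z, y}))) = (if z = p then \<omega> p (m p) else 0)"
      if z: "z \<in> B" for z
    proof -
      have sub: "nb E z - B \<subseteq> {m z}" using B z nb_Hn BV by (auto simp: closed_def)
      have zV: "z \<in> V" using z BV by blast
      show ?thesis
      proof (cases "z = p")
        case True
        have "nb E z - B = {m p}" using sub True p m zV by auto
        moreover have "{p, m p} \<in> N" using N by blast
        then have "\<kappa> {p, m p} \<noteq> Dv" using nonvert by blast
        \<comment> \<open>All three normals of non-vertical directions have second coordinate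
          1.\<close>
        then have "snd (nrm (\<kappa> {p, m p})) = 1" by (cases "\<kappa> {p, m p}") auto
        ultimately show ?thesis using True by simp
      next
        case False
        have "\<omega> z y * snd (nrm (\<kappa> {z, y})) = 0" if y: "y \<in> nb E z - B" for y
        proof -
          have ym: "y = m z" using sub y by blast
          then have cutz: "{z, m z} \<in> cut E B" using y z zV m by (auto simp: cut_def)
          have "{z, m z} \<noteq> {p, m p}" using False p z by (auto simp: doubleton_eq_iff)
          then have "{z, m z} \<notin> N" using N cutz by (metis IntI singletonD)
          then have "\<kappa> {z, m z} = Dv" using vert zV by (auto simp: M_def)
          then show ?thesis using ym by simp
        qed
        then show ?thesis using False by (simp add: sum.neutral)
      qed
    qed
    ultimately have "(\<Sum>z\<in>B. if z = p then \<omega> p (m p) else 0) = 0" by simp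
    then have "\<omega> p (m p) = 0" using finB p by simp
    moreover have "p \<noteq> w" "p \<in> V" using n p BV by auto
    ultimately show False using no_dead_vertex[OF prp \<omega> e w, of p "m p"] m by auto
  qed
  have BV: "B \<subseteq> V" using B by (auto simp: closed_def)
  have pV: "p \<in> V" "m p \<in> V" using p BV m by auto
  have cc: "cut E (V - B) = cut E B" using G BV by (auto simp: cut_def simple_graph_def)
  have "w \<in> V - B \<or> u \<in> V - B \<and> v \<in> V - B \<and> \<kappa> {u, v} \<noteq> Dv"
    by (rule one[of "V - B" "m p"])
      (use closed_Compl[OF B] p pV m N in \<open>auto simp: cc insert_commute\<close>)
  moreover have "w \<in> B \<or> u \<in> B \<and> v \<in> B \<and> \<kappa> {u, v} \<noteq> Dv" using one[OF B p N] .
  ultimately show ?thesis by auto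
qed

end

context vertical_matching
begin

text \<open>With this, magnitudes are carried unchanged along a cycle and compared across matching
  edges. The factor 1 occurs exactly at an end of a horizontal cycle edge, the factor 2
  elsewhere.\<close>

lemma magnitudes:
  assumes \<omega>: "stress V E \<kappa> u v w \<omega>" and x: "x \<in> V" "x \<noteq> w" and H: "Hn x = {y, y'}" "y \<noteq> y'"
    and k: "\<kappa> {x, m x} \<in> {Dv, Dh}"
  shows "\<bar>\<omega> x y\<bar> = \<bar>\<omega> x y'\<bar>"
    and "\<bar>\<omega> x (m x)\<bar> = (if \<exists>z\<in>Hn x. \<kappa> {x, z} = Dh then 1 else 2) * \<bar>\<omega> x y\<bar>"
proof -
  note eq = equilibrium[OF \<omega> x H]
  have D: "\<kappa> {x, y} \<noteq> \<kappa> {x, y'}" "\<kappa> {x, y} \<noteq> \<kappa> {x, m x}" "\<kappa> {x, y'} \<noteq> \<kappa> {x, m x}"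
    using eq(2) by auto
  note d = equilibrium_diagonals[OF eq(1) D eq(3,4)]
  have Z: "(\<exists>z\<in>Hn x. \<kappa> {x, z} = Dh) \<longleftrightarrow> Dh \<in> {\<kappa> {x, y}, \<kappa> {x, y'}}" using H by auto
  consider "\<kappa> {x, m x} = Dv" | "\<kappa> {x, m x} = Dh" using k by blast
  then have "\<bar>\<omega> x y\<bar> = \<bar>\<omega> x y'\<bar> \<and>
    \<bar>\<omega> x (m x)\<bar> = (if Dh \<in> {\<kappa> {x, y}, \<kappa> {x, y'}} then 1 else 2) * \<bar>\<omega> x y\<bar>"
  proof cases
    case 1
    then show ?thesis using d(1) by blast
  next
    case 2
    then have "Dh \<notin> {\<kappa> {x, y}, \<kappa> {x, y'}}" using D by auto
    then show ?thesis using d(2)[OF 2] by simp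
  qed
  then show "\<bar>\<omega> x y\<bar> = \<bar>\<omega> x y'\<bar>"
    "\<bar>\<omega> x (m x)\<bar> = (if \<exists>z\<in>Hn x. \<kappa> {x, z} = Dh then 1 else 2) * \<bar>\<omega> x y\<bar>"
    unfolding Z by blast+
qed

lemma card_one_iff:
  assumes "Hn x = {y, y'}" "y \<noteq> y'"
  shows "card {z \<in> Hn x. g x z = (r :: real)} = 1 \<longleftrightarrow> (g x y = r) \<noteq> (g x y' = r)"
proof -
  have "{z \<in> Hn x. g x z = r} = (if g x y = r then {y} else {}) \<union> (if g x y' = r then {y'} else {})"
    using assms by auto
  then show ?thesis using assms(2) by auto
qed

lemma Hn_pair:
  assumes "x \<in> V"
  obtains y y' where "Hn x = {y, y'}" "y \<noteq> y'"
  using card_Hn[OF assms] by (auto simp: card_2_iff)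

lemma antisym_abs:
  assumes "stress V E \<kappa> u v w \<omega>" "{x, y} \<in> E" "{x, y} \<noteq> {u, v}"
  shows "\<bar>\<omega> x y\<bar> = \<bar>\<omega> y x\<bar>"
proof -
  have "\<omega> x y = - \<omega> y x" using assms by (simp add: stress_def)
  then show ?thesis by simp
qed

text \<open>Each of \<open>C1\<close> and \<open>C2\<close> separates \<open>w\<close> from
  \<open>uv\<close>, so \<open>C0\<close> meets neither. Along \<open>C0\<close> the magnitude is
  thus carried unchanged, except at \<open>p2\<close>, where the diagonal matching edge makes it
  jump by the factor 2. One jump contradicts parity.\<close>

lemma three_cycles_generic:
  assumes C: "closed C0" "closed C1" "closed C2"
      "C0 \<inter> C1 = {}" "C0 \<inter> C2 = {}" "C1 \<inter> C2 = {}"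
    and p: "p1 \<in> C0" "m p1 \<in> C1" "p2 \<in> C0" "m p2 \<in> C2"
    and N: "N = {{p1, m p1}, {p2, m p2}}"
    and k: "\<kappa> {p1, m p1} = Dh" "\<kappa> {p2, m p2} \<noteq> Dh"
  shows "generic_colouring V E \<kappa>"
  unfolding generic_colouring_def
proof (intro allI impI notI)
  fix u v w \<omega> assume e: "{u, v} \<in> E" and w: "w \<in> V - {u, v}" and \<omega>: "stress V E \<kappa> u v w \<omega>"
  have pV: "p1 \<in> V" "p2 \<in> V" using p C by (auto simp: closed_def)
  have n1: "p1 \<notin> C1" "p2 \<notin> C1" "m p2 \<notin> C1" "p1 \<notin> C2" "p2 \<notin> C2" "m p1 \<notin> C2"
    using p C by auto
  have NE: "{p1, m p1} \<in> E" "{p2, m p2} \<in> E" using m pV by auto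
  have cut1: "N \<inter> cut E C1 = {{m p1, m (m p1)}}"
    using N NE p n1 m(3)[OF pV(1)] by (auto simp: cut_def insert_commute)
  have cut2: "N \<inter> cut E C2 = {{m p2, m (m p2)}}"
    using N NE p n1 m(3)[OF pV(2)] by (auto simp: cut_def insert_commute)
  have s1: "w \<notin> C1 \<and> u \<in> C1 \<and> v \<in> C1 \<or> w \<in> C1 \<and> u \<notin> C1 \<and> v \<notin> C1"
    using separated[OF \<omega> e w C(2) p(2) _ cut1] n1 m(3)[OF pV(1)] by simp
  have s2: "w \<notin> C2 \<and> u \<in> C2 \<and> v \<in> C2 \<or> w \<in> C2 \<and> u \<notin> C2 \<and> v \<notin> C2"
    using separated[OF \<omega> e w C(3) p(4) _ cut2] n1 m(3)[OF pV(2)] by simp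
  have out: "u \<notin> C0" "v \<notin> C0" "w \<notin> C0" using s1 s2 C(4-6) by auto
  have C0V: "C0 \<subseteq> V" using C by (auto simp: closed_def)
  have sym: "\<bar>\<omega> x y\<bar> = \<bar>\<omega> y x\<bar>" if x: "x \<in> C0" and y: "y \<in> Hn x" for x y
  proof (rule antisym_abs[OF \<omega>])
    show "{x, y} \<in> E" using x y C0V Hn_iff by auto
    show "{x, y} \<noteq> {u, v}" using x out by (auto simp: doubleton_eq_iff)
  qed
  obtain a b where ab: "Hn p2 = {a, b}" "a \<noteq> b" using Hn_pair[OF pV(2)] by metis
  have pw: "p2 \<noteq> w" using out p by auto
  have ne: "\<kappa> {p2, m p2} \<noteq> Dv" using nonvert N by auto
  \<comment> \<open>The matching edge at \<open>p2\<close> is diagonal, so the three non-vertical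
    directions all occur there and one cycle edge is horizontal.\<close>
  have "\<exists>y y'. Hn p2 = {y, y'} \<and> y \<noteq> y' \<and> \<kappa> {p2, y} = Dh"
  proof -
    have "Dh \<in> {\<kappa> {p2, a}, \<kappa> {p2, b}}"
      using equilibrium(2-4)[OF \<omega> pV(2) pw ab] k ne
      by (cases "\<kappa> {p2, a}"; cases "\<kappa> {p2, b}"; cases "\<kappa> {p2, m p2}") auto
    then show ?thesis
    proof
      assume "Dh = \<kappa> {p2, a}"
      then show ?thesis using ab by metis
    next
      assume "Dh \<in> {\<kappa> {p2, b}}"
      then show ?thesis using ab by (metis insert_commute singletonD)
    qed
  qed
  then obtain y y' where H: "Hn p2 = {y, y'}" "y \<noteq> y'" and yh: "\<kappa> {p2, y} = Dh" by blast
  note eq = equilibrium[OF \<omega> pV(2) pw H]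
  have D: "\<kappa> {p2, y} \<noteq> \<kappa> {p2, y'}" "\<kappa> {p2, y} \<noteq> \<kappa> {p2, m p2}" "\<kappa> {p2, y'} \<noteq> \<kappa> {p2, m p2}"
    using eq(2) by auto
  have half: "\<bar>\<omega> p2 y\<bar> = 2 * \<bar>\<omega> p2 y'\<bar>"
    by (rule equilibrium_diagonals(3)[OF eq(1) D eq(3,4) k(2) ne yh])
  have "y' \<in> nb E p2" using H by (auto simp: Hn_def)
  then have nz: "\<omega> p2 y' \<noteq> 0" using no_dead_vertex[OF prp \<omega> e w pV(2) pw] by blast
  define g where "g = (\<lambda>x y. \<bar>\<omega> x y\<bar>)"
  define r where "r = g p2 y"
  have "x = p2" if x: "x \<in> C0" "card {z \<in> Hn x. g x z = r} = 1" for x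
  proof (rule ccontr)
    assume xp: "x \<noteq> p2"
    have xV: "x \<in> V" "x \<noteq> w" using x C0V out by auto
    obtain z z' where z: "Hn x = {z, z'}" "z \<noteq> z'" using Hn_pair[OF xV(1)] by metis
    have "\<kappa> {x, m x} \<in> {Dv, Dh}"
    proof (cases "x = p1")
      case False
      have "x \<noteq> m p1" "x \<noteq> m p2" using x p C by auto
      then have "{x, m x} \<notin> N" using False xp N by (auto simp: doubleton_eq_iff)
      then show ?thesis using vert xV by (auto simp: M_def)
    qed (use k in simp)
    then have "g x z = g x z'" using magnitudes(1)[OF \<omega> xV z] by (simp add: g_def)
    then show False using x card_one_iff[OF z, of g r] by simp
  qed
  moreover have "card {z \<in> Hn p2. g p2 z = r} = 1"
    unfolding card_one_iff[OF H] using half nz by (auto simp: g_def r_def)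
  ultimately have "{x \<in> C0. card {z \<in> Hn x. g x z = r} = 1} = {p2}" using p by blast
  moreover have "even (card {x \<in> C0. card {z \<in> Hn x. g x z = r} = 1})"
    by (rule parity[OF C(1)]) (use sym in \<open>simp add: g_def\<close>)
  ultimately show False by simp
qed

text \<open>The magnitude is constant on each cycle, \<mu> on \<open>C1\<close> and \<nu> on
  \<open>C2\<close>. Comparing the two across matching edges, with factor 1 at the ends of the two
  horizontal cycle edges and 2 elsewhere, forces the matching to map one horizontal edge onto the
  other.\<close>

lemma two_cycles_no_stress:
  assumes C: "closed C1" "closed C2" "C1 \<inter> C2 = {}" "C1 \<union> C2 = V"
    and min: "\<And>S. closed S \<Longrightarrow> S \<noteq> {} \<Longrightarrow> S \<subseteq> C1 \<Longrightarrow> S = C1"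
      "\<And>S. closed S \<Longrightarrow> S \<noteq> {} \<Longrightarrow> S \<subseteq> C2 \<Longrightarrow> S = C2"
    and p: "p \<in> C1" "m p \<in> C2" and N: "N = {{p, m p}}" and k: "\<kappa> {p, m p} = Dh"
    and g: "{x1, x2} \<in> E - M" "{y1, y2} \<in> E - M" "x1 \<in> C1" "y1 \<in> C2"
    and h: "\<And>e. e \<in> E - M \<Longrightarrow> \<kappa> e = Dh \<longleftrightarrow> e = {x1, x2} \<or> e = {y1, y2}"
    and mg: "{m x1, m x2} \<noteq> {y1, y2}"
    and e: "{u, v} \<in> E" and w: "w \<in> C2" and uv: "u \<in> C1" "v \<in> C1" "\<kappa> {u, v} \<noteq> Dv"
  shows "\<not> stress V E \<kappa> u v w \<omega>"
proof
  assume \<omega>: "stress V E \<kappa> u v w \<omega>"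
  have sub: "C1 \<subseteq> V" "C2 \<subseteq> V" using C by auto
  have wV: "w \<in> V - {u, v}" using w uv C by auto
  have uV: "u \<in> V" "v \<in> V" using uv sub by auto
  have x2: "x2 \<in> C1" and y2: "y2 \<in> C2" using closed_edge C g by blast+
  have eM: "{u, v} \<notin> M"
  proof
    assume M: "{u, v} \<in> M"
    then have "{u, v} \<in> N" using vert uv(3) by blast
    then have "m p \<in> C1" using N uv by (auto simp: doubleton_eq_iff)
    then show False using p C by blast
  qed
  have vH: "v \<in> Hn u" "u \<in> Hn v" using Hn_iff[OF uV(1)] Hn_iff[OF uV(2)] e eM
    by (auto simp: insert_commute)
  have kMN: "\<kappa> {x, m x} \<in> {Dv, Dh}" if "x \<in> V" for x
    using that vert[of "{x, m x}"] N k by (cases "{x, m x} \<in> N") (auto simp: M_def)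
  note dead = no_dead_vertex[OF prp \<omega> e wV]
  have nw: "x \<noteq> w" if "x \<in> C1" for x using that w C by auto
  have uvE: "\<bar>\<omega> u v\<bar> = \<bar>\<omega> v u\<bar>"
  proof (rule ccontr)
    assume diff: "\<bar>\<omega> u v\<bar> \<noteq> \<bar>\<omega> v u\<bar>"
    \<comment> \<open>Antisymmetry may fail on \<open>uv\<close>, so its value is read at
      \<open>u\<close> from both ends; then only \<open>v\<close> could see two different
      magnitudes.\<close>
    define g where "g = (\<lambda>x y. if {x, y} = {u, v} then \<bar>\<omega> u v\<bar> else \<bar>\<omega> x y\<bar>)"
    define r where "r = \<bar>\<omega> u v\<bar>"
    have "card {z \<in> Hn x. g x z = r} = 1 \<longleftrightarrow> x = v" if x: "x \<in> C1" for x
    proof -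
      have xV: "x \<in> V" "x \<noteq> w" using x sub nw by auto
      consider "x = u" | "x = v" | "x \<noteq> u" "x \<noteq> v" by blast
      then show ?thesis
      proof cases
        case 1
        obtain y' where y': "Hn u = {v, y'}" "y' \<noteq> v" using Hn_two[OF uV(1) vH(1)] by metis
        have "\<bar>\<omega> u v\<bar> = \<bar>\<omega> u y'\<bar>"
          using magnitudes(1)[OF \<omega> uV(1) _ y'(1) _ kMN[OF uV(1)]] y' xV 1 by auto
        moreover have "u \<noteq> v" using simple_graph_edgeD[OF G e] by auto
        ultimately show ?thesis
          using card_one_iff[OF y'(1) y'(2)[symmetric], of g r] 1 y' by (auto simp: g_def r_def doubleton_eq_iff)
      next
        case 2
        obtain y' where y': "Hn v = {u, y'}" "y' \<noteq> u" using Hn_two[OF uV(2) vH(2)] by metis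
        have "\<bar>\<omega> v u\<bar> = \<bar>\<omega> v y'\<bar>"
          using magnitudes(1)[OF \<omega> uV(2) _ y'(1) _ kMN[OF uV(2)]] y' xV 2 by auto
        then show ?thesis
          using card_one_iff[OF y'(1) y'(2)[symmetric], of g r] 2 y' diff by (auto simp: g_def r_def doubleton_eq_iff)
      next
        case 3
        obtain z z' where z: "Hn x = {z, z'}" "z \<noteq> z'" using Hn_pair[OF xV(1)] by metis
        have "g x z = g x z'"
          using magnitudes(1)[OF \<omega> xV z kMN[OF xV(1)]] 3 by (auto simp: g_def doubleton_eq_iff)
        then show ?thesis using card_one_iff[OF z, of g r] 3 by simp
      qed
    qed
    then have "{x \<in> C1. card {z \<in> Hn x. g x z = r} = 1} = {v}" using uv by auto
    moreover have "even (card {x \<in> C1. card {z \<in> Hn x. g x z = r} = 1})"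
    proof (rule parity[OF C(1)])
      fix x y assume xy: "x \<in> C1" "y \<in> Hn x"
      then have E: "{x, y} \<in> E" using sub Hn_iff by auto
      show "g x y = g y x"
        using antisym_abs[OF \<omega> E] by (cases "{x, y} = {u, v}") (auto simp: g_def insert_commute)
    qed
    ultimately show False by simp
  qed
  define \<mu> where "\<mu> = \<bar>\<omega> u v\<bar>"
  have mu: "\<bar>\<omega> x y\<bar> = \<mu>" if "x \<in> C1" "y \<in> Hn x" for x y
  proof -
    \<comment> \<open>The set of vertices all of whose cycle edges have magnitude \<mu> is closed,
      so by minimality it is all of \<open>C1\<close>.\<close>
    define S where "S = {x \<in> C1. \<forall>y\<in>Hn x. \<bar>\<omega> x y\<bar> = \<mu>}"
    have both: "x \<in> S" if x: "x \<in> C1" "y \<in> Hn x" "\<bar>\<omega> x y\<bar> = \<mu>" for x y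
    proof -
      have xV: "x \<in> V" "x \<noteq> w" using x sub nw by auto
      obtain y' where y': "Hn x = {y, y'}" "y' \<noteq> y" using Hn_two[OF xV(1) x(2)] by metis
      then have "\<bar>\<omega> x y\<bar> = \<bar>\<omega> x y'\<bar>" using magnitudes(1)[OF \<omega> xV y'(1) _ kMN[OF xV(1)]] by auto
      then show ?thesis using x y' by (auto simp: S_def)
    qed
    have "closed S"
      unfolding closed_def
    proof (intro conjI ballI subsetI)
      show "x \<in> V" if "x \<in> S" for x using that sub by (auto simp: S_def)
      fix x y assume x: "x \<in> S" and y: "y \<in> Hn x"
      have xV: "x \<in> V" "x \<in> C1" using x sub by (auto simp: S_def)
      have E: "{x, y} \<in> E" using Hn_iff[OF xV(1)] y by auto
      have yC: "y \<in> C1" using C(1) xV y by (auto simp: closed_def)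
      have "\<bar>\<omega> x y\<bar> = \<mu>" using x y by (auto simp: S_def)
      moreover have "\<bar>\<omega> x y\<bar> = \<bar>\<omega> y x\<bar>"
        using antisym_abs[OF \<omega> E] uvE by (cases "{x, y} = {u, v}") (auto simp: doubleton_eq_iff)
      ultimately show "y \<in> S" using both[OF yC Hn_sym[OF xV(1) y]] by simp
    qed
    moreover have "u \<in> S" using both[OF uv(1) vH(1)] by (simp add: \<mu>_def)
    ultimately have "S = C1" by (intro min(1)) (auto simp: S_def)
    then show ?thesis using that by (auto simp: S_def)
  qed
  have mupos: "\<mu> > 0"
    using dead[OF uV(1), of v] wV e by (auto simp: \<mu>_def nb_def)
  have notuv: "{x, y} \<noteq> {u, v}" if "x \<in> C2" for x y using that uv C by (auto simp: doubleton_eq_iff)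
  \<comment> \<open>Equilibrium fails at \<open>w\<close>, so the cycle edges at \<open>w\<close>
    are measured from their other ends.\<close>
  define g' where "g' = (\<lambda>x y. if x = w then \<bar>\<omega> y w\<bar> else \<bar>\<omega> x y\<bar>)"
  have g'sym: "g' x y = g' y x" if "x \<in> C2" "y \<in> Hn x" for x y
  proof -
    have "x \<in> V" using that sub by auto
    then have E: "{x, y} \<in> E" using Hn_iff that by auto
    have "y \<in> C2" using C(2) that by (auto simp: closed_def)
    moreover have "x \<noteq> y" using simple_graph_edgeD[OF G E] by auto
    ultimately show ?thesis using antisym_abs[OF \<omega> E notuv[OF that(1)]] by (auto simp: g'_def)
  qed
  have g'const: "g' x z = g' x z'" if x: "x \<in> C2" "x \<noteq> w" and z: "Hn x = {z, z'}" "z \<noteq> z'" for x z z'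
  proof -
    have xV: "x \<in> V" using x sub by auto
    show ?thesis using magnitudes(1)[OF \<omega> xV x(2) z kMN[OF xV]] x by (simp add: g'_def)
  qed
  have wV': "w \<in> V" using w sub by auto
  obtain a a' where a: "Hn w = {a, a'}" "a \<noteq> a'" using Hn_pair[OF wV'] by metis
  have aa: "g' w a = g' w a'"
  proof (rule ccontr)
    assume diff: "g' w a \<noteq> g' w a'"
    define r where "r = g' w a"
    have "card {z \<in> Hn x. g' x z = r} = 1 \<longleftrightarrow> x = w" if x: "x \<in> C2" for x
    proof (cases "x = w")
      case True
      then show ?thesis using card_one_iff[OF a, of g' r] diff by (auto simp: r_def)
    next
      case False
      have xV: "x \<in> V" using x sub by auto
      obtain z z' where z: "Hn x = {z, z'}" "z \<noteq> z'" using Hn_pair[OF xV] by metis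
      then show ?thesis using card_one_iff[OF z, of g' r] g'const[OF x False z] False by simp
    qed
    then have "{x \<in> C2. card {z \<in> Hn x. g' x z = r} = 1} = {w}" using w by auto
    moreover have "even (card {x \<in> C2. card {z \<in> Hn x. g' x z = r} = 1})"
      by (rule parity[OF C(2) g'sym])
    ultimately show False by simp
  qed
  define \<nu> where "\<nu> = g' w a"
  have nu': "g' x y = \<nu>" if "x \<in> C2" "y \<in> Hn x" for x y
  proof -
    define S where "S = {x \<in> C2. \<forall>y\<in>Hn x. g' x y = \<nu>}"
    have wS: "w \<in> S" using a aa w by (auto simp: S_def \<nu>_def)
    have "closed S"
      unfolding closed_def
    proof (intro conjI ballI subsetI)
      show "x \<in> V" if "x \<in> S" for x using that sub by (auto simp: S_def)
      fix x y assume x: "x \<in> S" and y: "y \<in> Hn x"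
      have xV: "x \<in> V" "x \<in> C2" using x sub by (auto simp: S_def)
      have yC: "y \<in> C2" "y \<in> V" using C(2) xV y sub by (auto simp: closed_def)
      have gy: "g' y x = \<nu>" using x y g'sym[OF xV(2) y] by (auto simp: S_def)
      show "y \<in> S"
      proof (cases "y = w")
        case False
        obtain z where z: "Hn y = {x, z}" "z \<noteq> x" using Hn_two[OF yC(2) Hn_sym[OF xV(1) y]] by metis
        then show ?thesis using g'const[OF yC(1) False z(1)] gy yC by (auto simp: S_def)
      qed (use wS in simp)
    qed
    then have "S = C2" using wS by (intro min(2)) (auto simp: S_def)
    then show ?thesis using that by (auto simp: S_def)
  qed
  have nu: "\<bar>\<omega> x y\<bar> = \<nu>" if "x \<in> C2" "x \<noteq> w" "y \<in> Hn x" for x y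
    using nu'[OF that(1,3)] that(2) by (simp add: g'_def)
  have nupos: "\<nu> > 0"
  proof -
    have aC: "a \<in> C2" using C(2) w a by (auto simp: closed_def)
    have "a \<in> V" "a \<noteq> w" using nb_subset[OF G, of w] a by (auto simp: Hn_def)
    moreover have "w \<in> Hn a" using Hn_sym[OF wV'] a by auto
    ultimately show ?thesis using nu[OF aC, of w] dead[of a w] by (auto simp: Hn_def)
  qed
  \<comment> \<open>The ratio of matching edge to cycle edge at a vertex, as given by
    \<open>magnitudes\<close>.\<close>
  define c where "c = (\<lambda>x. if x \<in> {x1, x2, y1, y2} then 1 else 2 :: real)"
  have c: "(if \<exists>z\<in>Hn x. \<kappa> {x, z} = Dh then 1 else 2) = c x" if x: "x \<in> V" for x
  proof -
    have "(\<exists>z\<in>Hn x. \<kappa> {x, z} = Dh) \<longleftrightarrow> x \<in> {x1, x2, y1, y2}"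
    proof
      assume "\<exists>z\<in>Hn x. \<kappa> {x, z} = Dh"
      then obtain z where z: "z \<in> Hn x" "\<kappa> {x, z} = Dh" by blast
      then have "{x, z} = {x1, x2} \<or> {x, z} = {y1, y2}" using h Hn_iff[OF x] by blast
      then show "x \<in> {x1, x2, y1, y2}" by (auto simp: doubleton_eq_iff)
    next
      assume "x \<in> {x1, x2, y1, y2}"
      moreover have "{x2, x1} = {x1, x2}" "{y2, y1} = {y1, y2}" by auto
      ultimately obtain z where "{x, z} = {x1, x2} \<or> {x, z} = {y1, y2}" by blast
      then show "\<exists>z\<in>Hn x. \<kappa> {x, z} = Dh" using h g Hn_iff[OF x] by metis
    qed
    then show ?thesis by (simp add: c_def)
  qed
  have A: "\<bar>\<omega> x (m x)\<bar> = c x * \<mu>" if x: "x \<in> C1" for x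
  proof -
    have xV: "x \<in> V" "x \<noteq> w" using x sub nw by auto
    obtain z z' where z: "Hn x = {z, z'}" "z \<noteq> z'" using Hn_pair[OF xV(1)] by metis
    then show ?thesis using magnitudes(2)[OF \<omega> xV z kMN[OF xV(1)]] c[OF xV(1)] mu[OF x, of z] by simp
  qed
  have B: "\<bar>\<omega> x (m x)\<bar> = c x * \<nu>" if x: "x \<in> C2" "x \<noteq> w" for x
  proof -
    have xV: "x \<in> V" using x sub by auto
    obtain z z' where z: "Hn x = {z, z'}" "z \<noteq> z'" using Hn_pair[OF xV] by metis
    then show ?thesis using magnitudes(2)[OF \<omega> xV x(2) z kMN[OF xV]] c[OF xV] nu[OF x, of z] by simp
  qed
  have S: "\<bar>\<omega> x (m x)\<bar> = \<bar>\<omega> (m x) (m (m x))\<bar>" if x: "x \<in> V" for x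
  proof -
    have "{x, m x} \<in> M" using x by (auto simp: M_def)
    then have "{x, m x} \<noteq> {u, v}" using eM by metis
    then show ?thesis using antisym_abs[OF \<omega> m(4)[OF x]] m(3)[OF x] by simp
  qed
  have R1: "c x = c (m x)" if "x \<in> C1" "m x \<in> C1" for x
    using A[OF that(1)] A[OF that(2)] S[of x] that sub mupos by auto
  have R2: "c x * \<mu> = c (m x) * \<nu>" if "x \<in> C1" "m x \<in> C2" "m x \<noteq> w" for x
    using A[OF that(1)] B[OF that(2,3)] S[of x] that sub by auto
  have R3: "c x = c (m x)" if "x \<in> C2" "m x \<in> C2" "x \<noteq> w" "m x \<noteq> w" for x
    using B[OF that(1,3)] B[OF that(2,4)] S[of x] that sub nupos by auto
  have xV: "x1 \<in> V" "x2 \<in> V" "y1 \<in> V" "y2 \<in> V" "p \<in> V" using g x2 y2 p sub by auto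
  have xx: "x1 \<noteq> x2" "y1 \<noteq> y2" using simple_graph_edgeD[OF G, of x1 x2] simple_graph_edgeD[OF G, of y1 y2] g by auto
  have mx: "m x1 \<noteq> x2" "m y1 \<noteq> y2" "m x2 \<noteq> x1" "m y2 \<noteq> y1"
    using g M_iff[OF xV(1)] M_iff[OF xV(3)] m(3)[OF xV(2)] m(3)[OF xV(4)] by auto
  have pc: "c p = 2" "c (m p) = 2"
  proof -
    have Dh: "\<kappa> {x, z} \<noteq> Dh" if "x \<in> {p, m p}" "z \<in> Hn x" for x z
    proof -
      have x: "x \<in> V" "\<kappa> {x, m x} = Dh" using that k m[OF xV(5)] xV(5) by (auto simp: insert_commute)
      then show ?thesis using properD[OF prp, of x z "m x"] that(2) Hn_iff[OF x(1)] m(4)[OF x(1)]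
        by (auto simp: Hn_def)
    qed
    have "(if \<exists>z\<in>Hn x. \<kappa> {x, z} = Dh then 1 else 2) = (2::real)" if "x \<in> {p, m p}" for x
      using Dh[OF that] by auto
    then show "c p = 2" "c (m p) = 2" using c[OF xV(5)] c[OF m(1)[OF xV(5)]] by auto
  qed
  have inC: "x \<in> C1 \<or> x \<in> C2" if "x \<in> V" for x using that C by blast
  \<comment> \<open>An end of the horizontal edge of \<open>C1\<close> cannot be matched within
    \<open>C1\<close>, where all the other vertices have ratio 2.\<close>
  have X: "m x = w \<or> m x \<in> {y1, y2} \<and> \<mu> = \<nu> \<or> m x \<in> C2 \<and> \<mu> = 2 * \<nu>" if x: "x \<in> {x1, x2}" for x
  proof -
    have x': "x \<in> C1" "x \<in> V" "m x \<notin> {x1, x2}" "c x = 1" using x g x2 xV mx m xx by (auto simp: c_def)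
    have "m x \<in> C2"
    proof (rule ccontr)
      assume "m x \<notin> C2"
      then have m1: "m x \<in> C1" using inC m x' by blast
      then have "c (m x) = 2" using x' C g y2 by (auto simp: c_def)
      then show False using R1[OF x'(1) m1] x' by simp
    qed
    then show ?thesis using R2[OF x'(1)] x' by (cases "m x = w") (auto simp: c_def split: if_splits)
  qed
  have Y: "y = w \<or> m y = w \<or> m y \<in> {x1, x2} \<and> \<mu> = \<nu> \<or> m y \<in> C1 \<and> 2 * \<mu> = \<nu>" if y: "y \<in> {y1, y2}" for y
  proof (rule ccontr)
    assume n: "\<not> ?thesis"
    have y': "y \<in> C2" "y \<in> V" "m y \<notin> {y1, y2}" "c y = 1" using y g y2 xV mx m xx by (auto simp: c_def)
    show False
    proof (cases "m y \<in> C2")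
      case True
      then have "c (m y) = 2" using y' C g x2 by (auto simp: c_def)
      then show False using R3[OF y'(1) True] n y' by simp
    next
      case False
      then have m1: "m y \<in> C1" using inC m y' by blast
      then have "c (m y) * \<mu> = c y * \<nu>" using R2[OF m1] m(3)[OF y'(2)] y' n by auto
      then show False using n y' m1 by (auto simp: c_def split: if_splits)
    qed
  qed
  have minj: "m x = m y \<Longrightarrow> x \<in> V \<Longrightarrow> y \<in> V \<Longrightarrow> x = y" for x y using m(3) by metis
  show False
  \<comment> \<open>If \<open>m p\<close> is the exceptional vertex, the edge
    \<open>{p, m p}\<close> compares nothing, and the conditions at \<open>y1\<close> have to
    exclude that \<mu> is twice \<nu>.\<close>
  proof (cases "m p = w")
    case True
    have xw: "m x \<noteq> w" if "x \<in> {x1, x2}" for x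
    proof
      assume "m x = w"
      then have "x = p" using minj[of x p] True that xV by auto
      then show False using pc that by (auto simp: c_def)
    qed
    have yw: "y \<noteq> w \<and> m y \<noteq> w" if "y \<in> {y1, y2}" for y
    proof
      show "y \<noteq> w" using pc True that by (auto simp: c_def)
      show "m y \<noteq> w"
      proof
        assume "m y = w"
        then have "y = p" using minj[of y p] True that xV by auto
        then show False using that p C g y2 by auto
      qed
    qed
    have "\<mu> = \<nu> \<or> 2 * \<mu> = \<nu>" using Y[of y1] yw[of y1] by auto
    then have "\<mu> \<noteq> 2 * \<nu>" using nupos mupos by auto
    then have "m x1 \<in> {y1, y2}" "m x2 \<in> {y1, y2}" using X[of x1] X[of x2] xw by auto
    moreover have "m x1 \<noteq> m x2" using minj xV xx by blast
    ultimately show False using mg by auto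
  next
    case False
    \<comment> \<open>Both ends of the horizontal matching edge have ratio 2, since no cycle edge
      there can be horizontal as well.\<close>
    have eqn: "\<mu> = \<nu>" using R2[OF p False] pc by simp
    then have X': "m x = w \<or> m x \<in> {y1, y2}" if "x \<in> {x1, x2}" for x using X[OF that] nupos by auto
    have Y': "y = w \<or> m y = w \<or> m y \<in> {x1, x2}" if "y \<in> {y1, y2}" for y using Y[OF that] eqn nupos by auto
    have "\<not> (m x1 \<in> {y1, y2} \<and> m x2 \<in> {y1, y2})"
      using mg minj[of x1 x2] xV xx by auto
    then obtain x where x: "x \<in> {x1, x2}" "m x = w" "w \<notin> {y1, y2}" using X' by (metis insertI1 insertI2)
    have "m y \<in> {x1, x2}" if y: "y \<in> {y1, y2}" for y
    proof -
      have "m y \<noteq> w"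
      proof
        assume "m y = w"
        then have "y = x" using minj[of y x] x y xV by auto
        then show False using x y g x2 y2 C by auto
      qed
      then show ?thesis using Y'[OF y] x y by auto
    qed
    then have "m y1 \<in> {x1, x2}" "m y2 \<in> {x1, x2}" by auto
    moreover have "m y1 \<noteq> m y2" using minj xV xx by blast
    ultimately have "{m y1, m y2} = {x1, x2}" by auto
    then have "{m (m y1), m (m y2)} = {m x1, m x2}" by (auto simp: doubleton_eq_iff)
    then show False using mg m(3) xV by auto
  qed
qed

end

section \<open>Choice of the colouring according to the number of cycles\<close>

context matched
begin

text \<open>\<open>Z\<close> holds the horizontal cycle edges and \<open>c\<close> chooses between
  the diagonals. Only the exceptional matching edges can clash with the cycles, so a condition is
  imposed on \<open>n\<close> alone.\<close>

lemma colouring_vertical: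
  assumes Z: "Z \<subseteq> E - M" "\<And>e e'. e \<in> Z \<Longrightarrow> e' \<in> Z \<Longrightarrow> e \<noteq> e' \<Longrightarrow> e \<inter> e' = {}"
    and c: "\<And>e e'. e \<in> E - M - Z \<Longrightarrow> e' \<in> E - M - Z \<Longrightarrow> e \<noteq> e' \<Longrightarrow> e \<inter> e' \<noteq> {} \<Longrightarrow> c e \<noteq> c e'"
    and N: "N \<subseteq> M"
    and \<kappa>: "\<kappa> = (\<lambda>e. if e \<in> N then n e else if e \<in> M then Dv else if e \<in> Z then Dh else if c e then Dp else Dn)"
    and n: "\<And>x. x \<in> V \<Longrightarrow> {x, m x} \<in> N \<Longrightarrow> n {x, m x} \<noteq> Dv \<and> (\<forall>y\<in>Hn x. \<kappa> {x, y} \<noteq> n {x, m x})"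
  shows "vertical_matching V E m N \<kappa>"
proof unfold_locales
  show "N \<subseteq> M" by (rule N)
  show "\<kappa> e = Dv" if "e \<in> M - N" for e using that by (auto simp: \<kappa>)
  have H: "\<kappa> e = (if e \<in> Z then Dh else if c e then Dp else Dn)" if "e \<in> E - M" for e
    using that N by (auto simp: \<kappa>)
  have Nv: "\<kappa> e = n e \<and> n e \<noteq> Dv" if e: "e \<in> N" for e
  proof -
    obtain x where "x \<in> V" "e = {x, m x}" using e N by (auto simp: M_def)
    then show ?thesis using n e by (auto simp: \<kappa>)
  qed
  show "\<kappa> e \<noteq> Dv" if "e \<in> (E - M) \<union> N" for e
    using that H[of e] Nv[of e] by (auto split: if_splits)
  show "proper E \<kappa>"
  proof (rule properI)
    have cross: "\<kappa> e \<noteq> \<kappa> e'" if e: "e \<in> M" "e' \<in> E - M" "e \<inter> e' \<noteq> {}" for e e'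
    proof -
      obtain x where x: "x \<in> e" "x \<in> e'" using e by blast
      obtain y where y: "e' = {x, y}" "x \<in> V" using simple_graph_edgeE[OF G _ x(2)] e by (metis DiffD1)
      obtain z where z: "e = {x, z}" using simple_graph_edgeE[OF G _ x(1)] e M_sub by (metis subsetD)
      then have em: "e = {x, m x}" using M_iff[OF y(2)] e by auto
      have yH: "y \<in> Hn x" using Hn_iff[OF y(2)] y e by auto
      show ?thesis
      proof (cases "e \<in> N")
        case True
        then show ?thesis using n[OF y(2)] em yH y Nv[OF True] by metis
      next
        case False
        then show ?thesis using H[OF e(2)] e by (auto simp: \<kappa>)
      qed
    qed
    fix e e' assume e: "e \<in> E" "e' \<in> E" "e \<noteq> e'" "e \<inter> e' \<noteq> {}"
    consider "e \<in> M" "e' \<in> M" | "e \<in> M" "e' \<in> E - M" | "e \<in> E - M" "e' \<in> M" | "e \<in> E - M" "e' \<in> E - M"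
      using e by blast
    then show "\<kappa> e \<noteq> \<kappa> e'"
    proof cases
      case 1
      obtain x where x: "x \<in> e" "x \<in> e'" using e by blast
      obtain y where y: "e' = {x, y}" "x \<in> V" using simple_graph_edgeE[OF G _ x(2)] e by metis
      obtain z where z: "e = {x, z}" using simple_graph_edgeE[OF G _ x(1)] e by metis
      then show ?thesis using M_iff[OF y(2)] 1 y e by auto
    next
      case 2
      then show ?thesis using cross e by blast
    next
      case 3
      then show ?thesis using cross[of e' e] e by (metis Int_commute)
    next
      case 4
      then show ?thesis using H Z(2)[of e e'] c[of e e'] e by auto
    qed
  qed
qed

text \<open>\<open>z\<close> selects the edge of slope zero on each cycle. Cycles are disjoint, so
  the selected edges are disjoint too, and the one at a given vertex can only be that of its own
  cycle.\<close>

lemma zero_system: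
  assumes z: "\<forall>K\<in>comp ` V. z K \<in> E - M \<and> z K \<subseteq> K"
  defines "Z \<equiv> z ` comp ` V"
  shows "Z \<subseteq> E - M"
    and "e \<in> Z \<Longrightarrow> e' \<in> Z \<Longrightarrow> e \<noteq> e' \<Longrightarrow> e \<inter> e' = {}"
    and "closed S \<Longrightarrow> S \<noteq> {} \<Longrightarrow> \<exists>e\<in>Z. e \<subseteq> S \<and> e \<in> E - M"
    and "x \<in> V \<Longrightarrow> e \<in> Z \<Longrightarrow> x \<in> e \<Longrightarrow> e = z (comp x)"
proof -
  show "Z \<subseteq> E - M" using z by (auto simp: Z_def)
  show *: "e = z (comp x)" if xe: "x \<in> V" "e \<in> Z" "x \<in> e" for x e
  proof -
    obtain y where y: "y \<in> V" "e = z (comp y)" using xe by (auto simp: Z_def)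
    then have "x \<in> comp y" using z xe by blast
    then show ?thesis using comp_eq[OF y(1)] y by metis
  qed
  show "e \<inter> e' = {}" if e: "e \<in> Z" "e' \<in> Z" "e \<noteq> e'"
  proof (rule ccontr)
    assume "e \<inter> e' \<noteq> {}"
    then obtain x where x: "x \<in> e" "x \<in> e'" by blast
    have "e \<in> E" using e z by (auto simp: Z_def)
    then have "x \<in> V" using x G by (auto simp: simple_graph_def)
    then show False using * e x by metis
  qed
  show "\<exists>e\<in>Z. e \<subseteq> S \<and> e \<in> E - M" if S: "closed S" "S \<noteq> {}"
  proof -
    obtain x where x: "x \<in> S" "x \<in> V" using S by (auto simp: closed_def)
    then have "z (comp x) \<in> Z" "z (comp x) \<subseteq> comp x" "z (comp x) \<in> E - M" using z by (auto simp: Z_def)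
    then show ?thesis using comp_least[OF S(1) x(1)] by blast
  qed
qed

lemma edge_in_comp: "x \<in> V \<Longrightarrow> y \<in> Hn x \<Longrightarrow> {x, y} \<in> E - M \<and> {x, y} \<subseteq> comp x"
  using Hn_iff[of x y] closed_comp[of x] self_comp[of x] by (fastforce simp: closed_def)

lemma edge_ends: "e \<in> E \<Longrightarrow> \<exists>a b. e = {a, b}"
  using G by (meson card_2_iff simple_graph_def)

lemma edge_avoiding:
  assumes p: "p \<in> V"
  shows "\<exists>e\<in>E - M. e \<subseteq> comp p \<and> p \<notin> e"
proof -
  obtain y where y: "y \<in> Hn p" using card_Hn[OF p] by fastforce
  have yV: "y \<in> V" "p \<in> Hn y" "y \<in> comp p" "p \<noteq> y"
    using Hn_V[of p] Hn_sym[OF p y] edge_in_comp[OF p y] nb_subset[OF G, of p] y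
    by (auto simp: Hn_def)
  obtain y' where y': "Hn y = {p, y'}" "y' \<noteq> p" using Hn_two[OF yV(1,2)] by metis
  then have "{y, y'} \<in> E - M \<and> {y, y'} \<subseteq> comp y" by (intro edge_in_comp[OF yV(1)]) simp
  moreover have "comp y = comp p" using comp_eq[OF p yV(3)] .
  moreover have "p \<notin> {y, y'}" using y' yV by simp
  ultimately show ?thesis by metis
qed

text \<open>Two exceptional edges lead from one cycle to two others. One is horizontal; the other
  must be diagonal, because it has to cause the jump of magnitude on the common cycle.\<close>

lemma generic_if_three_cycles:
  assumes p: "p1 \<in> V" "p2 \<in> V" "comp p1 = comp p2"
    and d: "comp (m p1) \<noteq> comp p1" "comp (m p2) \<noteq> comp p1" "comp (m p1) \<noteq> comp (m p2)"
  shows "\<exists>\<kappa>. proper E \<kappa> \<and> generic_colouring V E \<kappa>"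
proof -
  have mV: "m p1 \<in> V" "m p2 \<in> V" using m p by auto
  have p12: "p1 \<noteq> p2" using d by auto
  obtain q where q: "q \<in> Hn p2" "q \<noteq> p1"
  proof -
    obtain a b where "Hn p2 = {a, b}" "a \<noteq> b" using card_Hn[OF p(2)] by (auto simp: card_2_iff)
    then show thesis using that[of a] that[of b] by (cases "a = p1") auto
  qed
  obtain q' where q': "Hn p2 = {q, q'}" "q' \<noteq> q" using Hn_two[OF p(2) q(1)] by metis
  obtain s where s: "s \<in> Hn (m p2)" using card_Hn[OF mV(2)] by fastforce
  obtain s' where s': "Hn (m p2) = {s, s'}" "s' \<noteq> s" using Hn_two[OF mV(2) s] by metis
  obtain e1 where e1: "e1 \<in> E - M" "e1 \<subseteq> comp (m p1)" "m p1 \<notin> e1" using edge_avoiding[OF mV(1)] by blast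
  have "\<exists>e. e \<in> E - M \<and> e \<subseteq> K" if "K \<in> comp ` V" for K using edge_avoiding that by blast
  then obtain z0 where z0: "\<And>K. K \<in> comp ` V \<Longrightarrow> z0 K \<in> E - M \<and> z0 K \<subseteq> K" by metis
  \<comment> \<open>The horizontal cycle edges meet both ends of \<open>{p2, m p2}\<close>, which
    makes room for a diagonal there, and avoid both ends of the horizontal
    \<open>{p1, m p1}\<close>.\<close>
  define z where "z = z0(comp p2 := {p2, q}, comp (m p1) := e1, comp (m p2) := {m p2, s})"
  have z: "\<forall>K\<in>comp ` V. z K \<in> E - M \<and> z K \<subseteq> K"
    using z0 e1 edge_in_comp[OF p(2) q(1)] edge_in_comp[OF mV(2) s] by (simp add: z_def)
  define Z where "Z = z ` comp ` V"
  note ZS = zero_system[of z, OF z, folded Z_def]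
  have zc: "z (comp p2) = {p2, q}" "z (comp (m p1)) = e1" "z (comp (m p2)) = {m p2, s}"
    using d p by (auto simp: z_def)
  obtain c0 :: "'a set \<Rightarrow> bool" where
    c0: "\<And>e e'. e \<in> E - M - Z \<Longrightarrow> e' \<in> E - M - Z \<Longrightarrow> e \<noteq> e' \<Longrightarrow> e \<inter> e' \<noteq> {} \<Longrightarrow> c0 e \<noteq> c0 e'"
    using zero_edge_colouring[of Z] ZS(3) by metis
  \<comment> \<open>The colourings of different cycles are independent, so the diagonals may be
    interchanged on the cycle of \<open>m p2\<close>. Then \<open>{p2, m p2}\<close> sees the same
    diagonal at both ends and takes the other one.\<close>
  define fl where "fl = (c0 {p2, q'} \<noteq> c0 {m p2, s'})"
  define c where "c = (\<lambda>e. if fl \<and> e \<subseteq> comp (m p2) then \<not> c0 e else c0 e)"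
  have c: "c e \<noteq> c e'" if e: "e \<in> E - M - Z" "e' \<in> E - M - Z" "e \<noteq> e'" "e \<inter> e' \<noteq> {}" for e e'
  proof -
    have sub: "f' \<subseteq> comp (m p2)" if f: "f \<in> E - M" "f' \<in> E - M" "f \<inter> f' \<noteq> {}" "f \<subseteq> comp (m p2)" for f f'
    proof -
      obtain x where x: "x \<in> f" "x \<in> f'" using f by blast
      obtain y where y: "f' = {x, y}" using simple_graph_edgeE[OF G _ x(2)] f by (metis DiffD1)
      then show ?thesis using closed_edge[OF closed_comp[OF mV(2)], of x y] f x by auto
    qed
    have "e \<subseteq> comp (m p2) \<longleftrightarrow> e' \<subseteq> comp (m p2)" using sub[of e e'] sub[of e' e] e by blast
    then show ?thesis using c0[OF e] by (auto simp: c_def)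
  qed
  have notsub: "\<not> {p2, q'} \<subseteq> comp (m p2)"
    using comp_disjoint[OF p(2) mV(2)] d p self_comp[of p2] by auto
  have sub: "{m p2, s'} \<subseteq> comp (m p2)" using edge_in_comp[OF mV(2), of s'] s' by auto
  have cc: "c {p2, q'} = c {m p2, s'}" using notsub sub by (auto simp: c_def fl_def)
  define N where "N = {{p1, m p1}, {p2, m p2}}"
  define n where "n = (\<lambda>e. if e = {p1, m p1} then Dh else if c {p2, q'} then Dn else Dp)"
  define \<kappa> where "\<kappa> = (\<lambda>e. if e \<in> N then n e else if e \<in> M then Dv else if e \<in> Z then Dh else if c e then Dp else Dn)"
  have NM: "N \<subseteq> M" using p by (auto simp: N_def M_def)
  have ne: "{p2, m p2} \<noteq> {p1, m p1}" using p12 d p by (auto simp: doubleton_eq_iff)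
  have H: "\<kappa> {x, y} = (if {x, y} \<in> Z then Dh else if c {x, y} then Dp else Dn)" if "x \<in> V" "y \<in> Hn x" for x y
    using that Hn_iff[OF that(1)] NM by (auto simp: \<kappa>_def)
  have "vertical_matching V E m N \<kappa>"
  proof (rule colouring_vertical[OF ZS(1,2) c NM \<kappa>_def])
    fix x assume x: "x \<in> V" "{x, m x} \<in> N"
    then consider "x = p1" | "x = m p1" | "x = p2" | "x = m p2" by (auto simp: N_def doubleton_eq_iff)
    then show "n {x, m x} \<noteq> Dv \<and> (\<forall>y\<in>Hn x. \<kappa> {x, y} \<noteq> n {x, m x})"
    proof cases
      case 1
      have "{p1, y} \<notin> Z" for y using ZS(4)[OF p(1), of "{p1, y}"] zc p p12 q by auto
      then show ?thesis using 1 H[OF p(1)] by (auto simp: n_def)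
    next
      case 2
      have "{m p1, y} \<notin> Z" for y using ZS(4)[OF mV(1), of "{m p1, y}"] zc e1 by auto
      moreover have "{m p1, m (m p1)} = {p1, m p1}" using m p by auto
      ultimately show ?thesis using 2 H[OF mV(1)] by (auto simp: n_def)
    next
      case 3
      have "{p2, q} \<in> Z" using zc p unfolding Z_def by (metis imageI)
      moreover have "{p2, q'} \<notin> Z" using ZS(4)[OF p(2), of "{p2, q'}"] zc q' by (auto simp: doubleton_eq_iff)
      ultimately show ?thesis using 3 H[OF p(2)] q' ne by (auto simp: n_def)
    next
      case 4
      have "{m p2, s} \<in> Z" using zc mV unfolding Z_def by (metis imageI)
      moreover have "{m p2, s'} \<notin> Z" using ZS(4)[OF mV(2), of "{m p2, s'}"] zc s' by (auto simp: doubleton_eq_iff)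
      moreover have "{m p2, m (m p2)} = {p2, m p2}" using m p by auto
      ultimately show ?thesis using 4 H[OF mV(2)] s' ne cc by (auto simp: n_def)
    qed
  qed
  then interpret vertical_matching V E m N \<kappa> .
  have "generic_colouring V E \<kappa>"
  proof (rule three_cycles_generic[of "comp p1" "comp (m p1)" "comp (m p2)" p1 p2])
    show "closed (comp p1)" "closed (comp (m p1))" "closed (comp (m p2))" using closed_comp p mV by auto
    show "comp p1 \<inter> comp (m p1) = {}" "comp p1 \<inter> comp (m p2) = {}" "comp (m p1) \<inter> comp (m p2) = {}"
      using comp_disjoint p mV d by metis+
    show "p1 \<in> comp p1" "m p1 \<in> comp (m p1)" "p2 \<in> comp p1" "m p2 \<in> comp (m p2)"
      using self_comp p by auto
    show "N = {{p1, m p1}, {p2, m p2}}" by (simp add: N_def)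
    show "\<kappa> {p1, m p1} = Dh" "\<kappa> {p2, m p2} \<noteq> Dh" using ne by (auto simp: \<kappa>_def N_def n_def)
  qed
  then show ?thesis using prp by blast
qed

text \<open>Each of \<open>uv\<close> and \<open>w\<close> may lie on either cycle, so
  \<open>two_cycles_no_stress\<close> is applied twice with the roles exchanged. The lower bound on
  one cycle leaves enough choice to keep the two horizontal edges from corresponding under
  \<open>m\<close>.\<close>

lemma generic_if_two_cycles:
  assumes p: "p \<in> V" "comp (m p) \<noteq> comp p" "comp p \<union> comp (m p) = V"
    and big: "card (comp (m p)) \<ge> 4"
  shows "\<exists>\<kappa>. proper E \<kappa> \<and> generic_colouring V E \<kappa>"
proof -
  have mV: "m p \<in> V" using m p by auto
  let ?C1 = "comp p" and ?C2 = "comp (m p)"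
  have C: "closed ?C1" "closed ?C2" "?C1 \<inter> ?C2 = {}"
    using closed_comp comp_disjoint p mV by auto
  obtain g1 where g1: "g1 \<in> E - M" "g1 \<subseteq> ?C1" "p \<notin> g1" using edge_avoiding[OF p(1)] by blast
  \<comment> \<open>From each neighbour of \<open>m p\<close> the cycle continues along an edge that
    avoids \<open>m p\<close>. On a cycle of at least four vertices these two edges differ, so one
    of them is not the image of \<open>g1\<close>.\<close>
  have "\<exists>g2\<in>E - M. g2 \<subseteq> ?C2 \<and> m p \<notin> g2 \<and> g2 \<noteq> m ` g1"
  proof -
    obtain a a' where a: "Hn (m p) = {a, a'}" "a \<noteq> a'" using card_Hn[OF mV] by (auto simp: card_2_iff)
    have finC: "finite ?C2" using C(2) finV by (auto simp: closed_def intro: finite_subset)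
    have ainH: "a \<in> Hn (m p)" "a' \<in> Hn (m p)" using a by auto
    have aV: "a \<in> V" "a' \<in> V" using Hn_V[of "m p"] a by auto
    obtain b where b: "Hn a = {m p, b}" "b \<noteq> m p" using Hn_two[OF aV(1) Hn_sym[OF mV ainH(1)]] by metis
    obtain b' where b': "Hn a' = {m p, b'}" "b' \<noteq> m p" using Hn_two[OF aV(2) Hn_sym[OF mV ainH(2)]] by metis
    have aC: "a \<in> ?C2" "a' \<in> ?C2" using edge_in_comp[OF mV] ainH by auto
    have na: "a \<noteq> m p" "a' \<noteq> m p" using nb_subset[OF G, of "m p"] ainH by (auto simp: Hn_def)
    have ca: "comp a = ?C2" "comp a' = ?C2" using comp_eq[OF mV] aC by metis+
    have "{a, b} \<in> E - M \<and> {a, b} \<subseteq> comp a" "{a', b'} \<in> E - M \<and> {a', b'} \<subseteq> comp a'"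
      by (intro edge_in_comp aV; simp add: b b')+
    then have e: "{a, b} \<in> E - M" "{a, b} \<subseteq> ?C2" "m p \<notin> {a, b}"
      "{a', b'} \<in> E - M" "{a', b'} \<subseteq> ?C2" "m p \<notin> {a', b'}"
      unfolding ca using na b(2) b'(2) by simp_all
    have "{a, b} \<noteq> {a', b'}"
    proof
      assume "{a, b} = {a', b'}"
      then have ba: "b = a'" "b' = a" using a by (auto simp: doubleton_eq_iff)
      have "closed {m p, a, a'}" unfolding closed_def using a b b' ba mV aV by auto
      then have "?C2 \<subseteq> {m p, a, a'}" using comp_least by blast
      then have "card ?C2 \<le> card {m p, a, a'}" by (intro card_mono) auto
      also have "\<dots> \<le> 3" by (simp add: card_insert_if)
      finally show False using big by simp
    qed
    then show ?thesis using e by metis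
  qed
  then obtain g2 where g2: "g2 \<in> E - M" "g2 \<subseteq> ?C2" "m p \<notin> g2" "g2 \<noteq> m ` g1" by blast
  obtain x1 x2 where x: "g1 = {x1, x2}" using g1(1) edge_ends[of g1] by blast
  obtain y1 y2 where y: "g2 = {y1, y2}" using g2(1) edge_ends[of g2] by blast
  have comps: "comp q = ?C1 \<or> comp q = ?C2" if "q \<in> V" for q
    using comp_eq[OF p(1), of q] comp_eq[OF mV, of q] p(3) that by auto
  define z where "z = (\<lambda>K. if K = ?C1 then g1 else g2)"
  have z: "\<forall>K\<in>comp ` V. z K \<in> E - M \<and> z K \<subseteq> K"
    using comps g1 g2 by (simp add: z_def) metis
  define Z where "Z = z ` comp ` V"
  note ZS = zero_system[of z, OF z, folded Z_def]
  have zc: "z ?C1 = g1" "z ?C2 = g2" using p(2) by (simp_all add: z_def)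
  have "comp ` V = {?C1, ?C2}" using comps p(1) mV by blast
  then have Zeq: "Z = {g1, g2}" using zc by (simp add: Z_def)
  obtain c :: "'a set \<Rightarrow> bool" where
    c: "\<And>e e'. e \<in> E - M - Z \<Longrightarrow> e' \<in> E - M - Z \<Longrightarrow> e \<noteq> e' \<Longrightarrow> e \<inter> e' \<noteq> {} \<Longrightarrow> c e \<noteq> c e'"
    using zero_edge_colouring[of Z] ZS(3) by metis
  define N where "N = {{p, m p}}"
  define \<kappa> where "\<kappa> = (\<lambda>e. if e \<in> N then Dh else if e \<in> M then Dv else if e \<in> Z then Dh else if c e then Dp else Dn)"
  have NM: "N \<subseteq> M" using p by (auto simp: N_def M_def)
  have H: "\<kappa> e = (if e \<in> Z then Dh else if c e then Dp else Dn)" if "e \<in> E - M" for e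
    using that NM by (auto simp: \<kappa>_def)
  have "vertical_matching V E m N \<kappa>"
  proof (rule colouring_vertical[OF ZS(1,2) c NM, where \<kappa> = \<kappa> and n = "\<lambda>_. Dh"])
    show "\<kappa> = (\<lambda>e. if e \<in> N then Dh else if e \<in> M then Dv else if e \<in> Z then Dh else if c e then Dp else Dn)"
      by (rule \<kappa>_def)
    fix x assume x: "x \<in> V" "{x, m x} \<in> N"
    then have "x = p \<or> x = m p" by (auto simp: N_def doubleton_eq_iff)
    then have "{x, y} \<notin> Z" for y using ZS(4)[OF x(1), of "{x, y}"] zc g1 g2 by auto
    then show "Dh \<noteq> Dv \<and> (\<forall>y\<in>Hn x. \<kappa> {x, y} \<noteq> Dh)"
      using H Hn_iff[OF x(1)] by auto
  qed auto
  then interpret vertical_matching V E m N \<kappa> .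
  have kN: "\<kappa> {p, m p} = Dh" by (simp add: \<kappa>_def N_def)
  have kZ: "\<kappa> e = Dh \<longleftrightarrow> e = {x1, x2} \<or> e = {y1, y2}" if "e \<in> E - M" for e
    using H[OF that] Zeq x y by auto
  have min: "S = ?C1" if "closed S" "S \<noteq> {}" "S \<subseteq> ?C1" for S using closed_minimal[OF p(1)] that by blast
  have min2: "S = ?C2" if "closed S" "S \<noteq> {}" "S \<subseteq> ?C2" for S using closed_minimal[OF mV] that by blast
  have mg: "{m x1, m x2} \<noteq> {y1, y2}" using g2(4) x y by simp
  have xyV: "x1 \<in> V" "x2 \<in> V" "y1 \<in> V" "y2 \<in> V"
    using simple_graph_edgeD[OF G, of x1 x2] simple_graph_edgeD[OF G, of y1 y2] x y g1 g2 by auto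
  have mg': "{m y1, m y2} \<noteq> {x1, x2}"
  proof
    assume "{m y1, m y2} = {x1, x2}"
    then have "m ` {m y1, m y2} = {m x1, m x2}" by auto
    then show False using mg m(3) xyV by auto
  qed
  have C12: "?C1 \<union> ?C2 = V" "?C2 \<union> ?C1 = V" "?C2 \<inter> ?C1 = {}" using p C by auto
  have mp: "m (m p) = p" using m p by auto
  have "generic_colouring V E \<kappa>"
    unfolding generic_colouring_def
  proof (intro allI impI)
    fix u v w \<omega> assume e: "{u, v} \<in> E" and w: "w \<in> V - {u, v}"
    show "\<not> stress V E \<kappa> u v w \<omega>"
    proof
      assume \<omega>: "stress V E \<kappa> u v w \<omega>"
      have cutN: "N \<inter> cut E ?C1 = {{p, m p}}"
        using m[OF p(1)] self_comp[of p] self_comp[of "m p"] C by (auto simp: N_def cut_def)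
      have sep: "(w \<notin> ?C1 \<and> u \<in> ?C1 \<and> v \<in> ?C1 \<or> w \<in> ?C1 \<and> u \<notin> ?C1 \<and> v \<notin> ?C1) \<and> \<kappa> {u, v} \<noteq> Dv"
        by (rule separated[OF \<omega> e w C(1) self_comp _ cutN]) (use C self_comp[of "m p"] in auto)
      have uvV: "u \<in> V" "v \<in> V" using simple_graph_edgeD[OF G e] by auto
      from sep consider "w \<in> ?C2" "u \<in> ?C1" "v \<in> ?C1" "\<kappa> {u, v} \<noteq> Dv"
        | "w \<in> ?C1" "u \<in> ?C2" "v \<in> ?C2" "\<kappa> {u, v} \<noteq> Dv"
        using C12 w uvV by blast
      then show False
      proof cases
        case 1
        show False
          using two_cycles_no_stress[OF C C12(1) min min2 self_comp self_comp N_def kN _ _ _ _ kZ mg e 1]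
            g1 g2 x y \<omega> by auto
      next
        case 2
        have N': "N = {{m p, m (m p)}}" "\<kappa> {m p, m (m p)} = Dh" using mp N_def kN by (auto simp: insert_commute)
        have kZ': "\<kappa> e = Dh \<longleftrightarrow> e = {y1, y2} \<or> e = {x1, x2}" if "e \<in> E - M" for e using kZ[OF that] by blast
        show False
          using two_cycles_no_stress[OF C(2,1) C12(3,2) min2 min self_comp _ N' _ _ _ _ kZ' mg' e 2]
            g1 g2 x y \<omega> self_comp[of p] mp by auto
      qed
    qed
  qed
  then show ?thesis using prp by blast
qed

end

context matched
begin

text \<open>The cycle is Hamiltonian and its length is even, so it can be coloured alternately and
  the matching supplies a third colour. The edge \<open>{a, b}\<close> is left out at first, and
  parity shows that its two neighbours agree.\<close>

lemma generic_if_one_cycle: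
  assumes a: "a \<in> V" "comp a = V"
  shows "\<exists>\<kappa>. proper E \<kappa> \<and> generic_colouring V E \<kappa>"
proof -
  obtain b where b: "b \<in> Hn a" using card_Hn[OF a(1)] by fastforce
  have bV: "b \<in> V" "a \<in> Hn b" "a \<noteq> b"
    using Hn_V[of a] Hn_sym[OF a(1) b] b nb_subset[OF G, of a] by (auto simp: Hn_def)
  obtain a' where a': "Hn a = {b, a'}" "a' \<noteq> b" using Hn_two[OF a(1) b] by metis
  obtain b' where b': "Hn b = {a, b'}" "b' \<noteq> a" using Hn_two[OF bV(1,2)] by metis
  have gE: "{a, b} \<in> E - M" using Hn_iff[OF a(1)] b by blast
  have "\<exists>z\<in>{{a, b}}. z \<subseteq> S \<and> z \<in> E - M" if "closed S" "S \<noteq> {}" for S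
  proof -
    have "S \<subseteq> comp a" using that(1) a by (auto simp: closed_def)
    then have "S = V" using closed_minimal[OF a(1) that(1) _ that(2)] a by simp
    then show ?thesis using a bV gE by auto
  qed
  then obtain c :: "'a set \<Rightarrow> bool" where
    c: "\<And>e e'. e \<in> E - M - {{a, b}} \<Longrightarrow> e' \<in> E - M - {{a, b}} \<Longrightarrow> e \<noteq> e' \<Longrightarrow> e \<inter> e' \<noteq> {} \<Longrightarrow> c e \<noteq> c e'"
    using zero_edge_colouring[of "{{a, b}}"] by metis
  \<comment> \<open>The value 5 is arbitrary; it only has to keep \<open>{a, b}\<close> out of the
    edges of value 1.\<close>
  define g where "g = (\<lambda>x y. if {x, y} = {a, b} then 5 else if c {x, y} then 1 else 0 :: real)"
  have other: "card {y \<in> Hn x. g x y = 1} = 1" if x: "x \<in> V - {a, b}" for x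
  proof -
    obtain z z' where z: "Hn x = {z, z'}" "z \<noteq> z'" using card_Hn[of x] x by (auto simp: card_2_iff)
    have E: "{x, z} \<in> E - M - {{a, b}}" "{x, z'} \<in> E - M - {{a, b}}"
      using Hn_iff[of x] z x by (auto simp: doubleton_eq_iff)
    have "{x, z} \<noteq> {x, z'}" using z by (auto simp: doubleton_eq_iff)
    then have "c {x, z} \<noteq> c {x, z'}" using c[OF E] by blast
    moreover have "g x z = (if c {x, z} then 1 else 0)" "g x z' = (if c {x, z'} then 1 else 0)"
      using E by (simp_all add: g_def)
    ultimately have "{y \<in> Hn x. g x y = 1} = (if c {x, z} then {z} else {z'})"
      unfolding z(1) using z(2) by auto
    then show ?thesis by simp
  qed
  have ab: "{a, a'} \<noteq> {a, b}" "{b, b'} \<noteq> {a, b}" using a' b' by (auto simp: doubleton_eq_iff)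
  have ga: "card {y \<in> Hn a. g a y = 1} = 1 \<longleftrightarrow> c {a, a'}"
  proof -
    have "{y \<in> Hn a. g a y = 1} = (if c {a, a'} then {a'} else {})" using a' ab by (auto simp: g_def)
    then show ?thesis by simp
  qed
  have gb: "card {y \<in> Hn b. g b y = 1} = 1 \<longleftrightarrow> c {b, b'}"
  proof -
    have "{b, a} = {a, b}" by auto
    then have "{y \<in> Hn b. g b y = 1} = (if c {b, b'} then {b'} else {})" using b' ab by (auto simp: g_def)
    then show ?thesis by simp
  qed
  have "{x \<in> V. card {y \<in> Hn x. g x y = 1} = 1}
      = (V - {a, b}) \<union> ((if c {a, a'} then {a} else {}) \<union> (if c {b, b'} then {b} else {}))"
    using other ga gb a bV by auto
  moreover have "even (card {x \<in> V. card {y \<in> Hn x. g x y = 1} = 1})"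
    by (rule parity[OF closed_V]) (simp add: g_def insert_commute)
  moreover have "card ((V - {a, b}) \<union> ((if c {a, a'} then {a} else {}) \<union> (if c {b, b'} then {b} else {})))
      = card (V - {a, b}) + card ((if c {a, a'} then {a} else {}) \<union> (if c {b, b'} then {b} else {}))"
    by (rule card_Un_disjoint) (use finV in auto)
  moreover have "even (card (V - {a, b}))" using even_V a bV finV by (simp add: card_Diff_subset)
  \<comment> \<open>All vertices except \<open>a\<close> and \<open>b\<close> are counted and their
    number is even, so \<open>a\<close> and \<open>b\<close> are counted both or not at all.\<close>
  ultimately have cab: "c {a, a'} = c {b, b'}" using bV(3) by (auto split: if_splits)
  define c3 where "c3 = (\<lambda>e. if e \<in> M then 0 else if e = {a, b} then (if c {a, a'} then 2 else 1)
      else if c e then 1 else 2 :: nat)"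
  have MM: "e = e'" if e: "e \<in> M" "e' \<in> M" "e \<inter> e' \<noteq> {}" for e e'
  proof -
    have "f = {z, m z}" if f: "f \<in> M" "z \<in> f" for f z
    proof -
      obtain x where "x \<in> V" "f = {x, m x}" using f by (auto simp: M_def)
      then show ?thesis using f m(3)[of x] by auto
    qed
    then show ?thesis using e by blast
  qed
  have gadj: "c3 e \<noteq> c3 {a, b}" if e: "e \<in> E - M" "e \<noteq> {a, b}" "e \<inter> {a, b} \<noteq> {}" for e
  proof -
    consider "a \<in> e" | "b \<in> e" using e by blast
    then have "e = {a, a'} \<or> e = {b, b'}"
    proof cases
      case 1
      then obtain y where y: "e = {a, y}" using simple_graph_edgeE[OF G] e by (metis DiffD1)
      then have "y \<in> Hn a" using Hn_iff[OF a(1)] e by blast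
      then show ?thesis using a' y e by auto
    next
      case 2
      then obtain y where y: "e = {b, y}" using simple_graph_edgeE[OF G] e by (metis DiffD1)
      then have "y \<in> Hn b" using Hn_iff[OF bV(1)] e by blast
      then show ?thesis using b' y e by (auto simp: insert_commute)
    qed
    then show ?thesis using cab e gE by (auto simp: c3_def)
  qed
  have "proper E c3"
  proof (rule properI)
    fix e e' assume e: "e \<in> E" "e' \<in> E" "e \<noteq> e'" "e \<inter> e' \<noteq> {}"
    consider "e \<in> M \<or> e' \<in> M" | "e \<notin> M" "e' \<notin> M" "e = {a, b}" | "e \<notin> M" "e' \<notin> M" "e' = {a, b}"
      | "e \<notin> M" "e' \<notin> M" "e \<noteq> {a, b}" "e' \<noteq> {a, b}" by blast
    then show "c3 e \<noteq> c3 e'"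
    proof cases
      case 1
      have "c3 f = 0 \<longleftrightarrow> f \<in> M" for f by (simp add: c3_def)
      moreover have "\<not> (e \<in> M \<and> e' \<in> M)" using MM[of e e'] e by blast
      ultimately show ?thesis using 1 by metis
    next
      case 2
      then show ?thesis using gadj[of e'] e by (metis DiffI Int_commute)
    next
      case 3
      then show ?thesis using gadj[of e] e by (metis DiffI)
    next
      case 4
      then show ?thesis using c[of e e'] e by (auto simp: c3_def)
    qed
  qed
  moreover have "c3 e \<in> {0, 1, 2}" for e by (simp add: c3_def)
  ultimately show ?thesis using tait_colouring_generic by blast
qed

text \<open>In a triangle only one edge avoids a given vertex, so the choice made for two longer
  cycles is impossible. The cut condition sends all matching edges across; the graph is the
  triangular prism, and each triangle edge gets the colour of the matching edge at the opposite
  vertex.\<close>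

lemma generic_if_prism:
  assumes p: "p \<in> V" "comp (m p) \<noteq> comp p" "comp p \<union> comp (m p) = V"
    and small: "card (comp p) = 3" "card (comp (m p)) = 3"
  shows "\<exists>\<kappa>. proper E \<kappa> \<and> generic_colouring V E \<kappa>"
proof -
  have mV: "m p \<in> V" using m p by auto
  have C: "closed (comp p)" "closed (comp (m p))" "comp p \<inter> comp (m p) = {}"
    using closed_comp comp_disjoint p mV by auto
  have tri: "Hn x = S - {x}" if S: "closed S" "card S = 3" "x \<in> S" for S x
  proof -
    have x: "x \<in> V" "finite S" using S finV by (auto simp: closed_def intro: finite_subset)
    have "Hn x \<subseteq> S - {x}" using S nb_subset[OF G, of x] by (auto simp: closed_def Hn_def)
    moreover have "card (S - {x}) = 2" using S x by simp
    ultimately show ?thesis using card_Hn[OF x(1)] x by (metis card_subset_eq finite_Diff)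
  qed
  obtain x1 x2 x3 where x: "comp p = {x1, x2, x3}" "x1 \<noteq> x2" "x1 \<noteq> x3" "x2 \<noteq> x3"
    using small(1) by (auto simp: card_3_iff)
  have xV: "x1 \<in> V" "x2 \<in> V" "x3 \<in> V" using C(1) x by (auto simp: closed_def)
  have "cut E (comp p) \<subseteq> (\<lambda>x. {x, m x}) ` {x \<in> comp p. m x \<notin> comp p}"
  proof
    fix e assume e: "e \<in> cut E (comp p)"
    then obtain z where z: "z \<in> e" "z \<in> comp p" "e \<in> E" by (auto simp: cut_def)
    then obtain y where y: "e = {z, y}" "z \<in> V" using simple_graph_edgeE[OF G] by metis
    have yn: "y \<notin> comp p" using e y z by (auto simp: cut_def)
    then have "e \<in> M" using closed_edge[OF C(1), of z y] y z by blast
    then have "y = m z" using M_iff y by auto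
    then show "e \<in> (\<lambda>x. {x, m x}) ` {x \<in> comp p. m x \<notin> comp p}" using y z yn by auto
  qed
  then have "card (cut E (comp p)) \<le> card {x \<in> comp p. m x \<notin> comp p}"
    using x(1) by (intro order_trans[OF card_mono card_image_le]) simp_all
  moreover have "3 \<le> card (cut E (comp p))"
    by (rule cut_ge_3) (use C self_comp[of p] self_comp[of "m p"] mV in \<open>auto simp: closed_def\<close>)
  ultimately have "card (comp p) \<le> card {x \<in> comp p. m x \<notin> comp p}" using small by simp
  then have "{x \<in> comp p. m x \<notin> comp p} = comp p"
    using x by (metis (no_types, lifting) card_seteq finite.emptyI finite_insert mem_Collect_eq subsetI)
  then have mo: "m z \<in> comp (m p)" if "z \<in> comp p" for z
    using that m(1)[of z] p(3) C(1) by (auto simp: closed_def)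
  define y1 y2 y3 where "y1 = m x1" and "y2 = m x2" and "y3 = m x3"
  have y: "y1 \<noteq> y2" "y1 \<noteq> y3" "y2 \<noteq> y3" using m(3) xV x by (metis y1_def y2_def y3_def)+
  have yC: "{y1, y2, y3} \<subseteq> comp (m p)" using mo x by (auto simp: y1_def y2_def y3_def)
  have "comp (m p) = {y1, y2, y3}"
    using yC small(2) y by (metis card_3_iff card_subset_eq card.infinite zero_neq_numeral)
  then have yV: "y1 \<in> V" "y2 \<in> V" "y3 \<in> V" and Cy: "comp (m p) = {y1, y2, y3}"
    using C(2) by (auto simp: closed_def)
  have dis: "x \<noteq> y" if "x \<in> {x1, x2, x3}" "y \<in> {y1, y2, y3}" for x y using that C(3) x Cy by auto
  have my: "m y1 = x1" "m y2 = x2" "m y3 = x3" using m(3) xV by (auto simp: y1_def y2_def y3_def)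
  have nbx: "nb E x1 = {y1, x2, x3}" "nb E x2 = {y2, x1, x3}" "nb E x3 = {y3, x1, x2}"
    using nb_Hn xV tri[OF C(1) small(1)] x by (auto simp: y1_def y2_def y3_def)
  have nby: "nb E y1 = {x1, y2, y3}" "nb E y2 = {x2, y1, y3}" "nb E y3 = {x3, y1, y2}"
    using nb_Hn yV tri[OF C(2) small(2)] Cy y my by auto
  define c where "c = (\<lambda>e. if e \<in> {{x1, y1}, {x2, x3}, {y2, y3}} then 0
     else if e \<in> {{x2, y2}, {x1, x3}, {y1, y3}} then 1 else 2 :: nat)"
  note ne = x(2-4) y dis[of x1 y1] dis[of x1 y2] dis[of x1 y3] dis[of x2 y1] dis[of x2 y2] dis[of x2 y3]
    dis[of x3 y1] dis[of x3 y2] dis[of x3 y3]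
  have D: "x1 \<noteq> x2" "x1 \<noteq> x3" "x2 \<noteq> x3" "y1 \<noteq> y2" "y1 \<noteq> y3" "y2 \<noteq> y3"
    "x1 \<noteq> y1" "x1 \<noteq> y2" "x1 \<noteq> y3" "x2 \<noteq> y1" "x2 \<noteq> y2" "x2 \<noteq> y3" "x3 \<noteq> y1" "x3 \<noteq> y2" "x3 \<noteq> y3"
    using ne by auto
  have "proper E c"
    unfolding proper_def
  proof
    fix z
    show "inj_on (\<lambda>y. c {z, y}) (nb E z)"
    proof (cases "z \<in> V")
      case True
      then consider "z = x1" | "z = x2" | "z = x3" | "z = y1" | "z = y2" | "z = y3"
        using p(3) x(1) Cy by auto
      then show ?thesis
        by cases (simp_all add: nbx nby c_def doubleton_eq_iff D D[symmetric])
    next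
      case False
      then have "nb E z = {}" using simple_graph_edgeD[OF G] by (auto simp: nb_def)
      then show ?thesis by simp
    qed
  qed
  moreover have "c e \<in> {0, 1, 2}" for e by (simp add: c_def)
  ultimately show ?thesis using tait_colouring_generic by blast
qed

lemma M_edge_out_of_closed:
  assumes S: "closed S" "S \<noteq> {}" "S \<noteq> V"
  shows "\<exists>x\<in>S. m x \<notin> S"
proof -
  have "3 \<le> card (cut E S)" by (rule cut_ge_3) (use S in \<open>auto simp: closed_def\<close>)
  then obtain e where e: "e \<in> cut E S" by (metis card.empty ex_in_conv not_numeral_le_zero)
  then obtain x where x: "x \<in> e" "x \<in> S" "e \<in> E" by (auto simp: cut_def)
  then obtain y where y: "e = {x, y}" "x \<in> V" using simple_graph_edgeE[OF G] by metis
  have yn: "y \<notin> S" using e y x by (auto simp: cut_def)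
  then have "e \<in> M" using closed_edge[OF S(1), of x y] y x by blast
  then have "y = m x" using M_iff y by auto
  then show ?thesis using x yn by blast
qed

lemma generic_exists: "\<exists>\<kappa>. proper E \<kappa> \<and> generic_colouring V E \<kappa>"
proof -
  obtain a where a: "a \<in> V" using nonempty by blast
  show ?thesis
  proof (cases "comp a = V")
    case True
    then show ?thesis using generic_if_one_cycle a by blast
  next
    case False
    obtain p where p: "p \<in> comp a" "m p \<notin> comp a"
      using M_edge_out_of_closed[OF closed_comp[OF a] _ False] self_comp by blast
    have pV: "p \<in> V" "m p \<in> V" using p closed_comp[OF a] m by (auto simp: closed_def)
    have ca: "comp p = comp a" using comp_eq[OF a p(1)] .
    then have ne: "comp (m p) \<noteq> comp p" using p self_comp[of "m p"] by auto
    have mm: "m (m p) = p" using m pV by auto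
    show ?thesis
    proof (cases "comp p \<union> comp (m p) = V")
      case True
      have three: "card (comp p) \<ge> 3" "card (comp (m p)) \<ge> 3"
        using closed_card_gt closed_comp self_comp pV by blast+
      consider "card (comp (m p)) \<ge> 4" | "card (comp p) \<ge> 4" | "card (comp p) = 3" "card (comp (m p)) = 3"
        using three by linarith
      then show ?thesis
      proof cases
        case 1
        then show ?thesis using generic_if_two_cycles[OF pV(1) ne True] by blast
      next
        case 2
        then show ?thesis using generic_if_two_cycles[OF pV(2)] ne True mm by (metis Un_commute)
      next
        case 3
        then show ?thesis using generic_if_prism[OF pV(1) ne True] by blast
      qed
    next
      case F: False
      have cl: "closed (comp p \<union> comp (m p))"
        using closed_comp[OF pV(1)] closed_comp[OF pV(2)] unfolding closed_def by fast
      \<comment> \<open>A matching edge leads to a third cycle; the one of the two cycles that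
        contains \<open>q\<close> becomes the common cycle.\<close>
      obtain q where q: "q \<in> comp p \<union> comp (m p)" "m q \<notin> comp p \<union> comp (m p)"
        using M_edge_out_of_closed[OF cl _ F] self_comp[of p] by blast
      have qV: "q \<in> V" using q cl by (auto simp: closed_def)
      have mq: "comp (m q) \<noteq> comp p" "comp (m q) \<noteq> comp (m p)" using q self_comp[of "m q"] by auto
      consider "q \<in> comp p" | "q \<in> comp (m p)" using q by blast
      then show ?thesis
      proof cases
        case 1
        then have "comp q = comp p" using comp_eq[OF pV(1)] by blast
        then show ?thesis using generic_if_three_cycles[OF pV(1) qV] ne mq by metis
      next
        case 2
        then have "comp q = comp (m p)" using comp_eq[OF pV(2)] by blast
        then show ?thesis using generic_if_three_cycles[OF pV(2) qV] ne mq mm by metis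
      qed
    qed
  qed
qed

end

text \<open>That even the whole line of an edge is free is needed later: an edge is removed from
  such a drawing and its ends are continued along the line.\<close>

lemma (in three_edge_connected) line_free_drawing:
  "\<exists>f. basic_drawing V E f \<and> (\<forall>u v. {u, v} \<in> E \<longrightarrow>
     (\<exists>s. nrm s \<bullet> f u = nrm s \<bullet> f v \<and> (\<forall>w\<in>V - {u, v}. nrm s \<bullet> f w \<noteq> nrm s \<bullet> f u)))"
proof -
  obtain m where "perfect_matching V E m" using perfect_matching_exists by blast
  then interpret matched V E m by unfold_locales
  obtain \<kappa> where \<kappa>: "generic_colouring V E \<kappa>" using generic_exists by blast
  define Q where "Q = {(u, v, w). {u, v} \<in> E \<and> w \<in> V - {u, v}}"
  have "Q \<subseteq> V \<times> V \<times> V" using simple_graph_edgeD[OF G] by (auto simp: Q_def)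
  then have "finite Q" using finV finite_subset by blast
  then have "\<exists>f. conforms E \<kappa> f \<and> (\<forall>(u, v, w)\<in>Q. nrm (\<kappa> {u, v}) \<bullet> f w \<noteq> nrm (\<kappa> {u, v}) \<bullet> f u)"
    by (rule stress_free_configuration[OF G]) (use \<kappa> in \<open>auto simp: Q_def generic_colouring_def\<close>)
  then obtain f where f: "conforms E \<kappa> f" and
    free: "\<And>u v w. {u, v} \<in> E \<Longrightarrow> w \<in> V - {u, v} \<Longrightarrow> nrm (\<kappa> {u, v}) \<bullet> f w \<noteq> nrm (\<kappa> {u, v}) \<bullet> f u"
    by (auto simp: Q_def)
  have on: "nrm (\<kappa> {u, v}) \<bullet> f u = nrm (\<kappa> {u, v}) \<bullet> f v" if "{u, v} \<in> E" for u v
    using f that by (auto simp: conforms_def)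
  have "inj_on f V"
  proof (rule inj_onI, rule ccontr)
    fix x y assume xy: "x \<in> V" "y \<in> V" "f x = f y" "x \<noteq> y"
    \<comment> \<open>An edge from \<open>x\<close> to a neighbour other than \<open>y\<close> has a
      line that misses \<open>f y\<close>.\<close>
    have "card (nb E x - {y}) > 0"
      using card_nb[OF xy(1)] finite_nb[OF G, of x] by (simp add: card_Diff_singleton_if)
    then obtain z where "z \<in> nb E x - {y}" by (metis card.empty ex_in_conv less_irrefl)
    then show False using free[of x z y] xy by (auto simp: nb_def)
  qed
  moreover have "f w \<notin> closed_segment (f u) (f v)" if "{u, v} \<in> E" "w \<in> V - {u, v}" for u v w
    using free[OF that] on[OF that(1)] inner_on_segment[of "f w" "f u" "f v" "nrm (\<kappa> {u, v})"] by auto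
  moreover have "basic_dir (f u - f v)" if "{u, v} \<in> E" for u v
    using on[OF that] by (intro basic_dir_nrm[of "\<kappa> {u, v}"]) (simp add: inner_diff_right)
  ultimately have "basic_drawing V E f" by (simp add: basic_drawing_def)
  moreover have "\<exists>s. nrm s \<bullet> f u = nrm s \<bullet> f v \<and> (\<forall>w\<in>V - {u, v}. nrm s \<bullet> f w \<noteq> nrm s \<bullet> f u)"
    if "{u, v} \<in> E" for u v using on[OF that] free[OF that] by blast
  ultimately show ?thesis by blast
qed

subsection \<open>Transforming and extending drawings\<close>

definition ind :: "'a set set \<Rightarrow> 'a set \<Rightarrow> 'a set set" where
  "ind E Y = {e \<in> E. e \<subseteq> Y}"

text \<open>Multiplication by the complex number \<open>d\<close>, that is, a rotation combined with
  a scaling.\<close>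

definition rot :: "real \<times> real \<Rightarrow> real \<times> real \<Rightarrow> real \<times> real" where
  "rot d q = fst q *\<^sub>R d + snd q *\<^sub>R (- snd d, fst d)"

lemma rot_simps [simp]:
  "fst (rot d q) = fst q * fst d - snd q * snd d" "snd (rot d q) = fst q * snd d + snd q * fst d"
  by (simp_all add: rot_def)

lemma linear_rot: "linear (rot d)"
  by (rule linearI) (auto simp: rot_def algebra_simps)

lemma rot_eq_0:
  assumes "d \<noteq> 0" "rot d q = 0"
  shows "q = 0"
proof -
  have e: "fst q * fst d - snd q * snd d = 0" "fst q * snd d + snd q * fst d = 0"
    using arg_cong[OF assms(2), of fst] arg_cong[OF assms(2), of snd] by simp_all
  have "fst q * ((fst d)\<^sup>2 + (snd d)\<^sup>2)
      = fst d * (fst q * fst d - snd q * snd d) + snd d * (fst q * snd d + snd q * fst d)"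
    and "snd q * ((fst d)\<^sup>2 + (snd d)\<^sup>2)
      = fst d * (fst q * snd d + snd q * fst d) - snd d * (fst q * fst d - snd q * snd d)"
    by (simp_all add: algebra_simps power2_eq_square)
  then have "fst q * ((fst d)\<^sup>2 + (snd d)\<^sup>2) = 0" "snd q * ((fst d)\<^sup>2 + (snd d)\<^sup>2) = 0"
    unfolding e by simp_all
  moreover have "(fst d)\<^sup>2 + (snd d)\<^sup>2 \<noteq> 0"
    using assms(1) by (auto simp: sum_power2_eq_zero_iff prod_eq_iff)
  ultimately show ?thesis by (auto simp: prod_eq_iff)
qed

lemma inj_rot: "d \<noteq> 0 \<Longrightarrow> inj (rot d)"
  using rot_eq_0 linear_injective_0[OF linear_rot] by blast

text \<open>Arguments add under complex multiplication, and the basic directions are the multiples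
  of pi/4.\<close>

lemma basic_dir_rot:
  assumes "basic_dir d" "basic_dir q"
  shows "basic_dir (rot d q)"
proof -
  have "fst d = 0 \<or> snd d = 0 \<or> snd d = fst d \<or> snd d = - fst d"
    "fst q = 0 \<or> snd q = 0 \<or> snd q = fst q \<or> snd q = - fst q"
    using assms by (auto simp: basic_dir_def)
  then show ?thesis unfolding basic_dir_def rot_simps by (elim disjE) (simp_all add: algebra_simps)
qed

lemma basic_drawing_transform:
  assumes D: "basic_drawing V E f" and d: "d \<noteq> 0" "basic_dir d"
  shows "basic_drawing V E (\<lambda>x. t + rot d (f x))"
proof -
  have inj: "inj (\<lambda>q. t + rot d q)" using inj_rot[OF d(1)] by (auto simp: inj_def)
  have seg: "closed_segment (t + rot d a) (t + rot d b) = (\<lambda>q. t + rot d q) ` closed_segment a b" for a b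
    using closed_segment_translation[of t "rot d a" "rot d b"] closed_segment_linear_image[OF linear_rot, of d a b]
    by (auto simp: image_image)
  have "inj_on (\<lambda>x. t + rot d (f x)) V"
    using D comp_inj_on[of f V "\<lambda>q. t + rot d q"] inj_on_subset[OF inj]
    by (auto simp: basic_drawing_def comp_def)
  moreover have "basic_dir ((t + rot d (f u)) - (t + rot d (f v)))" if "{u, v} \<in> E" for u v
  proof -
    have "(t + rot d (f u)) - (t + rot d (f v)) = rot d (f u - f v)"
      using linear_diff[OF linear_rot, of d "f u" "f v"] by simp
    then show ?thesis using basic_dir_rot[OF d(2)] D that by (auto simp: basic_drawing_def)
  qed
  moreover have "t + rot d (f w) \<notin> closed_segment (t + rot d (f u)) (t + rot d (f v))"
    if "{u, v} \<in> E" "w \<in> V - {u, v}" for u v w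
    unfolding seg using D that inj_image_mem_iff[OF inj] by (auto simp: basic_drawing_def)
  ultimately show ?thesis by (auto simp: basic_drawing_def)
qed

lemma basic_drawing_insert:
  assumes G: "simple_graph V E" and D: "basic_drawing Y (ind E Y) g" and a: "a \<notin> Y"
    and new: "\<And>y. y \<in> Y \<Longrightarrow> q \<noteq> g y"
    and old: "\<And>x y. {x, y} \<in> E \<Longrightarrow> x \<in> Y \<Longrightarrow> y \<in> Y \<Longrightarrow> q \<notin> closed_segment (g x) (g y)"
    and edges: "\<And>b. b \<in> nb E a \<inter> Y \<Longrightarrow> basic_dir (q - g b)"
    and free: "\<And>b y. b \<in> nb E a \<inter> Y \<Longrightarrow> y \<in> Y - {b} \<Longrightarrow> g y \<notin> closed_segment q (g b)"
  shows "basic_drawing (insert a Y) (ind E (insert a Y)) (g(a := q))"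
proof -
  let ?f = "g(a := q)"
  have f: "?f y = g y" if "y \<in> Y" for y using that a by auto
  have "inj_on ?f (insert a Y)"
    using D a new by (auto simp: basic_drawing_def inj_on_def)
  moreover have "basic_dir (?f u - ?f v) \<and> (\<forall>w \<in> insert a Y - {u, v}. ?f w \<notin> closed_segment (?f u) (?f v))"
    if e: "{u, v} \<in> ind E (insert a Y)" for u v
  proof -
    have uv: "u \<noteq> v" "u \<in> insert a Y" "v \<in> insert a Y" "{u, v} \<in> E"
      using e simple_graph_edgeD[OF G, of u v] by (auto simp: ind_def)
    consider "u \<in> Y" "v \<in> Y" | "u = a" "v \<in> Y" | "v = a" "u \<in> Y" using uv by auto
    then show ?thesis
    proof cases
      case 1
      then have "{u, v} \<in> ind E Y" using uv by (auto simp: ind_def)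
      then show ?thesis using D f 1 old[OF uv(4) 1] a by (auto simp: basic_drawing_def)
    next
      case 2
      then have "v \<in> nb E a \<inter> Y" using uv by (auto simp: nb_def)
      then show ?thesis using edges[of v] free[of v] f 2 a by auto
    next
      case 3
      then have "u \<in> nb E a \<inter> Y" using uv by (auto simp: nb_def insert_commute)
      then show ?thesis using edges[of u] free[of u] f 3 a basic_dir_minus_commute[of q "g u"]
        by (auto simp: closed_segment_commute)
    qed
  qed
  ultimately show ?thesis by (simp add: basic_drawing_def)
qed

subsection \<open>Pieces\<close>

text \<open>A piece is a vertex set \<open>Y\<close> joined to the rest of the graph by two edges only, at \<open>b\<close> and \<open>d\<close>.
  It is straight if these edges can leave it in opposite directions along a common line,
  a corner if they can leave it along two perpendicular rays, and closable
  if both can be joined to a new vertex from which a further ray runs to infinity.\<close>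

definition straight :: "'a set set \<Rightarrow> 'a set \<Rightarrow> 'a \<Rightarrow> 'a \<Rightarrow> bool" where
  "straight E Y b d \<longleftrightarrow> (\<exists>g. basic_drawing Y (ind E Y) g \<and> snd (g b) = 0 \<and> snd (g d) = 0 \<and>
     (\<forall>y\<in>Y. snd (g y) = 0 \<longrightarrow> fst (g b) \<le> fst (g y) \<and> fst (g y) \<le> fst (g d)))"

definition corner :: "'a set set \<Rightarrow> 'a set \<Rightarrow> 'a \<Rightarrow> 'a \<Rightarrow> bool" where
  "corner E Y b d \<longleftrightarrow> (\<exists>g. basic_drawing Y (ind E Y) g \<and> snd (g b) = 0 \<and> fst (g d) = 0 \<and>
     (\<forall>y\<in>Y. (snd (g y) = 0 \<longrightarrow> fst (g y) \<le> fst (g b)) \<and> (fst (g y) = 0 \<longrightarrow> snd (g y) \<le> snd (g d))))"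

definition closable :: "'a set set \<Rightarrow> 'a set \<Rightarrow> 'a \<Rightarrow> bool" where
  "closable E Y a \<longleftrightarrow> (\<exists>g. basic_drawing (insert a Y) (ind E (insert a Y)) g \<and> g a = 0 \<and>
     (\<forall>y\<in>Y. snd (g y) = 0 \<longrightarrow> fst (g y) < 0))"

lemma straightI:
  assumes "basic_drawing Y (ind E Y) g" "snd (g b) = 0" "snd (g d) = 0"
    "\<And>y. y \<in> Y \<Longrightarrow> snd (g y) = 0 \<Longrightarrow> fst (g b) \<le> fst (g y)"
    "\<And>y. y \<in> Y \<Longrightarrow> snd (g y) = 0 \<Longrightarrow> fst (g y) \<le> fst (g d)"
  shows "straight E Y b d"
  using assms by (auto simp: straight_def)

lemma cornerI:
  assumes "basic_drawing Y (ind E Y) g" "snd (g b) = 0" "fst (g d) = 0"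
    "\<And>y. y \<in> Y \<Longrightarrow> snd (g y) = 0 \<Longrightarrow> fst (g y) \<le> fst (g b)"
    "\<And>y. y \<in> Y \<Longrightarrow> fst (g y) = 0 \<Longrightarrow> snd (g y) \<le> snd (g d)"
  shows "corner E Y b d"
  using assms by (auto simp: corner_def)

lemma closableI:
  assumes "basic_drawing (insert a Y) (ind E (insert a Y)) g" "g a = 0"
    "\<And>y. y \<in> Y \<Longrightarrow> snd (g y) = 0 \<Longrightarrow> fst (g y) < 0"
  shows "closable E Y a"
  using assms by (auto simp: closable_def)

lemma segment_const:
  fixes n :: "real \<times> real"
  assumes "p \<in> closed_segment a b" "n \<bullet> a = c" "n \<bullet> b = c"
  shows "n \<bullet> p = c"
  using inner_on_segment[OF assms(1), of n] assms by simp

lemma on_x_axis: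
  fixes a b p :: "real \<times> real"
  assumes "p \<in> closed_segment a b" "snd a = 0" "snd b = 0" "fst b \<le> fst a"
  shows "snd p = 0" "fst b \<le> fst p" "fst p \<le> fst a"
proof -
  obtain u where u: "0 \<le> u" "u \<le> 1" "p = (1 - u) *\<^sub>R a + u *\<^sub>R b"
    using assms(1) by (auto simp: closed_segment_def)
  then show "snd p = 0" using assms by simp
  have "fst p = fst b + (1 - u) * (fst a - fst b)" "fst p = fst a - u * (fst a - fst b)"
    unfolding u(3) by (simp_all add: algebra_simps)
  moreover have "0 \<le> (1 - u) * (fst a - fst b)" "0 \<le> u * (fst a - fst b)" using u assms(4) by simp_all
  ultimately show "fst b \<le> fst p" "fst p \<le> fst a" by simp_all
qed

lemma on_y_axis:
  fixes a b p :: "real \<times> real"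
  assumes "p \<in> closed_segment a b" "fst a = 0" "fst b = 0" "snd b \<le> snd a"
  shows "fst p = 0" "snd b \<le> snd p" "snd p \<le> snd a"
proof -
  obtain u where u: "0 \<le> u" "u \<le> 1" "p = (1 - u) *\<^sub>R a + u *\<^sub>R b"
    using assms(1) by (auto simp: closed_segment_def)
  then show "fst p = 0" using assms by simp
  have "snd p = snd b + (1 - u) * (snd a - snd b)" "snd p = snd a - u * (snd a - snd b)"
    unfolding u(3) by (simp_all add: algebra_simps)
  moreover have "0 \<le> (1 - u) * (snd a - snd b)" "0 \<le> u * (snd a - snd b)" using u assms(4) by simp_all
  ultimately show "snd b \<le> snd p" "snd p \<le> snd a" by simp_all
qed

lemma finite_strict_upper_bound: "finite S \<Longrightarrow> \<exists>B :: real. \<forall>x\<in>S. x < B"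
  by (metis Max_ge gt_ex le_less_trans)

text \<open>With \<open>a\<close> far out on the ray of \<open>b\<close> and \<open>c\<close>
  equally far on the ray of \<open>d\<close>, the edge \<open>ac\<close> is a diagonal with all of
  \<open>Y\<close> strictly on one side. From there the next two edges can leave along this diagonal
  line, along two perpendicular rays, or meet in a common vertex \<open>h\<close>.\<close>

lemma ladder:
  assumes G: "simple_graph V E" and c: "corner E Y b d" and fin: "finite Y"
    and bd: "b \<in> Y" "d \<in> Y" and ac: "a \<notin> Y" "c \<notin> Y" "a \<noteq> c"
    and nba: "nb E a \<inter> Y = {b}" and nbc: "nb E c \<inter> insert a Y = {a, d}"
  defines "Y' \<equiv> insert c (insert a Y)"
  shows "straight E Y' c a" "corner E Y' c a"
    and "h \<notin> Y' \<Longrightarrow> nb E h \<inter> Y' = {a, c} \<Longrightarrow> closable E Y' h"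
proof -
  obtain g where g: "basic_drawing Y (ind E Y) g" "snd (g b) = 0" "fst (g d) = 0"
    and gx: "\<And>y. y \<in> Y \<Longrightarrow> snd (g y) = 0 \<Longrightarrow> fst (g y) \<le> fst (g b)"
    and gy: "\<And>y. y \<in> Y \<Longrightarrow> fst (g y) = 0 \<Longrightarrow> snd (g y) \<le> snd (g d)"
    using c by (auto simp: corner_def)
  have ginj: "y = y'" if "g y = g y'" "y \<in> Y" "y' \<in> Y" for y y'
    using g(1) that by (auto simp: basic_drawing_def inj_on_def)
  \<comment> \<open>A bound for the sum of absolute coordinates, so that \<open>Y\<close> lies below
    the line x + y = R.\<close>
  obtain R where R: "\<And>y. y \<in> Y \<Longrightarrow> \<bar>fst (g y)\<bar> + \<bar>snd (g y)\<bar> < R"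
  proof -
    have "finite ((\<lambda>y. \<bar>fst (g y)\<bar> + \<bar>snd (g y)\<bar>) ` Y)" using fin by simp
    then obtain B where "\<forall>x\<in>(\<lambda>y. \<bar>fst (g y)\<bar> + \<bar>snd (g y)\<bar>) ` Y. x < B"
      using finite_strict_upper_bound by blast
    then show thesis using that[of B] by auto
  qed
  have Rpos: "R > 0" using R[OF bd(1)] by linarith
  have l: "(1, 1) \<bullet> g y < R" "fst (g y) < R" "snd (g y) < R" if "y \<in> Y" for y
    using R[OF that] by (auto simp: inner_prod_def)
  define g1 where "g1 = g(a := (R, 0))"
  have D1: "basic_drawing (insert a Y) (ind E (insert a Y)) g1"
    unfolding g1_def
  proof (rule basic_drawing_insert[OF G g(1) ac(1)])
    show "(R, 0) \<noteq> g y" if "y \<in> Y" for y using l[OF that] by (metis fst_conv less_irrefl)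
    show "(R, 0) \<notin> closed_segment (g x) (g y)" if "x \<in> Y" "y \<in> Y" for x y
      using inner_on_segment_less[of "(R, 0)" "g x" "g y" "(1, 1)" R] l(1) that by auto
    show "basic_dir ((R, 0) - g b')" if "b' \<in> nb E a \<inter> Y" for b'
      using that nba g by (simp add: basic_dir_def)
    show "g y \<notin> closed_segment (R, 0) (g b')" if b': "b' \<in> nb E a \<inter> Y" and y: "y \<in> Y - {b'}" for b' y
    proof
      assume s: "g y \<in> closed_segment (R, 0) (g b')"
      have bb: "b' = b" using b' nba by auto
      have "snd (g y) = 0" "fst (g b) \<le> fst (g y)"
        using on_x_axis[OF s] g l(2)[OF bd(1)] bb by auto
      then have "g y = g b" using gx[of y] y g(2) by (auto simp: prod_eq_iff)
      then show False using ginj y bb bd by auto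
    qed
  qed
  have g1: "g1 a = (R, 0)" "\<And>y. y \<in> Y \<Longrightarrow> g1 y = g y" using ac by (auto simp: g1_def)
  define g2 where "g2 = g1(c := (0, R))"
  have D2: "basic_drawing Y' (ind E Y') g2"
    unfolding g2_def Y'_def
  proof (rule basic_drawing_insert[OF G D1])
    show "c \<notin> insert a Y" using ac by auto
    show "(0, R) \<noteq> g1 y" if "y \<in> insert a Y" for y
      using that l(3)[of y] g1 Rpos by (auto simp: prod_eq_iff)
    show "(0, R) \<notin> closed_segment (g1 x) (g1 y)" if e: "{x, y} \<in> E" and xy: "x \<in> insert a Y" "y \<in> insert a Y" for x y
    proof
      assume s: "(0, R) \<in> closed_segment (g1 x) (g1 y)"
      have ne: "x \<noteq> y" using simple_graph_edgeD[OF G e] by auto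
      consider "x \<in> Y" "y \<in> Y" | "x = a" "y \<in> Y" | "y = a" "x \<in> Y" using xy ne by auto
      then show False
      proof cases
        case 1
        then show False using inner_on_segment_less[OF s, of "(1, 1)" R] l(1) g1 by auto
      next
        case 2
        then have "y \<in> nb E a \<inter> Y" using e by (simp add: nb_def)
        then have "y = b" using nba by simp
        then show False using segment_const[OF s, of "(0, 1)" 0] g1 2 g(2) bd Rpos by (auto simp: inner_prod_def)
      next
        case 3
        then have "x \<in> nb E a \<inter> Y" using e by (simp add: nb_def insert_commute)
        then have "x = b" using nba by simp
        then show False using segment_const[OF s, of "(0, 1)" 0] g1 3 g(2) bd Rpos by (auto simp: inner_prod_def)
      qed
    qed
    show "basic_dir ((0, R) - g1 b')" if "b' \<in> nb E c \<inter> insert a Y" for b'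
      using that nbc g1 g bd by (auto simp: basic_dir_def)
    show "g1 y \<notin> closed_segment (0, R) (g1 b')" if b': "b' \<in> nb E c \<inter> insert a Y" and y: "y \<in> insert a Y - {b'}" for b' y
    proof
      assume s: "g1 y \<in> closed_segment (0, R) (g1 b')"
      consider "b' = a" | "b' = d" using b' nbc by auto
      then show False
      proof cases
        case 1
        then have "(1, 1) \<bullet> g1 y = R" using segment_const[OF s, of "(1, 1)" R] g1 by auto
        then show False using l(1)[of y] g1 y 1 by auto
      next
        case 2
        have ax: "fst (g1 y) = 0" "snd (g d) \<le> snd (g1 y)"
          using on_y_axis[OF s] g(3) l(3)[OF bd(2)] g1 bd 2 by auto
        then have yY: "y \<in> Y" using y g1 Rpos by auto
        then have "g y = g d" using gy[of y] ax g1 g(3) by (auto simp: prod_eq_iff)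
        then show False using ginj[of y d] y yY bd 2 by auto
      qed
    qed
  qed
  have g2: "g2 a = (R, 0)" "g2 c = (0, R)" "\<And>y. y \<in> Y \<Longrightarrow> g2 y = g y" using ac g1 by (auto simp: g2_def)
  have l2: "fst (g2 y) + snd (g2 y) < R" if "y \<in> Y" for y
    using l(1)[OF that] g2(3)[OF that] by (simp add: inner_prod_def)
  \<comment> \<open>Turning by 45 degrees makes the line x + y = R the horizontal axis, with only
    \<open>a\<close> and \<open>c\<close> on it.\<close>
  have "basic_drawing Y' (ind E Y') (\<lambda>x. (0, - R) + rot (1, 1) (g2 x))"
    by (rule basic_drawing_transform[OF D2]) (auto simp: basic_dir_def zero_prod_def)
  then show "straight E Y' c a"
  proof (rule straightI)
    show "snd ((0, - R) + rot (1, 1) (g2 c)) = 0" "snd ((0, - R) + rot (1, 1) (g2 a)) = 0" by (simp_all add: g2)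
    fix y assume y: "y \<in> Y'" "snd ((0, - R) + rot (1, 1) (g2 y)) = 0"
    then have "y = a \<or> y = c" using l2[of y] by (auto simp: Y'_def)
    then show "fst ((0, - R) + rot (1, 1) (g2 c)) \<le> fst ((0, - R) + rot (1, 1) (g2 y))"
      "fst ((0, - R) + rot (1, 1) (g2 y)) \<le> fst ((0, - R) + rot (1, 1) (g2 a))"
      using Rpos by (auto simp: g2)
  qed
  \<comment> \<open>The corner of the square at (R, R) moves to the origin; \<open>c\<close> sees it
    to the right and \<open>a\<close> sees it above.\<close>
  have "basic_drawing Y' (ind E Y') (\<lambda>x. (- R, - R) + rot (1, 0) (g2 x))"
    by (rule basic_drawing_transform[OF D2]) (auto simp: basic_dir_def zero_prod_def)
  then show "corner E Y' c a"
  proof (rule cornerI)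
    show "snd ((- R, - R) + rot (1, 0) (g2 c)) = 0" "fst ((- R, - R) + rot (1, 0) (g2 a)) = 0" by (simp_all add: g2)
    fix y assume y: "y \<in> Y'"
    show "fst ((- R, - R) + rot (1, 0) (g2 y)) \<le> fst ((- R, - R) + rot (1, 0) (g2 c))"
      if "snd ((- R, - R) + rot (1, 0) (g2 y)) = 0"
    proof -
      have "y = c"
      proof (rule ccontr)
        assume "y \<noteq> c"
        then have "snd (g2 y) < R" using y l(3)[of y] Rpos g2 by (cases "y = a") (simp_all add: Y'_def)
        then show False using that by simp
      qed
      then show ?thesis by simp
    qed
    show "snd ((- R, - R) + rot (1, 0) (g2 y)) \<le> snd ((- R, - R) + rot (1, 0) (g2 a))"
      if "fst ((- R, - R) + rot (1, 0) (g2 y)) = 0"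
    proof -
      have "y = a"
      proof (rule ccontr)
        assume "y \<noteq> a"
        then have "fst (g2 y) < R" using y l(2)[of y] Rpos g2 by (cases "y = c") (simp_all add: Y'_def)
        then show False using that by simp
      qed
      then show ?thesis by simp
    qed
  qed
  show "closable E Y' h" if h: "h \<notin> Y'" "nb E h \<inter> Y' = {a, c}"
  proof -
    \<comment> \<open>The fourth corner of the square; the further ray leaves it in direction (1,
      1), and \<open>rot (1, - 1)\<close> makes that ray horizontal.\<close>
    define g3 where "g3 = g2(h := (R, R))"
    have l3: "(1, 1) \<bullet> g2 y < 2 * R" if "y \<in> Y'" for y
      using that l2[of y] Rpos by (auto simp: Y'_def g2 inner_prod_def)
    have D3: "basic_drawing (insert h Y') (ind E (insert h Y')) g3"
      unfolding g3_def
    proof (rule basic_drawing_insert[OF G D2 h(1)])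
      show "(R, R) \<noteq> g2 y" if "y \<in> Y'" for y
      proof
        assume "(R, R) = g2 y"
        then have "(1, 1) \<bullet> (R, R) < 2 * R" using l3[OF that] by simp
        then show False by (simp add: inner_prod_def)
      qed
      show "(R, R) \<notin> closed_segment (g2 x) (g2 y)" if "x \<in> Y'" "y \<in> Y'" for x y
        using inner_on_segment_less[of "(R, R)" "g2 x" "g2 y" "(1, 1)" "2 * R"] l3 that by (auto simp: inner_prod_def)
      show "basic_dir ((R, R) - g2 b')" if "b' \<in> nb E h \<inter> Y'" for b'
        using that h g2 by (auto simp: basic_dir_def)
      show "g2 y \<notin> closed_segment (R, R) (g2 b')" if b': "b' \<in> nb E h \<inter> Y'" and y: "y \<in> Y' - {b'}" for b' y
      proof
        assume s: "g2 y \<in> closed_segment (R, R) (g2 b')"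
        consider "b' = a" | "b' = c" using b' h by auto
        then show False
        proof cases
          case 1
          then have "(1, 0) \<bullet> g2 y = R" using segment_const[OF s, of "(1, 0)" R] g2 by (auto simp: inner_prod_def)
          then show False using l(2)[of y] g2(2) g2(3)[of y] y 1 Rpos
            by (cases "y = c"; cases "y \<in> Y") (simp_all add: Y'_def inner_prod_def)
        next
          case 2
          then have "(0, 1) \<bullet> g2 y = R" using segment_const[OF s, of "(0, 1)" R] g2 by (auto simp: inner_prod_def)
          then show False using l(3)[of y] g2(1) g2(3)[of y] y 2 Rpos
            by (cases "y = a"; cases "y \<in> Y") (simp_all add: Y'_def inner_prod_def)
        qed
      qed
    qed
    have g3: "g3 h = (R, R)" "\<And>y. y \<in> Y' \<Longrightarrow> g3 y = g2 y" using h by (auto simp: g3_def)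
    have "basic_drawing (insert h Y') (ind E (insert h Y')) (\<lambda>x. (- 2 * R, 0) + rot (1, - 1) (g3 x))"
      by (rule basic_drawing_transform[OF D3]) (auto simp: basic_dir_def zero_prod_def)
    then show ?thesis
    proof (rule closableI)
      show "(- 2 * R, 0) + rot (1, - 1) (g3 h) = 0" by (simp add: g3 prod_eq_iff)
      fix y assume "y \<in> Y'"
      then show "fst ((- 2 * R, 0) + rot (1, - 1) (g3 y)) < 0" using l3[of y] g3(2)[of y] by (simp add: inner_prod_def)
    qed
  qed
qed

text \<open>The third neighbour \<open>h\<close> of the closing vertex is put far out on the free
  ray, beyond everything else. Both remaining edges start at \<open>h\<close>: the vertical line
  through \<open>h\<close> is free, and so are its two diagonal rays pointing outwards.\<close>

lemma hang:
  assumes G: "simple_graph V E" and c: "closable E Y a" and fin: "finite Y"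
    and ah: "a \<notin> Y" "h \<notin> insert a Y" and nbh: "nb E h \<inter> insert a Y = {a}"
  defines "Y' \<equiv> insert h (insert a Y)"
  shows "straight E Y' h h" "corner E Y' h h"
proof -
  obtain g where g: "basic_drawing (insert a Y) (ind E (insert a Y)) g" "g a = 0"
    and gx: "\<And>y. y \<in> Y \<Longrightarrow> snd (g y) = 0 \<Longrightarrow> fst (g y) < 0"
    using c by (auto simp: closable_def)
  obtain R where R: "\<And>y. y \<in> insert a Y \<Longrightarrow> fst (g y) < R"
  proof -
    have "finite ((\<lambda>y. fst (g y)) ` insert a Y)" using fin by simp
    then obtain B where "\<forall>x\<in>(\<lambda>y. fst (g y)) ` insert a Y. x < B"
      using finite_strict_upper_bound by blast
    then show thesis using that[of B] by auto
  qed
  have Rpos: "R > 0" using R[of a] g by simp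
  define g1 where "g1 = g(h := (R, 0))"
  have D1: "basic_drawing Y' (ind E Y') g1"
    unfolding g1_def Y'_def
  proof (rule basic_drawing_insert[OF G g(1) ah(2)])
    show "(R, 0) \<noteq> g y" if "y \<in> insert a Y" for y using R[OF that] by (metis fst_conv less_irrefl)
    show "(R, 0) \<notin> closed_segment (g x) (g y)" if "x \<in> insert a Y" "y \<in> insert a Y" for x y
      using inner_on_segment_less[of "(R, 0)" "g x" "g y" "(1, 0)" R] R that by (auto simp: inner_prod_def)
    show "basic_dir ((R, 0) - g b')" if "b' \<in> nb E h \<inter> insert a Y" for b'
      using that nbh g by (simp add: basic_dir_def)
    show "g y \<notin> closed_segment (R, 0) (g b')" if b': "b' \<in> nb E h \<inter> insert a Y" and y: "y \<in> insert a Y - {b'}" for b' y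
    proof
      assume s: "g y \<in> closed_segment (R, 0) (g b')"
      have "b' = a" using b' nbh by auto
      then have "snd (g y) = 0" "0 \<le> fst (g y)" using on_x_axis[OF s] g Rpos by auto
      then show False using gx[of y] y \<open>b' = a\<close> by auto
    qed
  qed
  have g1: "g1 h = (R, 0)" "\<And>y. y \<in> insert a Y \<Longrightarrow> fst (g1 y) < R" using ah R by (auto simp: g1_def)
  have "basic_drawing Y' (ind E Y') (\<lambda>x. (0, - R) + rot (0, 1) (g1 x))"
    by (rule basic_drawing_transform[OF D1]) (auto simp: basic_dir_def zero_prod_def)
  then show "straight E Y' h h"
  proof (rule straightI)
    show "snd ((0, - R) + rot (0, 1) (g1 h)) = 0" "snd ((0, - R) + rot (0, 1) (g1 h)) = 0" by (simp_all add: g1)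
    fix y assume y: "y \<in> Y'" "snd ((0, - R) + rot (0, 1) (g1 y)) = 0"
    then have "y = h" using g1(2)[of y] by (auto simp: Y'_def)
    then show "fst ((0, - R) + rot (0, 1) (g1 h)) \<le> fst ((0, - R) + rot (0, 1) (g1 y))"
      "fst ((0, - R) + rot (0, 1) (g1 y)) \<le> fst ((0, - R) + rot (0, 1) (g1 h))" by simp_all
  qed
  have "basic_drawing Y' (ind E Y') (\<lambda>x. (- R, - R) + rot (1, 1) (g1 x))"
    by (rule basic_drawing_transform[OF D1]) (auto simp: basic_dir_def zero_prod_def)
  then show "corner E Y' h h"
  proof (rule cornerI)
    show "snd ((- R, - R) + rot (1, 1) (g1 h)) = 0" "fst ((- R, - R) + rot (1, 1) (g1 h)) = 0" by (simp_all add: g1)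
    fix y assume y: "y \<in> Y'"
    show "fst ((- R, - R) + rot (1, 1) (g1 y)) \<le> fst ((- R, - R) + rot (1, 1) (g1 h))"
      if "snd ((- R, - R) + rot (1, 1) (g1 y)) = 0"
      using that y g1(2)[of y] by (cases "y = h") (simp_all add: Y'_def g1(1))
    show "snd ((- R, - R) + rot (1, 1) (g1 y)) \<le> snd ((- R, - R) + rot (1, 1) (g1 h))"
      if "fst ((- R, - R) + rot (1, 1) (g1 y)) = 0"
      using that y g1(2)[of y] by (cases "y = h") (simp_all add: Y'_def g1(1))
  qed
qed

subsection \<open>Combining drawings\<close>

text \<open>The two drawings are placed on different sides of a vertical line, so no segment of one
  reaches a vertex of the other.\<close>

lemma basic_drawing_disjoint_union:
  assumes G: "simple_graph V E" and V: "V = X \<union> Y" "X \<inter> Y = {}"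
    and no: "\<And>x y. x \<in> X \<Longrightarrow> y \<in> Y \<Longrightarrow> {x, y} \<notin> E"
    and F: "basic_drawing X (ind E X) F" and g: "basic_drawing Y (ind E Y) g"
  shows "\<exists>f. basic_drawing V E f"
proof -
  have fin: "finite X" "finite Y" using G V by (auto simp: simple_graph_def)
  obtain A where A: "\<And>x. x \<in> X \<Longrightarrow> fst (F x) < A"
    using finite_strict_upper_bound[of "(\<lambda>x. fst (F x)) ` X"] fin by auto
  obtain B where B: "\<And>y. y \<in> Y \<Longrightarrow> - fst (g y) < B"
    using finite_strict_upper_bound[of "(\<lambda>y. - fst (g y)) ` Y"] fin by auto
  define N where "N = (\<lambda>y. (A + B, 0) + rot (1, 0) (g y))"
  have N: "basic_drawing Y (ind E Y) N"
    unfolding N_def by (rule basic_drawing_transform[OF g]) (auto simp: basic_dir_def zero_prod_def)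
  have NA: "(-1, 0) \<bullet> N y < - A" if "y \<in> Y" for y using B[OF that] by (simp add: N_def inner_prod_def)
  have FA: "(1, 0) \<bullet> F x < A" if "x \<in> X" for x using A[OF that] by (simp add: inner_prod_def)
  have sepX: "N y \<notin> closed_segment (F x) (F x')" if "x \<in> X" "x' \<in> X" "y \<in> Y" for x x' y
    using inner_on_segment_less[of "N y" "F x" "F x'" "(1, 0)" A] FA NA that by (force simp: inner_prod_def)
  have sepY: "F x \<notin> closed_segment (N y) (N y')" if "y \<in> Y" "y' \<in> Y" "x \<in> X" for x y y'
    using inner_on_segment_less[of "F x" "N y" "N y'" "(-1, 0)" "- A"] FA NA that by (force simp: inner_prod_def)
  define f where "f = (\<lambda>x. if x \<in> Y then N x else F x)"
  have fX: "f x = F x" if "x \<in> X" for x using that V by (auto simp: f_def)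
  have fY: "f y = N y" if "y \<in> Y" for y using that by (simp add: f_def)
  have cross: "F x \<noteq> N y" if "x \<in> X" "y \<in> Y" for x y using sepX[OF that(1) that(1) that(2)] by auto
  have injF: "inj_on F X" "inj_on N Y" using F N by (auto simp: basic_drawing_def)
  have "inj_on f V"
  proof (rule inj_onI)
    fix x y assume xy: "x \<in> V" "y \<in> V" "f x = f y"
    then consider "x \<in> X" "y \<in> X" | "x \<in> Y" "y \<in> Y" | "x \<in> X" "y \<in> Y" | "x \<in> Y" "y \<in> X" using V by blast
    then show "x = y"
      by cases (use xy injF fX fY cross[of x y] cross[of y x] in \<open>auto dest: inj_onD\<close>)
  qed
  moreover have "basic_dir (f u - f v) \<and> (\<forall>w\<in>V - {u, v}. f w \<notin> closed_segment (f u) (f v))"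
    if e: "{u, v} \<in> E" for u v
  proof -
    have "u \<in> V" "v \<in> V" using simple_graph_edgeD[OF G e] by auto
    moreover have "\<not> (u \<in> X \<and> v \<in> Y)" "\<not> (u \<in> Y \<and> v \<in> X)"
      using no[of u v] no[of v u] e by (auto simp: insert_commute)
    ultimately consider "u \<in> X" "v \<in> X" | "u \<in> Y" "v \<in> Y" using V by blast
    then show ?thesis
    proof cases
      case 1
      then have "{u, v} \<in> ind E X" using e by (simp add: ind_def)
      then have "basic_dir (F u - F v)" "\<forall>w\<in>X - {u, v}. F w \<notin> closed_segment (F u) (F v)"
        using F by (auto simp: basic_drawing_def)
      then show ?thesis using fX fY 1 V sepX by auto
    next
      case 2
      then have "{u, v} \<in> ind E Y" using e by (simp add: ind_def)
      then have "basic_dir (N u - N v)" "\<forall>w\<in>Y - {u, v}. N w \<notin> closed_segment (N u) (N v)"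
        using N by (auto simp: basic_drawing_def)
      then show ?thesis using fX fY 2 V sepY by auto
    qed
  qed
  ultimately show ?thesis by (auto simp: basic_drawing_def)
qed

lemma perp_unique:
  fixes d :: "real \<times> real"
  assumes "d \<noteq> 0" "a *\<^sub>R d + b *\<^sub>R (- snd d, fst d) = a' *\<^sub>R d"
  shows "b = 0" "a = a'"
proof -
  have "rot d (a - a', b) = 0" using assms(2) by (simp add: rot_def algebra_simps)
  then have "(a - a', b) = 0" by (rule rot_eq_0[OF assms(1)])
  then show "b = 0" "a = a'" by (auto simp: zero_prod_def)
qed

lemma segment_from:
  fixes p d :: "real \<times> real"
  assumes "x \<in> closed_segment p (p + k *\<^sub>R d)" "0 \<le> k"
  shows "\<exists>t. 0 \<le> t \<and> t \<le> k \<and> x = p + t *\<^sub>R d"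
proof -
  obtain u where u: "0 \<le> u" "u \<le> 1" "x = (1 - u) *\<^sub>R p + u *\<^sub>R (p + k *\<^sub>R d)"
    using assms(1) by (auto simp: closed_segment_def)
  have "x = p + (u * k) *\<^sub>R d" using u(3) by (simp add: algebra_simps)
  moreover have "0 \<le> u * k" "u * k \<le> k" using u assms(2) by (auto intro: mult_left_le_one_le)
  ultimately show ?thesis by blast
qed

lemma in_segment_from:
  fixes p d :: "real \<times> real"
  assumes "0 \<le> t" "t \<le> k" "x = p + t *\<^sub>R d"
  shows "x \<in> closed_segment p (p + k *\<^sub>R d)"
proof (cases "k = 0")
  case True
  then show ?thesis using assms by simp
next
  case False
  then have k: "k > 0" using assms by simp
  have "x = (1 - t / k) *\<^sub>R p + (t / k) *\<^sub>R (p + k *\<^sub>R d)"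
    using assms(3) k by (simp add: algebra_simps)
  moreover have "0 \<le> t / k" "t / k \<le> 1" using assms k by auto
  ultimately show ?thesis by (auto simp: closed_segment_def)
qed

text \<open>If a point of the open segment from \<open>p\<close> to \<open>p + d\<close> lay on the
  segment from \<open>p\<close> to \<open>q\<close>, both would start in the same direction, and the
  shorter would end on the longer.\<close>

lemma segment_start:
  fixes p d q :: "real \<times> real"
  assumes q: "q \<notin> closed_segment p (p + d)" and d: "p + d \<notin> closed_segment p q"
    and t: "0 < t" "t < 1"
  shows "p + t *\<^sub>R d \<notin> closed_segment p q"
proof
  assume "p + t *\<^sub>R d \<in> closed_segment p q"
  then obtain u where u: "0 \<le> u" "u \<le> 1" "p + t *\<^sub>R d = (1 - u) *\<^sub>R p + u *\<^sub>R q"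
    by (auto simp: closed_segment_def)
  then have e: "t *\<^sub>R d = u *\<^sub>R (q - p)" by (simp add: algebra_simps)
  show False
  proof (cases "u = 0")
    case True
    then have "d = 0" using e t by simp
    then show False using d by simp
  next
    case False
    then have u0: "u > 0" using u by simp
    show False
    proof (cases "t \<le> u")
      case True
      have "(1 / u) *\<^sub>R (t *\<^sub>R d) = (1 / u) *\<^sub>R (u *\<^sub>R (q - p))" by (simp only: e)
      then have "q = p + (t / u) *\<^sub>R d" using u0 by (simp add: algebra_simps)
      then have "q \<in> closed_segment p (p + 1 *\<^sub>R d)"
        using True u0 t by (intro in_segment_from[of "t / u"]) auto
      then show False using q by simp
    next
      case F: False
      have "(1 / t) *\<^sub>R (t *\<^sub>R d) = (1 / t) *\<^sub>R (u *\<^sub>R (q - p))" by (simp only: e)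
      then have "p + d = p + (u / t) *\<^sub>R (q - p)" using t by simp
      then have "p + d \<in> closed_segment p (p + 1 *\<^sub>R (q - p))"
        using F u0 t by (intro in_segment_from[of "u / t"]) auto
      then show False using d by simp
    qed
  qed
qed

text \<open>The piece replaces a point in the interior of the drawn edge \<open>ac\<close>, scaled
  down so far that nothing else notices it; its terminals stay on the line of that edge and cut it
  into the two joining edges.\<close>

lemma insert_straight_piece:
  assumes G: "simple_graph V E" and V: "V = X \<union> Y" "X \<inter> Y = {}"
    and st: "straight E Y b d" and bd: "b \<in> Y" "d \<in> Y"
    and ac: "a \<in> X" "c \<in> X" "a \<noteq> c" "{a, c} \<notin> E"
    and cr: "\<And>x y. x \<in> X \<Longrightarrow> y \<in> Y \<Longrightarrow> {x, y} \<in> E \<longleftrightarrow> x = a \<and> y = b \<or> x = c \<and> y = d"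
    and F: "basic_drawing X (insert {a, c} (ind E X)) F"
  shows "\<exists>f. basic_drawing V E f"
proof -
  have fin: "finite X" "finite Y" using G V by (auto simp: simple_graph_def)
  obtain g where g: "basic_drawing Y (ind E Y) g" "snd (g b) = 0" "snd (g d) = 0"
    and gl: "\<And>y. y \<in> Y \<Longrightarrow> snd (g y) = 0 \<Longrightarrow> fst (g b) \<le> fst (g y) \<and> fst (g y) \<le> fst (g d)"
    using st by (auto simp: straight_def)
  define p \<delta> where "p = F a" and "\<delta> = F c - F a"
  have injF: "inj_on F X" using F by (simp add: basic_drawing_def)
  have \<delta>0: "\<delta> \<noteq> 0" using injF ac by (auto simp: \<delta>_def inj_on_def)
  have FE: "basic_dir (F u - F v)" "w \<in> X - {u, v} \<Longrightarrow> F w \<notin> closed_segment (F u) (F v)"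
    if "{u, v} \<in> insert {a, c} (ind E X)" for u v w
    using F[unfolded basic_drawing_def, THEN conjunct2, rule_format, OF that] by auto
  have "basic_dir (F a - F c)" by (rule FE(1)) simp
  then have \<delta>b: "basic_dir \<delta>" using basic_dir_minus_commute[of "F a" "F c"] by (simp add: \<delta>_def)
  have q: "F c = p + \<delta>" by (simp add: p_def \<delta>_def)
  have Fac: "F w \<notin> closed_segment p (p + \<delta>)" if "w \<in> X - {a, c}" for w
    using FE(2)[of a c w] that by (simp add: q p_def)
  have Fe: "F w \<notin> closed_segment (F x) (F y)" if "{x, y} \<in> E" "x \<in> X" "y \<in> X" "w \<in> X - {x, y}" for w x y
    using FE(2)[of x y w] that by (simp add: ind_def)
  define A where "A = {(x, y). {x, y} \<in> E \<and> x \<in> X \<and> y \<in> X}"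
  have finA: "finite A" by (rule finite_subset[of _ "X \<times> X"]) (use fin in \<open>auto simp: A_def\<close>)
  have lim: "((\<lambda>t. p + t *\<^sub>R \<delta>) \<longlongrightarrow> p) (at_right 0)"
  proof -
    have "((\<lambda>t. p + t *\<^sub>R \<delta>) \<longlongrightarrow> p + 0 *\<^sub>R \<delta>) (at_right 0)" by (intro tendsto_intros)
    then show ?thesis by simp
  qed
  \<comment> \<open>The point of insertion is taken close to \<open>a\<close>: edges not at
    \<open>a\<close> have positive distance from \<open>p\<close>, and those at \<open>a\<close> are
    treated by \<open>segment_start\<close>.\<close>
  have ev1: "eventually (\<lambda>t. p + t *\<^sub>R \<delta> \<notin> closed_segment (F x) (F y)) (at_right 0)" if xy: "(x, y) \<in> A" for x y
  proof (cases "a \<in> {x, y}")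
    case False
    then have "p \<in> - closed_segment (F x) (F y)" using Fe[of x y a] xy ac by (auto simp: A_def p_def)
    then have "eventually (\<lambda>t. p + t *\<^sub>R \<delta> \<in> - closed_segment (F x) (F y)) (at_right 0)"
      using topological_tendstoD[OF lim, of "- closed_segment (F x) (F y)"] by (simp add: open_Compl)
    then show ?thesis by simp
  next
    case True
    then obtain z where z: "{x, y} = {a, z}" "z \<in> X" "closed_segment (F x) (F y) = closed_segment p (F z)"
      using xy by (auto simp: A_def p_def closed_segment_commute insert_commute)
    have aE: "{a, z} \<in> E" using xy z(1) by (auto simp: A_def)
    have za: "z \<noteq> a" using simple_graph_edgeD[OF G aE] by auto
    have zc: "z \<noteq> c" using aE ac by auto
    have "p + t *\<^sub>R \<delta> \<notin> closed_segment p (F z)" if t: "0 < t" "t < 1" for t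
    proof (rule segment_start[OF _ _ t])
      show "F z \<notin> closed_segment p (p + \<delta>)" using Fac z za zc by auto
      show "p + \<delta> \<notin> closed_segment p (F z)"
        using Fe[OF aE ac(1) z(2), of c] zc ac q by (auto simp: p_def)
    qed
    then have "p + t *\<^sub>R \<delta> \<notin> closed_segment (F x) (F y)" if "0 < t" "t < 1" for t
      unfolding z(3) using that by blast
    then show ?thesis
      unfolding eventually_at_right_field by (intro exI[of _ 1]) auto
  qed
  have "eventually (\<lambda>t. \<forall>(x, y)\<in>A. p + t *\<^sub>R \<delta> \<notin> closed_segment (F x) (F y)) (at_right 0)"
    using ev1 by (intro eventually_ball_finite[OF finA]) auto
  moreover have "eventually (\<lambda>t. 0 < t \<and> t < 1) (at_right (0 :: real))"
    unfolding eventually_at_right_field by (intro exI[of _ 1]) auto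
  ultimately have "eventually (\<lambda>t. (\<forall>(x, y)\<in>A. p + t *\<^sub>R \<delta> \<notin> closed_segment (F x) (F y)) \<and> 0 < t \<and> t < 1) (at_right 0)"
    by (rule eventually_conj)
  then obtain \<eta> where \<eta>: "0 < \<eta>" "\<eta> < 1"
    and off: "\<And>x y. {x, y} \<in> E \<Longrightarrow> x \<in> X \<Longrightarrow> y \<in> X \<Longrightarrow> p + \<eta> *\<^sub>R \<delta> \<notin> closed_segment (F x) (F y)"
    using eventually_happens'[OF trivial_limit_at_right_real] unfolding A_def by blast
  define O' where "O' = p + \<eta> *\<^sub>R \<delta>"
  have OF: "O' \<noteq> F x" if x: "x \<in> X" for x
  proof
    assume eq: "O' = F x"
    have inseg: "O' \<in> closed_segment p (p + 1 *\<^sub>R \<delta>)"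
      by (rule in_segment_from[of \<eta>]) (use \<eta> in \<open>auto simp: O'_def\<close>)
    then have "x \<in> {a, c}" using Fac[of x] eq x by auto
    moreover have "x \<noteq> a" using eq \<eta> \<delta>0 by (auto simp: O'_def p_def)
    moreover have "x \<noteq> c"
    proof
      assume "x = c"
      then have "(1 - \<eta>) *\<^sub>R \<delta> = 0" using eq q by (simp add: O'_def algebra_simps)
      then show False using \<eta> \<delta>0 by simp
    qed
    ultimately show False by blast
  qed
  define N where "N = (\<lambda>\<epsilon> y. O' + \<epsilon> *\<^sub>R rot \<delta> (g y))"
  have Nlim: "((\<lambda>\<epsilon>. N \<epsilon> y) \<longlongrightarrow> O') (at_right 0)" for y
  proof -
    have "((\<lambda>\<epsilon>. N \<epsilon> y) \<longlongrightarrow> O' + 0 *\<^sub>R rot \<delta> (g y)) (at_right 0)" unfolding N_def by (intro tendsto_intros)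
    then show ?thesis by simp
  qed
  have e1: "eventually (\<lambda>\<epsilon>. \<forall>(x, x')\<in>A. \<forall>y\<in>Y. N \<epsilon> y \<notin> closed_segment (F x) (F x')) (at_right 0)"
  proof (rule eventually_ball_finite[OF finA], clarify)
    fix x x' assume xx: "(x, x') \<in> A"
    show "eventually (\<lambda>\<epsilon>. \<forall>y\<in>Y. N \<epsilon> y \<notin> closed_segment (F x) (F x')) (at_right 0)"
    proof (rule eventually_ball_finite[OF fin(2)], rule ballI)
      fix y
      have "O' \<in> - closed_segment (F x) (F x')" using off[of x x'] xx by (auto simp: A_def O'_def)
      then have "eventually (\<lambda>\<epsilon>. N \<epsilon> y \<in> - closed_segment (F x) (F x')) (at_right 0)"
        using topological_tendstoD[OF Nlim, of "- closed_segment (F x) (F x')"] by (simp add: open_Compl)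
      then show "eventually (\<lambda>\<epsilon>. N \<epsilon> y \<notin> closed_segment (F x) (F x')) (at_right 0)" by simp
    qed
  qed
  \<comment> \<open>An open ball that excludes \<open>F x\<close> is convex, so once it contains all
    of \<open>Y\<close>, no edge within the piece can pass through \<open>F x\<close>.\<close>
  have e2: "eventually (\<lambda>\<epsilon>. \<forall>x\<in>X. \<forall>y\<in>Y. N \<epsilon> y \<in> ball O' (dist O' (F x))) (at_right 0)"
  proof (rule eventually_ball_finite[OF fin(1)], rule ballI)
    fix x assume x: "x \<in> X"
    show "eventually (\<lambda>\<epsilon>. \<forall>y\<in>Y. N \<epsilon> y \<in> ball O' (dist O' (F x))) (at_right 0)"
    proof (rule eventually_ball_finite[OF fin(2)], rule ballI)
      fix y
      show "eventually (\<lambda>\<epsilon>. N \<epsilon> y \<in> ball O' (dist O' (F x))) (at_right 0)"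
        by (rule topological_tendstoD[OF Nlim]) (use OF[OF x] in auto)
    qed
  qed
  have e3: "eventually (\<lambda>\<epsilon>. 0 < \<eta> + \<epsilon> * fst (g b)) (at_right 0)"
  proof -
    have "((\<lambda>\<epsilon>. \<eta> + \<epsilon> * fst (g b)) \<longlongrightarrow> \<eta> + 0 * fst (g b)) (at_right 0)" by (intro tendsto_intros)
    then show ?thesis using order_tendstoD(1)[of _ "\<eta> + 0 * fst (g b)" "at_right 0" 0] \<eta> by simp
  qed
  have e4: "eventually (\<lambda>\<epsilon>. \<eta> + \<epsilon> * fst (g d) < 1) (at_right 0)"
  proof -
    have "((\<lambda>\<epsilon>. \<eta> + \<epsilon> * fst (g d)) \<longlongrightarrow> \<eta> + 0 * fst (g d)) (at_right 0)" by (intro tendsto_intros)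
    then show ?thesis using order_tendstoD(2)[of _ "\<eta> + 0 * fst (g d)" "at_right 0" 1] \<eta> by simp
  qed
  have e5: "eventually (\<lambda>\<epsilon>. 0 < \<epsilon>) (at_right (0 :: real))" by (rule eventually_at_right_less)
  obtain \<epsilon> where \<epsilon>: "0 < \<epsilon>" "0 < \<eta> + \<epsilon> * fst (g b)" "\<eta> + \<epsilon> * fst (g d) < 1"
    and sepX: "\<forall>(x, x')\<in>A. \<forall>y\<in>Y. N \<epsilon> y \<notin> closed_segment (F x) (F x')"
    and near: "\<forall>x\<in>X. \<forall>y\<in>Y. N \<epsilon> y \<in> ball O' (dist O' (F x))"
    using eventually_happens'[OF _ eventually_conj[OF e1 eventually_conj[OF e2 eventually_conj[OF e3 eventually_conj[OF e4 e5]]]]]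
    by auto
  define n where "n = N \<epsilon>"
  have bdle: "fst (g b) \<le> fst (g d)" using gl[OF bd(2) g(3)] by simp
  have sepY: "F x \<notin> closed_segment (n y) (n y')" if "x \<in> X" "y \<in> Y" "y' \<in> Y" for x y y'
  proof
    assume "F x \<in> closed_segment (n y) (n y')"
    moreover have "closed_segment (n y) (n y') \<subseteq> ball O' (dist O' (F x))"
      by (rule closed_segment_subset) (use near that in \<open>auto simp: n_def\<close>)
    ultimately have "F x \<in> ball O' (dist O' (F x))" by blast
    then show False by simp
  qed
  have neq: "n = (\<lambda>y. O' + rot (\<epsilon> *\<^sub>R \<delta>) (g y))"
    by (auto simp: n_def N_def rot_def algebra_simps prod_eq_iff)
  have nD: "basic_drawing Y (ind E Y) n"
    unfolding neq
  proof (rule basic_drawing_transform[OF g(1)])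
    show "\<epsilon> *\<^sub>R \<delta> \<noteq> 0" using \<epsilon> \<delta>0 by simp
    show "basic_dir (\<epsilon> *\<^sub>R \<delta>)" using \<delta>b by (auto simp: basic_dir_def)
  qed
  have np: "n y = p + ((\<eta> + \<epsilon> * fst (g y)) *\<^sub>R \<delta> + (\<epsilon> * snd (g y)) *\<^sub>R (- snd \<delta>, fst \<delta>))" for y
    by (simp add: n_def N_def O'_def rot_def algebra_simps prod_eq_iff)
  define \<beta> where "\<beta> = \<eta> + \<epsilon> * fst (g b)"
  define \<gamma> where "\<gamma> = \<eta> + \<epsilon> * fst (g d)"
  have nb: "n b = p + \<beta> *\<^sub>R \<delta>" "n d = p + \<gamma> *\<^sub>R \<delta>" using np[of b] np[of d] g by (auto simp: \<beta>_def \<gamma>_def zero_prod_def)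
  have bg: "0 < \<beta>" "\<beta> \<le> \<gamma>" "\<gamma> < 1" using \<epsilon> bdle by (auto simp: \<beta>_def \<gamma>_def)
  \<comment> \<open>The only vertices of the piece on the line of \<open>ac\<close> lie between its
    terminals, so the two joining edges meet none of them besides the terminals.\<close>
  have online: "\<beta> \<le> t \<and> t \<le> \<gamma> \<and> (t = \<beta> \<longrightarrow> y = b) \<and> (t = \<gamma> \<longrightarrow> y = d)"
    if y: "y \<in> Y" "n y = p + t *\<^sub>R \<delta>" for y t
  proof -
    have eq: "(\<eta> + \<epsilon> * fst (g y)) *\<^sub>R \<delta> + (\<epsilon> * snd (g y)) *\<^sub>R (- snd \<delta>, fst \<delta>) = t *\<^sub>R \<delta>"
      using y(2) np[of y] by simp
    have s: "snd (g y) = 0" "t = \<eta> + \<epsilon> * fst (g y)" using perp_unique[OF \<delta>0 eq] \<epsilon> by auto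
    have inj: "inj_on n Y" using nD by (simp add: basic_drawing_def)
    have "t = \<beta> \<Longrightarrow> y = b" "t = \<gamma> \<Longrightarrow> y = d"
      using inj_onD[OF inj, of y b] inj_onD[OF inj, of y d] y nb bd by simp_all
    moreover have "\<beta> \<le> t" "t \<le> \<gamma>" using gl[OF y(1) s(1)] s(2) \<epsilon>(1) by (simp_all add: \<beta>_def \<gamma>_def)
    ultimately show ?thesis by blast
  qed
  define f where "f = (\<lambda>x. if x \<in> Y then n x else F x)"
  have fX: "f x = F x" if "x \<in> X" for x using that V by (auto simp: f_def)
  have fY: "f y = n y" if "y \<in> Y" for y using that by (simp add: f_def)
  have cross: "F x \<noteq> n y" if "x \<in> X" "y \<in> Y" for x y using sepY[OF that that(2)] by auto
  have injn: "inj_on n Y" using nD by (simp add: basic_drawing_def)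
  have "inj_on f V"
  proof (rule inj_onI)
    fix x y assume xy: "x \<in> V" "y \<in> V" "f x = f y"
    then consider "x \<in> X" "y \<in> X" | "x \<in> Y" "y \<in> Y" | "x \<in> X" "y \<in> Y" | "x \<in> Y" "y \<in> X" using V by blast
    then show "x = y"
      by cases (use xy injF injn fX fY cross[of x y] cross[of y x] in \<open>auto dest: inj_onD\<close>)
  qed
  moreover have "basic_dir (f u - f v) \<and> (\<forall>w\<in>V - {u, v}. f w \<notin> closed_segment (f u) (f v))"
    if e: "{u, v} \<in> E" for u v
  proof -
    have ab: "basic_dir (F a - n b) \<and> (\<forall>w\<in>V - {a, b}. f w \<notin> closed_segment (F a) (n b))"
    proof (intro conjI ballI notI)
      show "basic_dir (F a - n b)" using \<delta>b by (auto simp: nb p_def[symmetric] basic_dir_def)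
      fix w assume w: "w \<in> V - {a, b}" "f w \<in> closed_segment (F a) (n b)"
      then obtain t where t: "0 \<le> t" "t \<le> \<beta>" "f w = p + t *\<^sub>R \<delta>"
        using segment_from[of "f w" p \<beta> \<delta>] bg by (auto simp: nb p_def)
      show False
      proof (cases "w \<in> Y")
        case True
        then show False using online[of w t] t fY w by auto
      next
        case False
        then have wX: "w \<in> X" using w V by auto
        have "F w \<in> closed_segment p (p + 1 *\<^sub>R \<delta>)"
          by (rule in_segment_from[of t]) (use t bg fX[OF wX] in auto)
        then have "w = c" using Fac[of w] w wX by auto
        then have "(1 - t) *\<^sub>R \<delta> = 0" using t(3) q fX[OF wX] by (simp add: algebra_simps)
        then show False using t bg \<delta>0 by simp
      qed
    qed
    have cd: "basic_dir (F c - n d) \<and> (\<forall>w\<in>V - {c, d}. f w \<notin> closed_segment (F c) (n d))"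
    proof (intro conjI ballI notI)
      have "F c - n d = (1 - \<gamma>) *\<^sub>R \<delta>" by (simp add: nb q algebra_simps)
      then show "basic_dir (F c - n d)" using \<delta>b by (auto simp: basic_dir_def)
      fix w assume w: "w \<in> V - {c, d}" "f w \<in> closed_segment (F c) (n d)"
      have "F c = n d + (1 - \<gamma>) *\<^sub>R \<delta>" by (simp add: nb q algebra_simps)
      then obtain s where s: "0 \<le> s" "s \<le> 1 - \<gamma>" "f w = n d + s *\<^sub>R \<delta>"
        using segment_from[of "f w" "n d" "1 - \<gamma>" \<delta>] w bg by (auto simp: closed_segment_commute)
      define t where "t = \<gamma> + s"
      have t: "\<gamma> \<le> t" "t \<le> 1" "f w = p + t *\<^sub>R \<delta>" using s by (auto simp: t_def nb algebra_simps)
      show False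
      proof (cases "w \<in> Y")
        case True
        then show False using online[of w t] t fY w by auto
      next
        case False
        then have wX: "w \<in> X" using w V by auto
        have "F w \<in> closed_segment p (p + 1 *\<^sub>R \<delta>)"
          by (rule in_segment_from[of t]) (use t bg fX[OF wX] in auto)
        then have "w = a" using Fac[of w] w wX by auto
        then have "t *\<^sub>R \<delta> = 0" using t(3) fX[OF wX] by (simp add: p_def)
        then show False using t bg \<delta>0 by simp
      qed
    qed
    have uv: "u \<in> V" "v \<in> V" using simple_graph_edgeD[OF G e] by auto
    then consider "u \<in> X" "v \<in> X" | "u \<in> Y" "v \<in> Y" | "u \<in> X" "v \<in> Y" | "u \<in> Y" "v \<in> X" using V by blast
    then show ?thesis
    proof cases
      case 1
      then have "{u, v} \<in> ind E X" using e by (simp add: ind_def)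
      then have "basic_dir (F u - F v)" "\<forall>w\<in>X - {u, v}. F w \<notin> closed_segment (F u) (F v)"
        using F by (auto simp: basic_drawing_def)
      moreover have "n w \<notin> closed_segment (F u) (F v)" if "w \<in> Y" for w
        using sepX 1 e that by (auto simp: A_def n_def)
      ultimately show ?thesis using fX fY 1 V by auto
    next
      case 2
      then have "{u, v} \<in> ind E Y" using e by (simp add: ind_def)
      then have "basic_dir (n u - n v)" "\<forall>w\<in>Y - {u, v}. n w \<notin> closed_segment (n u) (n v)"
        using nD by (auto simp: basic_drawing_def)
      then show ?thesis using fX fY 2 V sepY by auto
    next
      case 3
      then have "u = a \<and> v = b \<or> u = c \<and> v = d" using cr e by blast
      then show ?thesis using ab cd fX fY 3 by auto
    next
      case 4
      then have "v = a \<and> u = b \<or> v = c \<and> u = d" using cr[of v u] e by (simp add: insert_commute)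
      then show ?thesis using ab cd fX fY 4
        by (auto simp: closed_segment_commute insert_commute basic_dir_minus_commute)
    qed
  qed
  ultimately have "basic_drawing V E f" by (simp add: basic_drawing_def)
  then show ?thesis by blast
qed

lemma recolouring_exists:
  assumes "s \<noteq> t"
  shows "\<exists>\<pi> :: dir \<Rightarrow> dir. inj \<pi> \<and> \<pi> s = Dh \<and> \<pi> t = Dv"
proof -
  define \<tau> where "\<tau> = (\<lambda>p q x :: dir. if x = p then q else if x = q then p else x)"
  have inj: "inj (\<tau> p q)" for p q by (auto simp: inj_def \<tau>_def split: if_splits)
  \<comment> \<open>After the first transposition the image of \<open>t\<close> is not
    \<open>Dh\<close>, so the second one, which sends it to \<open>Dv\<close>, leaves
    \<open>Dh\<close> fixed.\<close>
  have "\<tau> s Dh t \<noteq> Dh" using assms by (auto simp: \<tau>_def)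
  then have "(\<tau> (\<tau> s Dh t) Dv \<circ> \<tau> s Dh) s = Dh" by (auto simp: \<tau>_def)
  moreover have "(\<tau> (\<tau> s Dh t) Dv \<circ> \<tau> s Dh) t = Dv" by (auto simp: \<tau>_def)
  ultimately show ?thesis using inj_compose[OF inj inj] by blast
qed

subsection \<open>Vertex sets left by two edges\<close>

lemma cut_complement:
  assumes "simple_graph V E" "S \<subseteq> V"
  shows "cut E (V - S) = cut E S"
proof -
  have "(e \<inter> (V - S) \<noteq> {} \<and> \<not> e \<subseteq> V - S) = (e \<inter> S \<noteq> {} \<and> \<not> e \<subseteq> S)" if "e \<in> E" for e
  proof -
    have "e \<subseteq> V" using assms(1) that by (simp add: simple_graph_def)
    then show ?thesis using assms(2) by blast
  qed
  then show ?thesis unfolding cut_def by (intro Collect_cong) metis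
qed

text \<open>The inner ends are \<open>b\<close> and \<open>d\<close>, the outer ends
  \<open>a\<close> and \<open>c\<close>. Either pair may coincide, but not both, as the two edges
  differ. The complement of \<open>Y\<close> is again of this form.\<close>

locale two_edge_cut =
  fixes V :: "'a set" and E :: "'a set set" and Y :: "'a set" and a b c d :: 'a
  assumes cubic: "cubic_graph V E" and YV: "Y \<subseteq> V"
    and cutY: "cut E Y = {{a, b}, {c, d}}" and two: "{a, b} \<noteq> {c, d}"
    and ends: "b \<in> Y" "d \<in> Y" and ac: "a \<notin> Y" "c \<notin> Y"
begin

lemma G: "simple_graph V E" using cubic by (simp add: cubic_graph_def)

lemma finY: "finite Y" using G YV finite_subset by (auto simp: simple_graph_def)

lemma card_nb: "x \<in> V \<Longrightarrow> card (nb E x) = 3"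
  using cubic vertex_degree_nb[OF G] by (auto simp: cubic_graph_def)

lemma abE: "{a, b} \<in> E" and cdE: "{c, d} \<in> E"
  using cutY by (auto simp: cut_def)

lemma outside: "a \<in> V" "c \<in> V"
  using simple_graph_edgeD[OF G abE] simple_graph_edgeD[OF G cdE] by auto

lemma leaving:
  assumes "{x, y} \<in> E" "x \<in> Y" "y \<notin> Y"
  shows "y = a \<and> x = b \<or> y = c \<and> x = d"
proof -
  have "{x, y} \<in> cut E Y" using assms by (auto simp: cut_def)
  then have "{x, y} = {a, b} \<or> {x, y} = {c, d}" by (simp add: cutY)
  then show ?thesis using assms ends ac by (auto simp: doubleton_eq_iff)
qed

lemma complement: "two_edge_cut V E (V - Y) b a d c"
proof
  have "cut E (V - Y) = {{a, b}, {c, d}}" using cut_complement[OF G YV] cutY by simp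
  then show "cut E (V - Y) = {{b, a}, {d, c}}" by (simp add: insert_commute)
  show "{b, a} \<noteq> {d, c}" using two by (simp add: insert_commute)
qed (use cubic ends ac outside in auto)

lemma nb_closure:
  assumes bdE: "b \<noteq> d" "{b, d} \<notin> E" and x: "x \<in> Y"
  shows "nb (insert {b, d} (ind E Y)) x =
    (nb E x \<inter> Y) \<union> (if x = b then {d} else if x = d then {b} else {})"
  using x ends by (auto simp: nb_def ind_def doubleton_eq_iff)

lemma nb_terminal_outside:
  assumes "b \<noteq> d"
  shows "nb E b - Y = {a}" "nb E d - Y = {c}"
proof -
  have "{b, a} \<in> E" "{d, c} \<in> E" using abE cdE by (simp_all add: insert_commute)
  moreover have "y = a" if "{b, y} \<in> E" "y \<notin> Y" for y using leaving[OF that(1) ends(1) that(2)] assms by auto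
  moreover have "y = c" if "{d, y} \<in> E" "y \<notin> Y" for y using leaving[OF that(1) ends(2) that(2)] assms by auto
  ultimately show "nb E b - Y = {a}" "nb E d - Y = {c}" using ac unfolding nb_def by blast+
qed

text \<open>The inner ends lose one outside neighbour each and gain each other; non-adjacency makes
  this a new edge.\<close>

lemma closure_cubic:
  assumes bdE: "b \<noteq> d" "{b, d} \<notin> E"
  shows "cubic_graph Y (insert {b, d} (ind E Y))"
proof -
  let ?H = "insert {b, d} (ind E Y)"
  have GH: "simple_graph Y ?H" using G finY ends bdE(1) by (auto simp: simple_graph_def ind_def)
  have "card (nb ?H x) = 3" if x: "x \<in> Y" for x
  proof -
    have fin: "finite (nb E x)" by (rule finite_nb[OF G])
    have c3: "card (nb E x) = 3" using card_nb x YV by auto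
    have split: "card (nb E x) = card (nb E x \<inter> Y) + card (nb E x - Y)"
      using fin by (subst card_Un_disjoint[symmetric]) (auto intro: arg_cong[of _ _ card])
    show ?thesis
    proof (cases "x = b \<or> x = d")
      case True
      then have "card (nb E x - Y) = 1" using nb_terminal_outside[OF bdE(1)] by auto
      moreover have "d \<notin> nb E b" "b \<notin> nb E d" using bdE by (auto simp: nb_def insert_commute)
      ultimately show ?thesis using True split c3 fin ends bdE(1) unfolding nb_closure[OF bdE x] by auto
    next
      case False
      then have "nb E x - Y = {}" using leaving[OF _ x] by (auto simp: nb_def)
      then have "nb E x \<inter> Y = nb E x" by auto
      then show ?thesis using False c3 unfolding nb_closure[OF bdE x] by simp
    qed
  qed
  then show ?thesis using GH vertex_degree_nb[OF GH] by (simp add: cubic_graph_def)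
qed

end

text \<open>The condition on proper subsets takes over the role of three-edge-connectivity within
  the piece.\<close>

locale minimal_piece = two_edge_cut +
  assumes ends_neq: "b \<noteq> d"
    and min: "\<And>S. S \<subseteq> Y \<Longrightarrow> S \<noteq> {} \<Longrightarrow> S \<noteq> Y \<Longrightarrow> 3 \<le> card (cut E S)"
begin

lemmas bd = ends ends_neq

lemma nb_outside: "x \<in> Y \<Longrightarrow> card (nb E x - Y) \<le> 1"
proof -
  assume x: "x \<in> Y"
  have "nb E x - Y \<subseteq> (if x = b then {a} else {c})"
    using leaving[OF _ x] bd by (auto simp: nb_def)
  then have "card (nb E x - Y) \<le> card (if x = b then {a} else {c})" by (intro card_mono) auto
  then show ?thesis by (simp split: if_splits)
qed

lemma inner_neighbour:
  assumes "x \<in> Y"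
  shows "\<exists>z. {x, z} \<in> E \<and> z \<in> Y \<and> z \<noteq> y"
proof (rule ccontr)
  assume "\<not> ?thesis"
  then have "nb E x \<subseteq> insert y (nb E x - Y)" by (auto simp: nb_def)
  then have "card (nb E x) \<le> card (insert y (nb E x - Y))"
    using finite_nb[OF G] by (intro card_mono) auto
  also have "\<dots> \<le> Suc (card (nb E x - Y))" by (rule card_insert_le_m1) simp_all
  finally show False using nb_outside[OF assms] card_nb[of x] YV assms by auto
qed

text \<open>The two leaving edges are kept as pendant edges, so that their directions take part in
  the colouring and in the stresses.\<close>

definition E' where "E' = {e \<in> E. e \<inter> Y \<noteq> {}}"

definition V' where "V' = insert a (insert c Y)"

lemma G': "simple_graph V' E'"
  unfolding simple_graph_def
proof (intro conjI ballI)
  show "finite V'" using finY by (simp add: V'_def)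
  fix e assume e: "e \<in> E'"
  then obtain x where x: "x \<in> e" "x \<in> Y" "e \<in> E" by (auto simp: E'_def)
  then obtain y where y: "e = {x, y}" using simple_graph_edgeE[OF G] by metis
  show "e \<subseteq> V'" using leaving[of x y] x y by (auto simp: V'_def)
  show "card e = 2" using G x by (auto simp: simple_graph_def)
qed

lemma nb_E': "x \<in> Y \<Longrightarrow> nb E' x = nb E x"
  by (auto simp: nb_def E'_def)

lemma nb_terminals:
  assumes "a \<noteq> c"
  shows "nb E' a = {b}" "nb E' c = {d}"
proof -
  have "x = b" if "{a, x} \<in> E" "x \<in> Y" for x
    using leaving[of x a] that ac assms by (auto simp: insert_commute)
  moreover have "x = d" if "{c, x} \<in> E" "x \<in> Y" for x
    using leaving[of x c] that ac assms by (auto simp: insert_commute)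
  moreover have "x \<in> nb E' y \<longleftrightarrow> {y, x} \<in> E \<and> x \<in> Y" if "y \<notin> Y" for x y
    using that by (auto simp: nb_def E'_def)
  ultimately show "nb E' a = {b}" "nb E' c = {d}"
    using abE cdE ac bd by (metis empty_iff insert_iff subsetI subset_antisym)+
qed

lemma card_nb_E':
  assumes "a \<noteq> c" "x \<in> V'"
  shows "card (nb E' x) \<le> 3"
  using assms nb_terminals[OF assms(1)] nb_E'[of x] card_nb[of x] YV by (auto simp: V'_def)

text \<open>Greedy colouring with four colours fails only for an edge set in which every edge meets
  four others. Such a set uses all three edges at each of its vertices, so it avoids the pendant
  ends and its vertex set has an empty cut. A permutation of the directions then gives the two
  prescribed ones.\<close>

lemma ex_colouring:
  assumes neq: "a \<noteq> c"
  shows "\<exists>\<kappa> :: 'a set \<Rightarrow> dir. proper E' \<kappa> \<and> \<kappa> {a, b} = Dh \<and> \<kappa> {c, d} = Dv"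
proof -
  let ?C = "UNIV :: dir set"
  have C: "finite ?C" "card ?C = 4" by (simp_all add: UNIV_dir)
  have finE: "finite E'" by (rule finite_edges[OF G'])
  have deg: "card {e \<in> E'. x \<in> e} = card (nb E' x)" for x
    using vertex_degree_nb[OF G', of x] by (simp add: vertex_degree_def)
  have sparse: "\<exists>e\<in>F. card {e' \<in> F. e' \<noteq> e \<and> e' \<inter> e \<noteq> {}} < card ?C" if F: "F \<subseteq> E'" "F \<noteq> {}" for F
  proof (rule ccontr)
    assume no: "\<not> ?thesis"
    have finF: "finite F" using finE F finite_subset by blast
    have le3: "card {e \<in> F. x \<in> e} \<le> 3" if x: "x \<in> V'" for x
    proof -
      have "card {e \<in> F. x \<in> e} \<le> card {e \<in> E'. x \<in> e}" using F finE by (intro card_mono) auto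
      then show ?thesis using deg card_nb_E'[OF neq x] by simp
    qed
    have full: "card {e \<in> F. x \<in> e} = 3" if e: "e \<in> F" and x: "x \<in> e" for x e
    proof (rule ccontr)
      assume ne: "card {e \<in> F. x \<in> e} \<noteq> 3"
      have eE: "e \<in> E'" using e F by auto
      obtain y where y: "e = {x, y}" "y \<noteq> x" "x \<in> V'" "y \<in> V'" using simple_graph_edgeE[OF G' eE x] by metis
      have "{e' \<in> F. e' \<noteq> e \<and> e' \<inter> e \<noteq> {}} \<subseteq> ({e \<in> F. x \<in> e} - {e}) \<union> ({e \<in> F. y \<in> e} - {e})"
        using y by auto
      then have "card {e' \<in> F. e' \<noteq> e \<and> e' \<inter> e \<noteq> {}} \<le> card (({e \<in> F. x \<in> e} - {e}) \<union> ({e \<in> F. y \<in> e} - {e}))"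
        using finF by (intro card_mono) auto
      also have "\<dots> \<le> card ({e \<in> F. x \<in> e} - {e}) + card ({e \<in> F. y \<in> e} - {e})" by (rule card_Un_le)
      also have "\<dots> = (card {e \<in> F. x \<in> e} - 1) + (card {e \<in> F. y \<in> e} - 1)"
        using e y finF by simp
      also have "\<dots> < 4" using le3[OF y(3)] le3[OF y(4)] ne by linarith
      finally show False using no e C by auto
    qed
    define T where "T = \<Union>F"
    have Tfull: "card {e \<in> F. x \<in> e} = 3" if "x \<in> T" for x using full that by (auto simp: T_def)
    have TV: "T \<subseteq> V'" using F G' by (auto simp: T_def simple_graph_def)
    have sub: "card {e \<in> F. x \<in> e} \<le> card (nb E' x)" for x
      unfolding deg[symmetric] using F finE by (intro card_mono) auto
    have "a \<notin> T" "c \<notin> T" using sub[of a] sub[of c] Tfull[of a] Tfull[of c] nb_terminals[OF neq] by auto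
    then have TY: "T \<subseteq> Y" using TV by (auto simp: V'_def)
    have "cut E T = {}"
    proof (rule ccontr)
      assume "cut E T \<noteq> {}"
      then obtain e x where e: "e \<in> E" "x \<in> e" "x \<in> T" "\<not> e \<subseteq> T" by (auto simp: cut_def)
      have xY: "x \<in> Y" using e TY by auto
      have "{e \<in> F. x \<in> e} = {e \<in> E'. x \<in> e}"
        by (rule card_subset_eq) (use F finE Tfull[OF e(3)] deg nb_E'[OF xY] card_nb[of x] xY YV in auto)
      moreover have "e \<in> E'" using e xY by (auto simp: E'_def)
      ultimately have "e \<in> F" using e by auto
      then show False using e by (auto simp: T_def)
    qed
    moreover have "T \<noteq> {}"
    proof -
      obtain e where "e \<in> F" using F by auto
      then have "e \<noteq> {}" "e \<subseteq> T" using F by (auto simp: E'_def T_def)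
      then show ?thesis by auto
    qed
    ultimately show False using min[OF TY] cutY by (cases "T = Y") auto
  qed
  obtain \<kappa> :: "'a set \<Rightarrow> dir" where \<kappa>: "\<forall>e\<in>E'. \<forall>e'\<in>E'. e \<noteq> e' \<and> e \<inter> e' \<noteq> {} \<longrightarrow> \<kappa> e \<noteq> \<kappa> e'"
    using degenerate_edge_colouring[OF finE C(1) sparse] by auto
  \<comment> \<open>As \<open>a\<close> is a pendant end, only two edges meet \<open>{a, b}\<close>.
    Together with \<open>{c, d}\<close> they forbid at most three of the four colours, so
    \<open>{a, b}\<close> can be made different from \<open>{c, d}\<close>.\<close>
  let ?B = "{e \<in> E'. b \<in> e} - {{a, b}}"
  have abE': "{a, b} \<in> E'" "{c, d} \<in> E'" using abE cdE bd by (auto simp: E'_def)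
  have "card ?B = 2" using deg[of b] nb_E'[OF bd(1)] card_nb[of b] bd YV abE' finE by auto
  then have "card (\<kappa> ` ?B) \<le> 2" using card_image_le[of ?B \<kappa>] finE by simp
  then have "card (insert (\<kappa> {c, d}) (\<kappa> ` ?B)) < 4"
    using finE by (simp add: card_insert_if)
  then have "insert (\<kappa> {c, d}) (\<kappa> ` ?B) \<noteq> ?C" using C by auto
  then obtain s where s: "s \<noteq> \<kappa> {c, d}" "s \<notin> \<kappa> ` ?B" by auto
  define \<kappa>' where "\<kappa>' = \<kappa>({a, b} := s)"
  have touch: "e \<in> ?B" if e: "e \<in> E'" "e \<noteq> {a, b}" "e \<inter> {a, b} \<noteq> {}" for e
  proof -
    have "b \<in> e"
    proof (rule ccontr)
      assume nb: "b \<notin> e"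
      then have "a \<in> e" using e by auto
      then obtain y where y: "e = {a, y}" using simple_graph_edgeE[OF G' e(1)] by metis
      then have "y \<in> nb E' a" using e by (simp add: nb_def)
      then show False using nb_terminals(1)[OF neq] nb y by auto
    qed
    then show ?thesis using e by auto
  qed
  have "{c, d} \<noteq> {a, b}" using neq ac bd by (auto simp: doubleton_eq_iff)
  then have k1: "\<kappa>' {a, b} = s" "\<kappa>' {c, d} = \<kappa> {c, d}" by (auto simp: \<kappa>'_def)
  have k2: "\<kappa>' e \<noteq> \<kappa>' e'" if e: "e \<in> E'" "e' \<in> E'" "e \<noteq> e'" "e \<inter> e' \<noteq> {}" for e e'
  proof -
    consider "e = {a, b}" "e' \<noteq> {a, b}" | "e' = {a, b}" "e \<noteq> {a, b}" | "e \<noteq> {a, b}" "e' \<noteq> {a, b}" using e(3) by blast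
    then show ?thesis
    proof cases
      case 1
      then have "e' \<in> ?B" using touch[of e'] e by (simp add: Int_commute)
      then have "s \<noteq> \<kappa> e'" using s(2) by blast
      then show ?thesis using 1 by (simp add: \<kappa>'_def)
    next
      case 2
      then have "e \<in> ?B" using touch[of e] e by simp
      then have "s \<noteq> \<kappa> e" using s(2) by blast
      then show ?thesis using 2 by (simp add: \<kappa>'_def)
    next
      case 3
      then show ?thesis using \<kappa> e by (simp add: \<kappa>'_def)
    qed
  qed
  obtain \<pi> :: "dir \<Rightarrow> dir" where \<pi>: "inj \<pi>" "\<pi> s = Dh" "\<pi> (\<kappa> {c, d}) = Dv" using recolouring_exists[OF s(1)] by blast
  have "proper E' (\<pi> \<circ> \<kappa>')" by (rule properI) (use k2 \<pi>(1) in \<open>auto dest: injD\<close>)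
  then show ?thesis using k1 \<pi> by (intro exI[of _ "\<pi> \<circ> \<kappa>'"]) simp
qed

text \<open>The counting is that of \<open>no_dead_vertex\<close>, with the pendant ends dead from
  the start. The cut bound for \<open>insert w S\<close> is lost only when this set is all of
  \<open>Y\<close>; then both leaving edges must start at \<open>w\<close> or be \<open>uv\<close>,
  which are the two excluded incidences.\<close>

lemma no_stress:
  assumes neq: "a \<noteq> c" and pr: "proper E' \<kappa>" and e: "{u, v} \<in> E'" and w: "w \<in> Y - {u, v}"
    and ex: "\<not> ({u, v} = {a, b} \<and> w = d)" "\<not> ({u, v} = {c, d} \<and> w = b)"
  shows "\<not> stress V' E' \<kappa> u v w \<omega>"
proof
  assume \<omega>: "stress V' E' \<kappa> u v w \<omega>"
  have dead: "\<omega> x z = 0" if "x \<in> V'" "x \<noteq> w" "y \<in> nb E' x" "\<omega> x y = 0" "z \<in> nb E' x" for x y z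
    by (rule dead_vertex[where E = E' and y = y and \<kappa> = \<kappa>])
      (use \<omega> that finite_nb[OF G'] card_nb_E'[OF neq that(1)] pr in \<open>auto simp: stress_def\<close>)
  define D where "D = {x \<in> V' - {w}. \<forall>y\<in>nb E' x. \<omega> x y = 0}"
  have wac: "w \<noteq> a" "w \<noteq> c" using w ac by auto
  have bal: "(\<Sum>y\<in>nb E' z. \<omega> z y *\<^sub>R nrm (\<kappa> {z, y})) = 0" if "z \<in> V'" "z \<noteq> w" for z
    using \<omega> that by (auto simp: stress_def)
  \<comment> \<open>A single force in equilibrium is zero.\<close>
  have "a \<in> D" "c \<in> D"
    using bal[of a] bal[of c] wac nb_terminals[OF neq] by (auto simp: D_def V'_def)
  define S where "S = V' - {w} - D"
  have SY: "S \<subseteq> Y" using \<open>a \<in> D\<close> \<open>c \<in> D\<close> by (auto simp: S_def V'_def)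
  have EE': "{x, y} \<in> E'" if "{x, y} \<in> E" "x \<in> Y" for x y using that by (auto simp: E'_def)
  have out: "{x, y} = {u, v}" if xy: "{x, y} \<in> E" "x \<in> S" "y \<notin> S" "y \<noteq> w" for x y
  proof (rule ccontr)
    assume ne: "{x, y} \<noteq> {u, v}"
    have xyE: "{x, y} \<in> E'" using EE' xy SY by auto
    have "y \<in> D" using xy simple_graph_edgeD[OF G' xyE] by (auto simp: S_def)
    moreover have "x \<in> nb E' y" "y \<in> nb E' x" using xyE by (auto simp: nb_def insert_commute)
    ultimately have "\<omega> y x = 0" by (simp add: D_def)
    then have "\<omega> x y = 0" using \<omega> xyE ne by (auto simp: stress_def)
    then have "x \<in> D" using dead[of x y] xy(2) \<open>y \<in> nb E' x\<close> by (auto simp: D_def S_def)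
    then show False using xy by (auto simp: S_def)
  qed
  have "S \<noteq> {}"
  proof
    assume "S = {}"
    moreover have "u \<in> V'" "v \<in> V'" using simple_graph_edgeD[OF G' e] by auto
    ultimately have "u \<in> D" "v \<in> D" using w by (auto simp: S_def)
    then have "\<omega> u v = 0" "\<omega> v u = 0" using e by (auto simp: D_def nb_def insert_commute)
    then show False using \<omega> by (simp add: stress_def)
  qed
  have wS: "w \<notin> S" by (simp add: S_def)
  have fin: "finite (nb E w)" by (rule finite_nb[OF G])
  have inj: "inj_on (\<lambda>x. {w, x}) A" for A by (auto simp: inj_on_def doubleton_eq_iff)
  have "cut E S \<subseteq> insert {u, v} ((\<lambda>x. {w, x}) ` (nb E w \<inter> S))"
  proof
    fix f assume f: "f \<in> cut E S"
    then obtain x where x: "x \<in> f" "x \<in> S" "f \<in> E" by (auto simp: cut_def)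
    then obtain y where y: "f = {x, y}" using simple_graph_edgeE[OF G] by metis
    have "y \<notin> S" using f y x by (auto simp: cut_def)
    then show "f \<in> insert {u, v} ((\<lambda>x. {w, x}) ` (nb E w \<inter> S))"
      using out[of x y] x y by (cases "y = w") (auto simp: nb_def insert_commute)
  qed
  then have "card (cut E S) \<le> card (insert {u, v} ((\<lambda>x. {w, x}) ` (nb E w \<inter> S)))"
    using fin by (intro card_mono) auto
  also have "\<dots> \<le> Suc (card (nb E w \<inter> S))"
    using fin by (simp add: card_insert_if card_image[OF inj])
  finally have "card (cut E S) \<le> Suc (card (nb E w \<inter> S))" .
  moreover have "3 \<le> card (cut E S)"
    by (rule min) (use \<open>S \<noteq> {}\<close> w wS SY in auto)
  ultimately have two: "2 \<le> card (nb E w \<inter> S)" by simp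
  have "cut E (insert w S) \<subseteq> insert {u, v} ((\<lambda>x. {w, x}) ` (nb E w - S))"
  proof
    fix f assume f: "f \<in> cut E (insert w S)"
    then obtain x where x: "x \<in> f" "x \<in> insert w S" "f \<in> E" by (auto simp: cut_def)
    then obtain y where y: "f = {x, y}" using simple_graph_edgeE[OF G] by metis
    have "y \<notin> S" "y \<noteq> w" using f y x by (auto simp: cut_def)
    then show "f \<in> insert {u, v} ((\<lambda>x. {w, x}) ` (nb E w - S))"
      using out[of x y] x y by (cases "x = w") (auto simp: nb_def)
  qed
  then have "card (cut E (insert w S)) \<le> card (insert {u, v} ((\<lambda>x. {w, x}) ` (nb E w - S)))"
    using fin by (intro card_mono) auto
  also have "\<dots> \<le> Suc (card (nb E w - S))"
    using fin by (simp add: card_insert_if card_image[OF inj])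
  also have "card (nb E w - S) = 3 - card (nb E w \<inter> S)"
    using card_nb[of w] w YV fin by (auto simp: card_Diff_subset_Int)
  finally have "card (cut E (insert w S)) \<le> Suc (3 - card (nb E w \<inter> S))" .
  then have YS: "insert w S = Y" using min[of "insert w S"] two w SY by fastforce
  have "a \<notin> S" "c \<notin> S" using SY ac by auto
  then have ab: "b \<in> S \<Longrightarrow> {a, b} = {u, v}" and cd: "d \<in> S \<Longrightarrow> {c, d} = {u, v}"
    using out[of b a] out[of d c] abE cdE wac by (auto simp: insert_commute)
  have neq': "{a, b} \<noteq> {c, d}" using neq ac bd by (auto simp: doubleton_eq_iff)
  have "b = w \<or> b \<in> S" "d = w \<or> d \<in> S" using YS bd by auto
  then show False using ab cd ex neq' bd by metis
qed

text \<open>The generic configuration has the two leaving edges horizontal and vertical. The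
  undecided incidences allow \<open>d\<close> on the horizontal line of \<open>b\<close> or
  \<open>b\<close> on the vertical line of \<open>d\<close>. In both cases a half-turn, if
  necessary, takes the other terminal off the ray.\<close>

lemma corner:
  assumes neq: "a \<noteq> c"
  shows "corner E Y b d"
proof -
  obtain \<kappa> :: "'a set \<Rightarrow> dir" where \<kappa>: "proper E' \<kappa>" "\<kappa> {a, b} = Dh" "\<kappa> {c, d} = Dv"
    using ex_colouring[OF neq] by blast
  define Q where "Q = {(u, v, w). {u, v} \<in> E' \<and> w \<in> Y - {u, v} \<and>
    \<not> ({u, v} = {a, b} \<and> w = d) \<and> \<not> ({u, v} = {c, d} \<and> w = b)}"
  have finQ: "finite Q"
    by (rule finite_subset[of _ "V' \<times> V' \<times> Y"])
      (use simple_graph_edgeD[OF G'] finY in \<open>auto simp: Q_def V'_def\<close>)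
  have Q: "{u, v} \<in> E' \<and> w \<in> V' - {u, v} \<and> \<not> (\<exists>\<omega>. stress V' E' \<kappa> u v w \<omega>)" if q: "(u, v, w) \<in> Q" for u v w
    using q no_stress[OF neq \<kappa>(1), of u v w] by (simp add: Q_def V'_def)
  obtain f where f: "conforms E' \<kappa> f"
    and fQ: "\<forall>(u, v, w)\<in>Q. nrm (\<kappa> {u, v}) \<bullet> f w \<noteq> nrm (\<kappa> {u, v}) \<bullet> f u"
    using stress_free_configuration[OF G' finQ Q] by blast
  have free: "nrm (\<kappa> {u, v}) \<bullet> f w \<noteq> nrm (\<kappa> {u, v}) \<bullet> f u"
    if uvw: "{u, v} \<in> E" "u \<in> Y" "v \<in> Y" "w \<in> Y - {u, v}" for u v w
  proof -
    have "a \<notin> {u, v}" "c \<notin> {u, v}" using uvw ac by auto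
    then have "{u, v} \<noteq> {a, b}" "{u, v} \<noteq> {c, d}" by blast+
    then have "(u, v, w) \<in> Q" using uvw by (simp add: Q_def E'_def)
    then show ?thesis using fQ by auto
  qed
  have conf: "nrm (\<kappa> {u, v}) \<bullet> f u = nrm (\<kappa> {u, v}) \<bullet> f v" if "{u, v} \<in> E'" for u v
    using f that by (auto simp: conforms_def)
  have inj: "inj_on f Y"
  proof (rule inj_onI, rule ccontr)
    fix x y assume xy: "x \<in> Y" "y \<in> Y" "f x = f y" "x \<noteq> y"
    obtain z where "{x, z} \<in> E" "z \<in> Y" "z \<noteq> y" using inner_neighbour[OF xy(1)] by blast
    then show False using free[of x z y] xy by auto
  qed
  have D: "basic_drawing Y (ind E Y) f"
    unfolding basic_drawing_def
  proof (intro conjI allI impI ballI inj)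
    fix u v assume "{u, v} \<in> ind E Y"
    then have uv: "{u, v} \<in> E" "u \<in> Y" "v \<in> Y" "{u, v} \<in> E'" by (auto simp: ind_def E'_def)
    show "basic_dir (f u - f v)"
      using conf[OF uv(4)] by (intro basic_dir_nrm[of "\<kappa> {u, v}"]) (simp add: inner_diff_right)
    show "f w \<notin> closed_segment (f u) (f v)" if "w \<in> Y - {u, v}" for w
      using inner_on_segment[of "f w" "f u" "f v" "nrm (\<kappa> {u, v})"] conf[OF uv(4)] free[OF uv(1-3) that] by auto
  qed
  have abE': "{a, b} \<in> E'" "{c, d} \<in> E'" using abE cdE bd by (auto simp: E'_def)
  have neq': "{a, b} \<noteq> {c, d}" using neq ac bd by (auto simp: doubleton_eq_iff)
  have bx: "snd (f w) \<noteq> snd (f b)" if w: "w \<in> Y" "w \<noteq> b" "w \<noteq> d" for w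
  proof -
    have "(a, b, w) \<in> Q" using w abE' ac neq' by (auto simp: Q_def)
    then have "nrm (\<kappa> {a, b}) \<bullet> f w \<noteq> nrm (\<kappa> {a, b}) \<bullet> f a" using fQ by auto
    then show ?thesis using conf[OF abE'(1)] by (simp add: \<kappa> inner_prod_def)
  qed
  have dy: "fst (f w) \<noteq> fst (f d)" if w: "w \<in> Y" "w \<noteq> b" "w \<noteq> d" for w
  proof -
    have "(c, d, w) \<in> Q" using w abE' ac neq' by (auto simp: Q_def)
    then have "nrm (\<kappa> {c, d}) \<bullet> f w \<noteq> nrm (\<kappa> {c, d}) \<bullet> f c" using fQ by auto
    then show ?thesis using conf[OF abE'(2)] by (simp add: \<kappa> inner_prod_def)
  qed
  have fbd: "f b \<noteq> f d" using inj bd by (auto simp: inj_on_def)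
  define p where "p = fst (f b) - fst (f d)"
  define q where "q = snd (f d) - snd (f b)"
  have pq: "p \<noteq> 0 \<or> q \<noteq> 0" using fbd by (auto simp: p_def q_def prod_eq_iff)
  have "\<exists>\<sigma> :: real. \<sigma> \<noteq> 0 \<and> (q = 0 \<longrightarrow> 0 \<le> \<sigma> * p) \<and> (p = 0 \<longrightarrow> 0 \<le> \<sigma> * q)"
  proof (cases "q = 0")
    case True
    then show ?thesis using pq by (intro exI[of _ p]) simp
  next
    case False
    then show ?thesis by (intro exI[of _ q]) simp
  qed
  then obtain \<sigma> where \<sigma>: "\<sigma> \<noteq> 0" "q = 0 \<Longrightarrow> 0 \<le> \<sigma> * p" "p = 0 \<Longrightarrow> 0 \<le> \<sigma> * q" by blast
  \<comment> \<open>The origin is the point where the horizontal line through \<open>b\<close> meets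
    the vertical line through \<open>d\<close>.\<close>
  define t where "t = (- \<sigma> * fst (f d), - \<sigma> * snd (f b))"
  define g where "g = (\<lambda>x. t + rot (\<sigma>, 0) (f x))"
  have g: "fst (g x) = \<sigma> * (fst (f x) - fst (f d))" "snd (g x) = \<sigma> * (snd (f x) - snd (f b))" for x
    by (simp_all add: g_def t_def algebra_simps)
  have "basic_drawing Y (ind E Y) g"
    unfolding g_def by (rule basic_drawing_transform[OF D]) (use \<sigma> in \<open>auto simp: zero_prod_def basic_dir_def\<close>)
  then show ?thesis
  proof (rule cornerI)
    show "snd (g b) = 0" "fst (g d) = 0" by (simp_all add: g)
    show "fst (g y) \<le> fst (g b)" if y: "y \<in> Y" "snd (g y) = 0" for y
    proof -
      have "snd (f y) = snd (f b)" using y \<sigma> by (simp add: g)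
      then have "y = b \<or> y = d \<and> q = 0" using bx[of y] y by (auto simp: q_def)
      then show ?thesis using \<sigma>(2) by (auto simp: g p_def)
    qed
    show "snd (g y) \<le> snd (g d)" if y: "y \<in> Y" "fst (g y) = 0" for y
    proof -
      have "fst (f y) = fst (f d)" using y \<sigma> by (simp add: g)
      then have "y = d \<or> y = b \<and> p = 0" using dy[of y] y by (auto simp: p_def)
      then show ?thesis using \<sigma>(3) by (auto simp: g q_def)
    qed
  qed
qed

end

lemma cross_nonzero:
  assumes "nrm s \<bullet> p = 0" "p \<noteq> 0" "nrm s \<bullet> q \<noteq> 0"
  shows "fst p * snd q \<noteq> fst q * snd p"
proof (cases s)
  case Dn
  then have "snd p = - fst p" "fst p \<noteq> 0" "fst q + snd q \<noteq> 0"
    using assms by (auto simp: inner_prod_def prod_eq_iff)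
  then have "fst p * (fst q + snd q) \<noteq> 0" by simp
  then show ?thesis using \<open>snd p = - fst p\<close> by (simp add: algebra_simps)
qed (use assms in \<open>auto simp: inner_prod_def prod_eq_iff\<close>)

lemma basic_drawing_subset: "basic_drawing V E f \<Longrightarrow> F \<subseteq> E \<Longrightarrow> basic_drawing V F f"
  unfolding basic_drawing_def by (elim conjE, intro conjI allI impI) (simp_all add: subset_iff)

lemma finite_axis_crossing:
  fixes p q :: "real \<times> real"
  assumes "\<not> (snd p = 0 \<and> snd q = 0)"
  shows "finite {t. (t, 0) \<in> closed_segment p q}"
proof (rule finite_subset)
  let ?u = "snd p / (snd p - snd q)"
  show "{t. (t, 0) \<in> closed_segment p q} \<subseteq> {(1 - ?u) * fst p + ?u * fst q}"
  proof
    fix t assume "t \<in> {t. (t, 0) \<in> closed_segment p q}"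
    then obtain u where u: "(t, 0) = (1 - u) *\<^sub>R p + u *\<^sub>R q" by (auto simp: closed_segment_def)
    have t: "t = (1 - u) * fst p + u * fst q" and z: "(1 - u) * snd p + u * snd q = 0"
      using arg_cong[OF u, of fst] arg_cong[OF u, of snd] by simp_all
    have "u * (snd p - snd q) = snd p" using z by (simp add: algebra_simps)
    moreover have "snd p - snd q \<noteq> 0" using calculation assms by auto
    ultimately have "u = ?u" by (simp add: field_simps)
    then show "t \<in> {(1 - ?u) * fst p + ?u * fst q}" using t by simp
  qed
qed simp

section \<open>Minimal pieces drawn through their three-edge-connected closure\<close>

context minimal_piece
begin

text \<open>If a set contains only one of \<open>b\<close> and \<open>d\<close>, the new edge
  replaces the leaving edge in its cut; if it contains neither, its cut loses nothing. If it
  contains both, its complement within \<open>Y\<close> has the same cut in the closure.\<close>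

lemma closure_three_edge_connected:
  assumes bdE: "{b, d} \<notin> E"
  shows "three_edge_connected Y (insert {b, d} (ind E Y))"
proof
  let ?H = "insert {b, d} (ind E Y)"
  show "cubic_graph Y ?H" by (rule closure_cubic[OF bd(3) bdE])
  have GH: "simple_graph Y ?H" using \<open>cubic_graph Y ?H\<close> by (simp add: cubic_graph_def)
  have finH: "finite ?H" by (rule finite_edges[OF GH])
  have finE: "finite E" by (rule finite_edges[OF G])
  show "Y \<noteq> {}" using bd by auto
  have inside: "e \<in> cut ?H S \<or> e = {a, b} \<and> b \<in> S \<or> e = {c, d} \<and> d \<in> S"
    if e: "e \<in> cut E S" and S: "S \<subseteq> Y" for e S
  proof (cases "e \<subseteq> Y")
    case True
    then show ?thesis using e by (auto simp: cut_def ind_def)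
  next
    case False
    obtain x where x: "x \<in> e" "x \<in> S" "e \<in> E" using e by (auto simp: cut_def)
    then obtain y where y: "e = {x, y}" using simple_graph_edgeE[OF G] by metis
    then have "y \<notin> Y" using x False S by auto
    then have "y = a \<and> x = b \<or> y = c \<and> x = d" using leaving[of x y] x y S by auto
    then show ?thesis using x y by (auto simp: insert_commute)
  qed
  have one: "3 \<le> card (cut ?H S)" if S: "S \<subseteq> Y" "S \<noteq> {}" "S \<noteq> Y" and nb: "\<not> (b \<in> S \<and> d \<in> S)" for S
  proof (cases "b \<in> S \<or> d \<in> S")
    case False
    then have "cut E S \<subseteq> cut ?H S" using inside[OF _ S(1)] by blast
    then have "card (cut E S) \<le> card (cut ?H S)" using finH by (intro card_mono) (auto simp: cut_def)
    then show ?thesis using min[OF S] by simp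
  next
    case True
    define e where "e = (if b \<in> S then {a, b} else {c, d})"
    have "cut E S - {e} \<subseteq> cut ?H S" using inside[OF _ S(1)] nb True by (auto simp: e_def)
    moreover have "{b, d} \<in> cut ?H S" using True nb by (auto simp: cut_def)
    ultimately have "insert {b, d} (cut E S - {e}) \<subseteq> cut ?H S" by blast
    then have "card (insert {b, d} (cut E S - {e})) \<le> card (cut ?H S)" using finH by (intro card_mono) (auto simp: cut_def)
    moreover have fc: "finite (cut E S)" using finE by (simp add: cut_def)
    moreover have "{b, d} \<notin> cut E S - {e}" using bdE by (auto simp: cut_def)
    ultimately have "Suc (card (cut E S - {e})) \<le> card (cut ?H S)" by simp
    moreover have "card (cut E S) - 1 \<le> card (cut E S - {e})" using fc by (simp add: card_Diff_singleton_if)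
    ultimately show ?thesis using min[OF S] by linarith
  qed
  show "3 \<le> card (cut ?H S)" if S: "S \<subseteq> Y" "S \<noteq> {}" "S \<noteq> Y" for S
  proof (cases "b \<in> S \<and> d \<in> S")
    case False
    then show ?thesis by (rule one[OF S])
  next
    case True
    have "cut ?H S = cut ?H (Y - S)" by (rule cut_complement[OF GH S(1), symmetric])
    moreover have "3 \<le> card (cut ?H (Y - S))" by (rule one) (use S True in auto)
    ultimately show ?thesis by simp
  qed
qed

text \<open>The closure has a drawing in which the line of \<open>bd\<close> contains no other
  vertex. Removing this edge leaves a drawing of the piece whose terminals can be reached along that
  line.\<close>

lemma axis_drawing:
  assumes bdE: "{b, d} \<notin> E"
  shows "\<exists>g L. basic_drawing Y (ind E Y) g \<and> 0 < L \<and> g b = 0 \<and> g d = (L, 0) \<and>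
    (\<forall>y\<in>Y - {b, d}. snd (g y) \<noteq> 0)"
proof -
  let ?H = "insert {b, d} (ind E Y)"
  interpret H: three_edge_connected Y ?H by (rule closure_three_edge_connected[OF bdE])
  obtain f where f: "basic_drawing Y ?H f"
    and line: "\<forall>u v. {u, v} \<in> ?H \<longrightarrow> (\<exists>s. nrm s \<bullet> f u = nrm s \<bullet> f v \<and> (\<forall>w\<in>Y - {u, v}. nrm s \<bullet> f w \<noteq> nrm s \<bullet> f u))"
    using H.line_free_drawing by blast
  obtain s where s: "nrm s \<bullet> f b = nrm s \<bullet> f d" "\<forall>w\<in>Y - {b, d}. nrm s \<bullet> f w \<noteq> nrm s \<bullet> f b"
    using line[rule_format, of b d] by auto
  define \<delta> where "\<delta> = f d - f b"
  have inj: "inj_on f Y" using f by (simp add: basic_drawing_def)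
  have \<delta>0: "\<delta> \<noteq> 0" using inj_onD[OF inj, of d b] bd by (auto simp: \<delta>_def)
  have \<delta>s: "nrm s \<bullet> \<delta> = 0" using s(1) by (simp add: \<delta>_def inner_diff_right)
  have \<delta>b: "basic_dir \<delta>" by (rule basic_dir_nrm[OF \<delta>s])
  \<comment> \<open>The complex conjugate of \<delta>; their product is positive, so
    \<open>d\<close> lands on the positive horizontal axis.\<close>
  define \<eta> where "\<eta> = (fst \<delta>, - snd \<delta>)"
  define g where "g = (\<lambda>x. - rot \<eta> (f b) + rot \<eta> (f x))"
  have "basic_drawing Y (ind E Y) f" by (rule basic_drawing_subset[OF f]) auto
  then have "basic_drawing Y (ind E Y) g"
    unfolding g_def by (rule basic_drawing_transform)
      (use \<delta>0 \<delta>b in \<open>auto simp: \<eta>_def basic_dir_def prod_eq_iff\<close>)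
  moreover have "g b = 0" by (simp add: g_def)
  moreover have "g d = ((fst \<delta>)\<^sup>2 + (snd \<delta>)\<^sup>2, 0)"
    by (simp add: g_def \<eta>_def \<delta>_def prod_eq_iff power2_eq_square algebra_simps)
  moreover have "0 < (fst \<delta>)\<^sup>2 + (snd \<delta>)\<^sup>2"
    using \<delta>0 by (simp add: sum_power2_gt_zero_iff prod_eq_iff)
  moreover have "snd (g y) \<noteq> 0" if y: "y \<in> Y - {b, d}" for y
  proof -
    have "nrm s \<bullet> (f y - f b) \<noteq> 0" using s(2) y by (simp add: inner_diff_right)
    from cross_nonzero[OF \<delta>s \<delta>0 this] show ?thesis
      by (simp add: g_def \<eta>_def algebra_simps)
  qed
  ultimately show ?thesis by blast
qed

lemma straight:
  assumes bdE: "{b, d} \<notin> E"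
  shows "straight E Y b d"
proof -
  obtain g L where g: "basic_drawing Y (ind E Y) g" "0 < L" "g b = 0" "g d = (L, 0)"
    and off: "\<forall>y\<in>Y - {b, d}. snd (g y) \<noteq> 0"
    using axis_drawing[OF bdE] by blast
  have axis: "y = b \<or> y = d" if "y \<in> Y" "snd (g y) = 0" for y using off that by auto
  show ?thesis
  proof (rule straightI[OF g(1)])
    show "fst (g b) \<le> fst (g y)" if "y \<in> Y" "snd (g y) = 0" for y
      using axis[OF that] g(2-4) by auto
    show "fst (g y) \<le> fst (g d)" if "y \<in> Y" "snd (g y) = 0" for y
      using axis[OF that] g(2-4) by auto
  qed (use g in auto)
qed

text \<open>The common outer vertex is placed on the axis between \<open>b\<close> and
  \<open>d\<close>, where only finitely many positions are blocked by edges of the piece. Its third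
  edge can then leave at a right angle.\<close>

lemma closable:
  assumes bdE: "{b, d} \<notin> E" and eq: "a = c"
  shows "closable E Y a"
proof -
  obtain g L where g: "basic_drawing Y (ind E Y) g" "0 < L" "g b = 0" "g d = (L, 0)"
    and off: "\<forall>y\<in>Y - {b, d}. snd (g y) \<noteq> 0"
    using axis_drawing[OF bdE] by blast
  have axis: "y = b \<or> y = d" if "y \<in> Y" "snd (g y) = 0" for y using off that by auto
  define A where "A = {(x, y). {x, y} \<in> E \<and> x \<in> Y \<and> y \<in> Y}"
  have finA: "finite A" by (rule finite_subset[of _ "Y \<times> Y"]) (use finY in \<open>auto simp: A_def\<close>)
  have crossing: "finite {t. (t, 0) \<in> closed_segment (g x) (g y)}" if xy: "(x, y) \<in> A" for x y
  proof (rule finite_axis_crossing, rule notI)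
    assume "snd (g x) = 0 \<and> snd (g y) = 0"
    then have "x = b \<or> x = d" "y = b \<or> y = d" using axis xy by (auto simp: A_def)
    moreover have "{x, y} \<in> E" "x \<noteq> y" using xy simple_graph_edgeD(3)[OF G, of x y] by (auto simp: A_def)
    ultimately show False using bdE by (auto simp: insert_commute)
  qed
  \<comment> \<open>The abscissas of the vertices are excluded as well, so that the vertical line
    through the new vertex is free.\<close>
  define B where "B = (\<lambda>y. fst (g y)) ` Y \<union> (\<Union>(x, y)\<in>A. {t. (t, 0) \<in> closed_segment (g x) (g y)})"
  have "finite B" using finY finA crossing by (auto simp: B_def)
  moreover have "infinite {0<..<L}" using g(2) by simp
  ultimately have "infinite ({0<..<L} - B)" by (rule Diff_infinite_finite)
  then have "{0<..<L} - B \<noteq> {}" by (metis finite.emptyI)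
  then obtain t where "t \<in> {0<..<L} - B" by blast
  then have t: "0 < t" "t < L" "t \<notin> B" by auto
  have tx: "fst (g y) \<noteq> t" if "y \<in> Y" for y using t that by (auto simp: B_def)
  have tseg: "(t, 0) \<notin> closed_segment (g x) (g y)" if "{x, y} \<in> E" "x \<in> Y" "y \<in> Y" for x y
    using t that by (auto simp: B_def A_def)
  have nba: "y = b \<or> y = d" if "y \<in> nb E a \<inter> Y" for y
    using leaving[of y a] that ac by (auto simp: nb_def insert_commute)
  define h where "h = g(a := (t, 0))"
  have D: "basic_drawing (insert a Y) (ind E (insert a Y)) h"
    unfolding h_def
  proof (rule basic_drawing_insert[OF G g(1) ac(1)])
    show "(t, 0) \<noteq> g y" if "y \<in> Y" for y using tx[OF that] by (metis fst_conv)
    show "(t, 0) \<notin> closed_segment (g x) (g y)" if "{x, y} \<in> E" "x \<in> Y" "y \<in> Y" for x y by (rule tseg[OF that])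
    show "basic_dir ((t, 0) - g y)" if "y \<in> nb E a \<inter> Y" for y
      using nba[OF that] g by (auto simp: basic_dir_def)
    show "g y \<notin> closed_segment (t, 0) (g z)" if z: "z \<in> nb E a \<inter> Y" and y: "y \<in> Y - {z}" for z y
    proof
      assume s: "g y \<in> closed_segment (t, 0) (g z)"
      have z': "z = b \<or> z = d" by (rule nba[OF z])
      then have z0: "snd (g z) = 0" using g by auto
      have "snd (g y) = 0" using segment_const[OF s, of "(0, 1)" 0] z0 by (simp add: inner_prod_def)
      then have y': "y = b \<or> y = d" using axis y by auto
      show False
      proof (cases "z = b")
        case True
        then have "y = d" using y y' by auto
        then show False using on_x_axis[OF s] g t True by auto
      next
        case False
        then have "z = d" "y = b" using z' y y' by auto
        moreover have "g y \<in> closed_segment (g z) (t, 0)" using s by (simp add: closed_segment_commute)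
        ultimately show False using on_x_axis[of "g y" "g z" "(t, 0)"] g t by auto
      qed
    qed
  qed
  have h: "h a = (t, 0)" "\<And>y. y \<in> Y \<Longrightarrow> h y = g y" using ac by (auto simp: h_def)
  have "basic_drawing (insert a Y) (ind E (insert a Y)) (\<lambda>x. (0, t) + rot (0, - 1) (h x))"
    by (rule basic_drawing_transform[OF D]) (auto simp: basic_dir_def zero_prod_def)
  then show ?thesis
  proof (rule closableI)
    show "(0, t) + rot (0, - 1) (h a) = 0" by (simp add: h prod_eq_iff)
    fix y assume "y \<in> Y" "snd ((0, t) + rot (0, - 1) (h y)) = 0"
    then show "fst ((0, t) + rot (0, - 1) (h y)) < 0" using tx[of y] h by simp
  qed
qed

end

subsection \<open>The induction\<close>

lemma two_edge_cutI:
  assumes "cubic_graph V E" "Y \<subseteq> V" "{a, b} \<in> E" "{c, d} \<in> E" "{a, b} \<noteq> {c, d}"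
    "b \<in> Y" "d \<in> Y" "a \<notin> Y" "c \<notin> Y"
    and out: "\<And>x y. {x, y} \<in> E \<Longrightarrow> x \<in> Y \<Longrightarrow> y \<notin> Y \<Longrightarrow> x = b \<and> y = a \<or> x = d \<and> y = c"
  shows "two_edge_cut V E Y a b c d"
proof
  have G: "simple_graph V E" using assms(1) by (simp add: cubic_graph_def)
  show "cut E Y = {{a, b}, {c, d}}"
  proof (intro equalityI subsetI)
    fix e assume e: "e \<in> cut E Y"
    then obtain x where x: "x \<in> e" "x \<in> Y" "e \<in> E" by (auto simp: cut_def)
    then obtain y where y: "e = {x, y}" using simple_graph_edgeE[OF G] by metis
    have "y \<notin> Y" using e x y by (auto simp: cut_def)
    then have "x = b \<and> y = a \<or> x = d \<and> y = c" using out x y by metis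
    then show "e \<in> {{a, b}, {c, d}}" using y by auto
  next
    fix e assume "e \<in> {{a, b}, {c, d}}"
    then show "e \<in> cut E Y" using assms by (auto simp: cut_def)
  qed
qed (use assms in auto)

lemma third_element:
  assumes "card S = 3" "p \<in> S" "q \<in> S" "p \<noteq> q"
  shows "\<exists>r. S = {p, q, r} \<and> r \<noteq> p \<and> r \<noteq> q"
proof -
  have fin: "finite S" using assms(1) by (metis card.infinite zero_neq_numeral)
  have "card (S - {p, q}) = 1" using assms fin by (simp add: card_Diff_subset)
  then obtain r where "S - {p, q} = {r}" by (auto simp: card_1_singleton_iff)
  then show ?thesis using assms by (intro exI[of _ r]) auto
qed

text \<open>If \<open>a\<close> and \<open>c\<close> are distinct and not adjacent, closing the
  complement by the edge \<open>ac\<close> gives a smaller cubic graph, and the piece is inserted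
  into that edge. Otherwise the new edge would be a loop or a double edge; the piece then absorbs
  \<open>a\<close> with its third neighbour, or \<open>a\<close> with \<open>c\<close>. The corner
  and closing drawings are what these two enlargements require.\<close>

lemma grow_piece:
  fixes V :: "'a set"
  assumes IH: "\<And>(V' :: 'a set) E'. card V' < card V \<Longrightarrow> cubic_graph V' E' \<Longrightarrow> \<exists>f. basic_drawing V' E' f"
    and "two_edge_cut V E Y a b c d" "straight E Y b d"
    and "a \<noteq> c \<Longrightarrow> corner E Y b d" "a = c \<Longrightarrow> closable E Y a"
  shows "\<exists>f. basic_drawing V E f"
  using assms(2-)
proof (induction "card (V - Y)" arbitrary: Y a b c d rule: less_induct)
  case less
  interpret two_edge_cut V E Y a b c d by (rule less.prems(1))
  have finV: "finite V" using G by (simp add: simple_graph_def)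
  have smaller: "card (V - insert x (insert y Y)) < card (V - Y)" if "x \<in> V" "x \<notin> Y" for x y
    by (rule psubset_card_mono) (use finV that in auto)
  have enter: "y = b \<and> x = a \<or> y = d \<and> x = c" if "{x, y} \<in> E" "y \<in> Y" "x \<notin> Y" for x y
    using leaving[of y x] that by (auto simp: insert_commute)
  have nbE: "y \<in> nb E x \<longleftrightarrow> {x, y} \<in> E" for x y by (simp add: nb_def)
  show ?case
  proof (cases "a = c")
    case True
    have bd: "b \<noteq> d" using two True by auto
    have "card (nb E a) = 3" "b \<in> nb E a" "d \<in> nb E a" using card_nb outside abE cdE True by (auto simp: nbE)
    then obtain h where h: "nb E a = {b, d, h}" "h \<noteq> b" "h \<noteq> d" using third_element[of "nb E a" b d] bd by auto
    have ahE: "{a, h} \<in> E" using h by (auto simp: nbE[symmetric])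
    have hV: "h \<in> V" "h \<noteq> a" using simple_graph_edgeD[OF G ahE] by auto
    have hY: "h \<notin> insert a Y" using enter[OF ahE] h ac hV by auto
    have nbhY: "nb E h \<inter> insert a Y = {a}"
    proof -
      have "y = a" if "{h, y} \<in> E" "y \<in> insert a Y" for y using enter[of h y] that hY True by auto
      moreover have "{h, a} \<in> E" using ahE by (simp add: insert_commute)
      ultimately show ?thesis by (auto simp: nbE)
    qed
    let ?Y = "insert h (insert a Y)"
    note H = hang[OF G less.prems(4)[OF True] finY ac(1) hY nbhY]
    have "card (nb E h) = 3" "a \<in> nb E h" using card_nb hV ahE by (auto simp: nbE insert_commute)
    moreover have "card (nb E h) \<le> card {a}" if "nb E h - {a} = {}"
      by (rule card_mono) (use that in auto)
    ultimately have "nb E h - {a} \<noteq> {}" by auto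
    then obtain h1 where h1: "h1 \<in> nb E h" "h1 \<noteq> a" by auto
    obtain h2 where h2: "nb E h = {a, h1, h2}" "h2 \<noteq> a" "h2 \<noteq> h1"
      using third_element[OF \<open>card (nb E h) = 3\<close> \<open>a \<in> nb E h\<close> h1(1)] h1(2) by auto
    have hE: "{h, h1} \<in> E" "{h, h2} \<in> E" using h2 by (auto simp: nbE[symmetric])
    have out: "y \<notin> ?Y" if "{h, y} \<in> E" "y \<noteq> a" for y
    proof -
      have "y \<in> insert a Y \<Longrightarrow> y \<in> nb E h \<inter> insert a Y" using that by (simp add: nbE)
      then have "y \<notin> insert a Y" using that nbhY by auto
      moreover have "y \<noteq> h" using simple_graph_edgeD[OF G that(1)] by auto
      ultimately show ?thesis by simp
    qed
    have C: "two_edge_cut V E ?Y h1 h h2 h"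
    proof (rule two_edge_cutI[OF cubic])
      show "?Y \<subseteq> V" using YV hV outside by auto
      show "{h1, h} \<in> E" "{h2, h} \<in> E" using hE by (simp_all add: insert_commute)
      show "{h1, h} \<noteq> {h2, h}" using h2 by (auto simp: doubleton_eq_iff)
      show "h1 \<notin> ?Y" "h2 \<notin> ?Y" using out[OF hE(1)] out[OF hE(2)] h1 h2 by auto
      show "x = h \<and> y = h1 \<or> x = h \<and> y = h2" if xy: "{x, y} \<in> E" "x \<in> ?Y" "y \<notin> ?Y" for x y
      proof -
        have "x \<notin> Y" using leaving[of x y] xy True by auto
        moreover have "x \<noteq> a"
        proof
          assume "x = a"
          then have "y \<in> nb E a" using xy by (simp add: nbE)
          then show False using h xy ends by auto
        qed
        ultimately have "x = h" using xy by auto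
        then have "y \<in> nb E h" using xy by (simp add: nbE)
        then show ?thesis using h2 xy \<open>x = h\<close> by auto
      qed
    qed auto
    show ?thesis
      by (rule less.hyps[OF _ C H(1)]) (use smaller[OF hV(1)] hY H(2) h2(3) in auto)
  next
    case neq: False
    show ?thesis
    proof (cases "{a, c} \<in> E")
      case False
      interpret X: two_edge_cut V E "V - Y" b a d c by (rule complement)
      have cubX: "cubic_graph (V - Y) (insert {a, c} (ind E (V - Y)))" by (rule X.closure_cubic[OF neq False])
      have "card (V - Y) < card V" by (rule psubset_card_mono) (use finV ends YV in auto)
      from IH[OF this cubX] obtain F where F: "basic_drawing (V - Y) (insert {a, c} (ind E (V - Y))) F" by blast
      show ?thesis
      proof (rule insert_straight_piece[OF G _ _ less.prems(2) ends _ _ neq False _ F])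
        show "V = (V - Y) \<union> Y" "(V - Y) \<inter> Y = {}" using YV by auto
        show "a \<in> V - Y" "c \<in> V - Y" using outside ac by auto
        show "{x, y} \<in> E \<longleftrightarrow> x = a \<and> y = b \<or> x = c \<and> y = d" if "x \<in> V - Y" "y \<in> Y" for x y
          using enter[of x y] that abE cdE by auto
      qed
    next
      case acE: True
      have caE: "{c, a} \<in> E" using acE by (simp add: insert_commute)
      have "card (nb E a) = 3" "b \<in> nb E a" "c \<in> nb E a" "b \<noteq> c" using card_nb outside abE acE ends ac by (auto simp: nbE)
      then obtain a2 where a2: "nb E a = {b, c, a2}" "a2 \<noteq> b" "a2 \<noteq> c" using third_element[of "nb E a" b c] by auto
      have "card (nb E c) = 3" "d \<in> nb E c" "a \<in> nb E c" "d \<noteq> a" using card_nb outside cdE caE ends ac by (auto simp: nbE)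
      then obtain c2 where c2: "nb E c = {d, a, c2}" "c2 \<noteq> d" "c2 \<noteq> a" using third_element[of "nb E c" d a] by auto
      have aE: "{a, a2} \<in> E" and cE: "{c, c2} \<in> E" using a2 c2 by (auto simp: nbE[symmetric])
      let ?Y = "insert c (insert a Y)"
      have a2Y: "a2 \<notin> ?Y" using enter[OF aE] ac a2 neq simple_graph_edgeD[OF G aE] by auto
      have c2Y: "c2 \<notin> ?Y" using enter[OF cE] ac c2 neq simple_graph_edgeD[OF G cE] by auto
      have na: "nb E a \<inter> Y = {b}" using a2 a2Y ac ends by auto
      have nc: "nb E c \<inter> insert a Y = {a, d}" using c2 c2Y ac ends by auto
      note L = ladder[OF G less.prems(3)[OF neq] finY ends ac neq na nc]
      have C: "two_edge_cut V E ?Y c2 c a2 a"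
      proof (rule two_edge_cutI[OF cubic])
        show "?Y \<subseteq> V" using YV outside by auto
        show "{c2, c} \<in> E" "{a2, a} \<in> E" using aE cE by (simp_all add: insert_commute)
        show "{c2, c} \<noteq> {a2, a}" using neq a2 by (auto simp: doubleton_eq_iff)
        show "x = c \<and> y = c2 \<or> x = a \<and> y = a2" if xy: "{x, y} \<in> E" "x \<in> ?Y" "y \<notin> ?Y" for x y
        proof -
          have "x \<notin> Y" using leaving[of x y] xy by auto
          then have "x = a \<or> x = c" using xy by auto
          moreover have "y \<in> nb E x" using xy by (simp add: nbE)
          ultimately show ?thesis using a2 c2 xy ends by auto
        qed
      qed (use a2Y c2Y in auto)
      have clos: "closable E ?Y c2" if eq: "c2 = a2"
      proof (rule L(3)[OF c2Y])
        have "y \<in> {a, c}" if "{c2, y} \<in> E" "y \<in> ?Y" for y using enter[of c2 y] that c2Y by auto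
        moreover have "{c2, a} \<in> E" "{c2, c} \<in> E" using aE cE eq by (simp_all add: insert_commute)
        ultimately show "nb E c2 \<inter> ?Y = {a, c}" unfolding nb_def by blast
      qed
      show ?thesis
        by (rule less.hyps[OF _ C L(1)]) (use smaller[OF outside(2) ac(2)] L(2) clos in auto)
    qed
  qed
qed

text \<open>The inner ends of the cut edges of \<open>S\<close> all lie in \<open>T\<close>, so an
  edge leaving \<open>S - T\<close> must go to \<open>T\<close> and is neither in the old cut nor
  inside \<open>T\<close>. This bounds the cut after the terminals are stripped off.\<close>

lemma cut_diff_subset:
  assumes G: "simple_graph V E" and T: "T \<subseteq> S" "\<And>e. e \<in> cut E S \<Longrightarrow> e \<inter> S \<subseteq> T"
  shows "cut E (S - T) \<subseteq> (\<Union>x\<in>T. {e \<in> E. x \<in> e} - cut E S - {e. e \<subseteq> T})"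
proof
  fix e assume e: "e \<in> cut E (S - T)"
  then obtain x where x: "x \<in> e" "x \<in> S - T" "e \<in> E" by (auto simp: cut_def)
  then obtain y where y: "e = {x, y}" using simple_graph_edgeE[OF G] by metis
  have nc: "e \<notin> cut E S" using T(2)[of e] x by auto
  then have "y \<in> S" using x y by (auto simp: cut_def)
  moreover have "y \<notin> S - T" using e x y by (auto simp: cut_def)
  ultimately have "y \<in> T" by simp
  then show "e \<in> (\<Union>x\<in>T. {e \<in> E. x \<in> e} - cut E S - {e. e \<subseteq> T})" using x y nc by auto
qed

lemma cut_edgeE:
  assumes "simple_graph V E" "e \<in> cut E S"
  obtains x y where "e = {y, x}" "x \<in> S" "y \<notin> S"
proof -
  obtain x where x: "x \<in> e" "x \<in> S" "e \<in> E" using assms by (auto simp: cut_def)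
  then obtain y where "e = {x, y}" using simple_graph_edgeE[OF assms(1)] by metis
  moreover have "y \<notin> S" using assms(2) x calculation by (auto simp: cut_def)
  ultimately show thesis using that x by (simp add: insert_commute)
qed

lemma cubic_induced:
  assumes "cubic_graph V E" "S \<subseteq> V" "cut E S = {}"
  shows "cubic_graph S (ind E S)"
proof -
  have "{e \<in> ind E S. x \<in> e} = {e \<in> E. x \<in> e}" if "x \<in> S" for x
    using assms(3) that by (auto simp: ind_def cut_def)
  then show ?thesis using assms finite_subset
    by (auto simp: cubic_graph_def simple_graph_def vertex_degree_def ind_def)
qed

text \<open>A smallest vertex set left by at most two edges has no such proper subset. An empty cut
  splits the graph, a single edge cannot occur, and two edges make it a minimal piece with distinct,
  non-adjacent terminals, which is then grown.\<close>

lemma cubic_basic_drawing: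
  assumes "cubic_graph V E"
  shows "\<exists>f :: 'a \<Rightarrow> real \<times> real. basic_drawing V E f"
  using assms
proof (induction "card V" arbitrary: V E rule: less_induct)
  case less
  have G: "simple_graph V E" using less.prems by (simp add: cubic_graph_def)
  have finV: "finite V" using G by (simp add: simple_graph_def)
  have finE: "finite E" by (rule finite_edges[OF G])
  have deg: "card {e \<in> E. x \<in> e} = 3" if "x \<in> V" for x
    using less.prems that by (simp add: cubic_graph_def vertex_degree_def)
  define small where "small = (\<lambda>S. S \<subseteq> V \<and> S \<noteq> {} \<and> S \<noteq> V \<and> card (cut E S) \<le> 2)"
  consider "V = {}" | "V \<noteq> {}" "\<nexists>S. small S" | S where "small S" by blast
  then show ?case
  proof cases
    case 1
    then have "basic_drawing V E (\<lambda>_. 0)" using simple_graph_edgeD(1)[OF G] by (auto simp: basic_drawing_def)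
    then show ?thesis by blast
  next
    case 2
    interpret three_edge_connected V E
    proof unfold_locales
      show "cubic_graph V E" by (rule less.prems)
      show "V \<noteq> {}" by (rule 2)
      show "3 \<le> card (cut E S)" if S: "S \<subseteq> V" "S \<noteq> {}" "S \<noteq> V" for S
      proof -
        have "\<not> small S" using 2(2) by blast
        then show ?thesis using S by (simp add: small_def)
      qed
    qed
    show ?thesis using line_free_drawing by blast
  next
    case 3
    then obtain S where S: "small S" and least: "\<And>S'. small S' \<Longrightarrow> card S \<le> card S'"
      using ex_has_least_nat[of small S card] by blast
    have SV: "S \<subseteq> V" "S \<noteq> {}" "S \<noteq> V" and c2: "card (cut E S) \<le> 2" using S by (auto simp: small_def)
    have finS: "finite S" using SV finV finite_subset by blast
    have min: "3 \<le> card (cut E S')" if "S' \<subseteq> S" "S' \<noteq> {}" "S' \<noteq> S" for S'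
    proof (rule ccontr)
      assume "\<not> ?thesis"
      then have "small S'" using that SV by (auto simp: small_def)
      moreover have "card S' < card S" by (rule psubset_card_mono) (use finS that in auto)
      ultimately show False using least by fastforce
    qed
    have fincut: "finite (cut E S)" using finE by (simp add: cut_def)
    \<comment> \<open>If all cut edges have the same inner end \<open>x\<close>, removing
      \<open>x\<close> leaves at most two of its edges in the cut. By minimality \<open>S\<close> is
      \<open>{x}\<close>, whose cut has three edges. This rules out a bridge and a common inner end
      of two cut edges.\<close>
    have single: False if x: "x \<in> S" and e: "e \<in> cut E S" and all: "\<And>e. e \<in> cut E S \<Longrightarrow> e \<inter> S = {x}" for x e
    proof -
      have xV: "x \<in> V" using x SV by auto
      have "x \<in> e" using all[OF e] by auto
      then have fe: "e \<in> {e \<in> E. x \<in> e}" using e by (auto simp: cut_def)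
      have "cut E (S - {x}) \<subseteq> {e \<in> E. x \<in> e} - cut E S"
        using cut_diff_subset[OF G, of "{x}" S] x all by auto
      then have "cut E (S - {x}) \<subseteq> {e \<in> E. x \<in> e} - {e}" using e by auto
      then have "card (cut E (S - {x})) \<le> card ({e \<in> E. x \<in> e} - {e})" using finE by (intro card_mono) auto
      also have "\<dots> = 2" using deg[OF xV] fe finE by simp
      finally have "S - {x} = {}" using min[of "S - {x}"] x by fastforce
      then have "S = {x}" using x by auto
      moreover have "\<not> e \<subseteq> {x}" if "e \<in> E" for e
        using card_mono[of "{x}" e] G that by (auto simp: simple_graph_def)
      ultimately have "cut E S = {e \<in> E. x \<in> e}" by (auto simp: cut_def)
      then show False using c2 deg[OF xV] by simp
    qed
    consider "card (cut E S) = 0" | "card (cut E S) = 1" | "card (cut E S) = 2" using c2 by linarith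
    then show ?thesis
    proof cases
      case 1
      then have c0: "cut E S = {}" using fincut by simp
      then have c0': "cut E (V - S) = {}" using cut_complement[OF G SV(1)] by simp
      have "card S < card V" "card (V - S) < card V"
        by (rule psubset_card_mono; use finV SV in auto)+
      then obtain f g where "basic_drawing S (ind E S) f" "basic_drawing (V - S) (ind E (V - S)) g"
        using less.hyps[OF _ cubic_induced[OF less.prems SV(1) c0]]
          less.hyps[OF _ cubic_induced[OF less.prems _ c0']] by auto
      moreover have "V = S \<union> (V - S)" "S \<inter> (V - S) = {}" using SV by auto
      moreover have "{x, y} \<notin> E" if "x \<in> S" "y \<in> V - S" for x y
      proof
        assume "{x, y} \<in> E"
        then have "{x, y} \<in> cut E S" using that by (auto simp: cut_def)
        then show False using c0 by simp
      qed
      ultimately show ?thesis by (intro basic_drawing_disjoint_union[OF G])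
    next
      case 2
      then obtain e where e: "cut E S = {e}" by (auto simp: card_1_singleton_iff)
      then have "e \<in> cut E S" by simp
      then obtain x y where "e = {y, x}" "x \<in> S" "y \<notin> S" by (rule cut_edgeE[OF G])
      then have False using single[of x e] e by auto
      then show ?thesis ..
    next
      case 3
      then obtain e1 e2 where e: "cut E S = {e1, e2}" "e1 \<noteq> e2" by (auto simp: card_2_iff)
      have "e1 \<in> cut E S" using e by simp
      then obtain b a where ab: "e1 = {a, b}" "b \<in> S" "a \<notin> S" by (rule cut_edgeE[OF G])
      have "e2 \<in> cut E S" using e by simp
      then obtain d c where cd: "e2 = {c, d}" "d \<in> S" "c \<notin> S" by (rule cut_edgeE[OF G])
      have bd: "b \<noteq> d" using single[of b e1] e ab cd by auto
      interpret two_edge_cut V E S a b c d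
        by unfold_locales (use less.prems SV e ab cd in auto)
      interpret minimal_piece V E S a b c d
        by unfold_locales (use bd min in auto)
      \<comment> \<open>If the terminals were adjacent, each would have just one further edge, so
        removing both would leave a cut of at most two edges. Then \<open>S\<close> would consist of
        \<open>b\<close> and \<open>d\<close> only, too few vertices for degree three.\<close>
      have bdE: "{b, d} \<notin> E"
      proof
        assume bdE: "{b, d} \<in> E"
        let ?A = "{e \<in> E. b \<in> e}" and ?B = "{e \<in> E. d \<in> e}"
        have sub: "{b, d} \<subseteq> S" "\<And>e. e \<in> cut E S \<Longrightarrow> e \<inter> S \<subseteq> {b, d}" using e ab cd by auto
        have "cut E (S - {b, d}) \<subseteq> (\<Union>x\<in>{b, d}. {e \<in> E. x \<in> e} - cut E S - {e. e \<subseteq> {b, d}})"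
          by (rule cut_diff_subset[OF G sub])
        also have "\<dots> \<subseteq> (?A - {{a, b}, {b, d}}) \<union> (?B - {{c, d}, {b, d}})" using e ab cd by auto
        finally have "card (cut E (S - {b, d})) \<le> card ((?A - {{a, b}, {b, d}}) \<union> (?B - {{c, d}, {b, d}}))"
          using finE by (intro card_mono) auto
        also have "\<dots> \<le> card (?A - {{a, b}, {b, d}}) + card (?B - {{c, d}, {b, d}})" by (rule card_Un_le)
        also have "card (?A - {{a, b}, {b, d}}) = 1"
        proof -
          have "{a, b} \<noteq> {b, d}" using ab cd by (auto simp: doubleton_eq_iff)
          then show ?thesis using deg[of b] SV ab abE bdE by (subst card_Diff_subset) auto
        qed
        also have "card (?B - {{c, d}, {b, d}}) = 1"
        proof -
          have "{c, d} \<noteq> {b, d}" using ab cd by (auto simp: doubleton_eq_iff)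
          then show ?thesis using deg[of d] SV cd cdE bdE by (subst card_Diff_subset) auto
        qed
        finally have "S - {b, d} = {}" using min[of "S - {b, d}"] ab by fastforce
        then have "S \<subseteq> {b, d}" by auto
        then have "nb E b \<inter> S \<subseteq> {d}" using nb_subset[OF G, of b] by auto
        then have "nb E b \<subseteq> insert d (nb E b - S)" by auto
        then have "card (nb E b) \<le> card (insert d (nb E b - S))" using finite_nb[OF G] by (intro card_mono) auto
        also have "\<dots> \<le> Suc (card (nb E b - S))" by (rule card_insert_le_m1) simp_all
        finally show False using nb_outside[OF ab(2)] card_nb[of b] SV ab by auto
      qed
      show ?thesis
        by (rule grow_piece[OF less.hyps two_edge_cut_axioms straight[OF bdE] corner closable[OF bdE]])
    qed
  qed
qed

theorem theorem1p1:
  fixes V :: "'a set" and E :: "'a set set"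
  assumes "cubic_graph V E"
  shows "\<exists>f :: 'a \<Rightarrow> real \<times> real. straight_line_drawing V E f \<and>
           (\<forall>u v. {u, v} \<in> E \<longrightarrow> slope (f u) (f v) \<in> basic_slopes)"
proof -
  obtain f :: "'a \<Rightarrow> real \<times> real" where f: "basic_drawing V E f" using cubic_basic_drawing[OF assms] by blast
  have "simple_graph V E" using assms by (simp add: cubic_graph_def)
  from basic_drawing_slopes[OF this f] show ?thesis by (rule exI[of _ f])
qed

end
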